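(* Let $M$ be a compact connected $C^{1}$ submanifold (without boundary) of $\mathbb{R}^{n}$, let $\epsilon>0$, and let $(N,F)$ be a given definable $\epsilon$-approximation of $M$. Then the set of all vector fields $X\in\mathcal{X}_{M}$ that do not admit any Lipschitz continuous first integral $f\colon M\to\mathbb{R}$ which is essentially o-minimal with respect to $(N,F)$ is generic in $\mathcal{X}_{M}$ for the $C^{1}$ topology (i.e. it contains a residual subset of $\mathcal{X}_{M}$).
   Context: $\mathcal{X}_{M}$ is the space of $C^{1}$ vector fields on $M$, equipped with the $C^{1}$ topology. A set is residual if it contains a countable intersection of open dense sets. First integral: a first integral of a vector field $X$ on a compact connected manifold $M$ is a continuous function $f\colon M\to\mathbb{R}$ which is constant on the orbits of the flow generated by $X$ but is not constant on any nonempty open subset of $M$. O-minimal structure: an o-minimal structure on the ordered field $\mathbb{R}$ is a sequence $\mathcal{O}=\{\mathcal{O}_{m}\}_{m\ge 1}$, where $\mathcal{O}_{m}$ is a Boolean algebra of subsets of $\mathbb{R}^{m}$, such that for each $m\geq 1$: (i) $A\in\mathcal{O}_{m}$ implies $A\times\mathbb{R}\in\mathcal{O}_{m+1}$ and $\mathbb{R}\times A\in\mathcal{O}_{m+1}$; (ii) $A\in\mathcal{O}_{m+1}$ implies $\Pi(A)\in\mathcal{O}_{m}$, where $\Pi\colon\mathbb{R}^{m+1}\to\mathbb{R}^{m}$ is the canonical projection; (iii) $\mathcal{O}_{m}$ contains all sets $\{x\in\mathbb{R}^{m}:p(x)=0\}$ with $p\colon\mathbb{R}^m\to\mathbb{R}$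 polynomial; (iv) $\mathcal{O}_{1}$ consists exactly of the finite unions of intervals and points. A set $A\subset\mathbb{R}^{m}$ is definable in $\mathcal{O}$ if $A\in\mathcal{O}_{m}$; a function $g\colon S\to\mathbb{R}$, $S\subset\mathbb{R}^{m}$, is definable in $\mathcal{O}$ if its graph is a definable subset of $\mathbb{R}^{m}\times\mathbb{R}$. A function is called o-minimal if it is definable in an o-minimal structure. Approximation: let $N$ be a $C^{1}$ submanifold of $\mathbb{R}^{n}$ and $F\colon M\to N$ a $C^{1}$ diffeomorphism. The pair $(N,F)$ is a $C^{1}$-approximation of $M$ of precision $\epsilon$ (an $\epsilon$-approximation) if $N$ is contained in the $\epsilon$-tubular neighborhood $U_{\epsilon}$ of $M$ (the points of $\mathbb{R}^n$ at distance less than $\epsilon$ from $M$) and $F$ extends to a $C^{1}$ diffeomorphism $\tilde{F}\colon\mathbb{R}^{n}\to\mathbb{R}^{n}$ which is isotopic to the identity $\mathrm{id}$, satisfies $\tilde{F}=\mathrm{id}$ on $\mathbb{R}^{n}\setminus U_{\epsilon}$, and $\max_{x\in\mathbb{R}^{n}}\{\|\tilde{F}(x)-x\|+\|d\tilde{F}(x)-\mathrm{id}\|\}<\epsilon$. It is called definable if $N$ is a definable set in an o-minimal structure. Essential o-minimality: a function $f\colon M\to\mathbb{R}$ is essentially o-minimal with respect to a definable approximation $(N,F)$ of $M$ if $f\circ F^{-1}\colon N\to\mathbb{R}$ is o-minimal. *)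

theory Defs
  imports "HOL-Analysis.Analysis"
begin

section \<open>$C^1$ and $C^2$ maps on subsets of Euclidean space\<close>

text \<open>For a set \<open>S\<close> that need not be open (a submanifold, or a relatively open subset of a linear
  subspace), a map on \<open>S\<close> is $C^r$ if it is locally the restriction of a $C^r$ map defined on an
  open subset of the ambient space.\<close>

definition C1_open :: "'a::euclidean_space set \<Rightarrow> ('a \<Rightarrow> 'b::real_normed_vector) \<Rightarrow> bool" where
  "C1_open U g \<longleftrightarrow> open U \<and>
     (\<exists>g' :: 'a \<Rightarrow> 'a \<Rightarrow>\<^sub>L 'b.
        (\<forall>x\<in>U. (g has_derivative blinfun_apply (g' x)) (at x)) \<and> continuous_on U g')"

definition C2_open :: "'a::euclidean_space set \<Rightarrow> ('a \<Rightarrow> 'b::real_normed_vector) \<Rightarrow> bool" where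
  "C2_open U g \<longleftrightarrow> open U \<and>
     (\<exists>g' :: 'a \<Rightarrow> 'a \<Rightarrow>\<^sub>L 'b.
        (\<forall>x\<in>U. (g has_derivative blinfun_apply (g' x)) (at x)) \<and> C1_open U g')"

definition C1_on :: "'a::euclidean_space set \<Rightarrow> ('a \<Rightarrow> 'b::real_normed_vector) \<Rightarrow> bool" where
  "C1_on S f \<longleftrightarrow> (\<forall>x\<in>S. \<exists>U g. x \<in> U \<and> C1_open U g \<and> (\<forall>y\<in>U \<inter> S. g y = f y))"

definition C2_on :: "'a::euclidean_space set \<Rightarrow> ('a \<Rightarrow> 'b::real_normed_vector) \<Rightarrow> bool" where
  "C2_on S f \<longleftrightarrow> (\<forall>x\<in>S. \<exists>U g. x \<in> U \<and> C2_open U g \<and> (\<forall>y\<in>U \<inter> S. g y = f y))"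

definition C1_diffeo ::
  "'a::euclidean_space set \<Rightarrow> 'b::euclidean_space set \<Rightarrow> ('a \<Rightarrow> 'b) \<Rightarrow> bool" where
  "C1_diffeo A B f \<longleftrightarrow> bij_betw f A B \<and> C1_on A f \<and> C1_on B (inv_into A f)"


section \<open>Submanifolds, tangent spaces and $C^2$ atlases\<close>

text \<open>The linear subspace \<open>E\<close>, whose dimension is that of \<open>M\<close>, serves as the model space.\<close>

definition slice_chart ::
  "'a::euclidean_space set \<Rightarrow> 'a set \<Rightarrow> 'a set \<Rightarrow> ('a \<Rightarrow> 'a) \<Rightarrow> bool" where
  "slice_chart E M U \<phi> \<longleftrightarrow>
     open U \<and> open (\<phi> ` U) \<and> C1_diffeo U (\<phi> ` U) \<phi> \<and> \<phi> ` (U \<inter> M) = \<phi> ` U \<inter> E"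

definition C1_submanifold :: "'a::euclidean_space set \<Rightarrow> bool" where
  "C1_submanifold M \<longleftrightarrow>
     (\<exists>E. subspace E \<and> (\<forall>p\<in>M. \<exists>U \<phi>. p \<in> U \<and> slice_chart E M U \<phi>))"

definition tangent_space :: "'a::euclidean_space set \<Rightarrow> 'a \<Rightarrow> 'a set" where
  "tangent_space M p =
     {v. \<exists>e>0. \<exists>\<gamma>. \<gamma> C1_differentiable_on {-e<..<e} \<and> \<gamma> ` {-e<..<e} \<subseteq> M \<and> \<gamma> 0 = p \<and>
           (\<gamma> has_vector_derivative v) (at 0)}"

text \<open>The tangent bundle of a $C^1$ manifold carries only a $C^0$ structure, so being a $C^1$ vector
  field makes sense only relative to a $C^2$ structure that refines the given $C^1$ structure.
  (Requiring \<open>X\<close> to be $C^1$ as a map into the ambient space instead would leave only the zero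
  field on, say, the graph of a $C^1$ function with nowhere differentiable derivative.)
  Every $C^1$ structure has such refinements, by a theorem of Whitney.  An atlas \<open>\<A>\<close> below is a
  set of ambient $C^1$ charts whose restrictions to \<open>M\<close> have $C^2$ transition maps; since a $C^1$
  chart of \<open>M\<close> locally extends to an ambient one, each $C^2$ structure compatible with the $C^1$
  structure of \<open>M\<close> arises in this way.  If \<open>M\<close> is a $C^2$ submanifold and \<open>\<A>\<close> consists
  of ambient $C^2$ charts, then the fields below are the tangent fields that are $C^1$ as
  maps into the ambient space.\<close>

definition C2_atlas ::
  "'a::euclidean_space set \<Rightarrow> 'a set \<Rightarrow> ('a set \<times> ('a \<Rightarrow> 'a)) set \<Rightarrow> bool" where
  "C2_atlas E M \<A> \<longleftrightarrow> subspace E \<and>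
     (\<forall>(U, \<phi>)\<in>\<A>. slice_chart E M U \<phi>) \<and>
     (\<forall>p\<in>M. \<exists>(U, \<phi>)\<in>\<A>. p \<in> U) \<and>
     (\<forall>(U, \<phi>)\<in>\<A>. \<forall>(V, \<psi>)\<in>\<A>. C2_on (\<phi> ` (U \<inter> V \<inter> M)) (\<psi> \<circ> inv_into U \<phi>))"


section \<open>The space of $C^1$ vector fields\<close>

definition chart_rep :: "'a::euclidean_space set \<Rightarrow> ('a \<Rightarrow> 'a) \<Rightarrow> ('a \<Rightarrow> 'a) \<Rightarrow> 'a \<Rightarrow> 'a" where
  "chart_rep U \<phi> X w =
     frechet_derivative \<phi> (at (inv_into U \<phi> w)) (X (inv_into U \<phi> w))"

definition C1_vector_fields ::
  "'a::euclidean_space set \<Rightarrow> ('a set \<times> ('a \<Rightarrow> 'a)) set \<Rightarrow> ('a \<Rightarrow> 'a) set" where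
  "C1_vector_fields M \<A> =
     {X \<in> extensional M. (\<forall>p\<in>M. X p \<in> tangent_space M p) \<and>
        (\<forall>(U, \<phi>)\<in>\<A>. C1_on (\<phi> ` (U \<inter> M)) (chart_rep U \<phi> X))}"

text \<open>Closeness up to first order, in a chart and over a compact set \<open>K\<close> of chart values.
  The derivative of the difference is taken along the model space \<open>E\<close>.  The strict bound for
  all nonzero \<open>v\<close> says that its operator norm on \<open>E\<close> is less than \<open>\<delta>\<close>.\<close>

definition C1_near ::
  "'a::euclidean_space set \<Rightarrow> 'a set \<Rightarrow> ('a \<Rightarrow> 'a) \<Rightarrow> 'a set \<Rightarrow> real \<Rightarrow> ('a \<Rightarrow> 'a) \<Rightarrow> ('a \<Rightarrow> 'a) \<Rightarrow> bool"
  where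
  "C1_near E U \<phi> K \<delta> X Y \<longleftrightarrow>
     (\<forall>w\<in>K. norm (chart_rep U \<phi> Y w - chart_rep U \<phi> X w) < \<delta> \<and>
        (\<exists>D. ((\<lambda>u. chart_rep U \<phi> Y u - chart_rep U \<phi> X u) has_derivative D) (at w within E) \<and>
             (\<forall>v\<in>E. v \<noteq> 0 \<longrightarrow> norm (D v) < \<delta> * norm v)))"

definition C1_topology ::
  "'a::euclidean_space set \<Rightarrow> 'a set \<Rightarrow> ('a set \<times> ('a \<Rightarrow> 'a)) set \<Rightarrow> ('a \<Rightarrow> 'a) topology" where
  "C1_topology E M \<A> = topology_generated_by
     {{Y \<in> C1_vector_fields M \<A>. C1_near E U \<phi> K \<delta> X Y} | X U \<phi> K \<delta>.
        X \<in> C1_vector_fields M \<A> \<and> (U, \<phi>) \<in> \<A> \<and> compact K \<and> K \<subseteq> \<phi> ` (U \<inter> M) \<and> 0 < \<delta>}"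

lemma topspace_C1_topology:
  assumes "C2_atlas E M \<A>" "M \<noteq> {}"
  shows "topspace (C1_topology E M \<A>) = C1_vector_fields M \<A>"
proof -
  obtain U \<phi> where c: "(U, \<phi>) \<in> \<A>"
    using assms by (fastforce simp: C2_atlas_def)
  have "X \<in> topspace (C1_topology E M \<A>)" if "X \<in> C1_vector_fields M \<A>" for X
  proof -
    have "C1_near E U \<phi> {} 1 X X" by (simp add: C1_near_def)
    with that have "X \<in> {Y \<in> C1_vector_fields M \<A>. C1_near E U \<phi> {} 1 X Y}"
      by simp
    moreover have "compact {}" "{} \<subseteq> \<phi> ` (U \<inter> M)" "(0::real) < 1"
      by simp_all
    ultimately show ?thesis
      unfolding C1_topology_def topology_generated_by_topspace using that c by blast
  qed
  moreover have "topspace (C1_topology E M \<A>) \<subseteq> C1_vector_fields M \<A>"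
    unfolding C1_topology_def topology_generated_by_topspace by auto
  ultimately show ?thesis by blast
qed

definition residual_in :: "'a topology \<Rightarrow> 'a set \<Rightarrow> bool" where
  "residual_in T S \<longleftrightarrow> S \<subseteq> topspace T \<and>
     (\<exists>\<D>. countable \<D> \<and> (\<forall>D\<in>\<D>. openin T D \<and> T closure_of D = topspace T) \<and>
          topspace T \<inter> \<Inter>\<D> \<subseteq> S)"


section \<open>First integrals\<close>

text \<open>On a compact \<open>M\<close> the flow of a $C^1$ field is complete, and its orbits are the ranges of the
  integral curves defined on the whole real line.\<close>

definition integral_curve ::
  "'a::euclidean_space set \<Rightarrow> ('a \<Rightarrow> 'a) \<Rightarrow> (real \<Rightarrow> 'a) \<Rightarrow> bool" where
  "integral_curve M X \<gamma> \<longleftrightarrow>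
     (\<forall>t. \<gamma> t \<in> M \<and> (\<gamma> has_vector_derivative X (\<gamma> t)) (at t))"

definition orbits :: "'a::euclidean_space set \<Rightarrow> ('a \<Rightarrow> 'a) \<Rightarrow> 'a set set" where
  "orbits M X = {range \<gamma> | \<gamma>. integral_curve M X \<gamma>}"

definition first_integral ::
  "'a::euclidean_space set \<Rightarrow> ('a \<Rightarrow> 'a) \<Rightarrow> ('a \<Rightarrow> real) \<Rightarrow> bool" where
  "first_integral M X f \<longleftrightarrow> continuous_on M f \<and>
     (\<forall>\<O>\<in>orbits M X. f constant_on \<O>) \<and>
     (\<forall>V. openin (top_of_set M) V \<and> V \<noteq> {} \<longrightarrow> \<not> f constant_on V)"


section \<open>O-minimal structures\<close>

text \<open>The members of \<open>\<O> m\<close> are sets of real lists of length \<open>m\<close>.\<close>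

definition Rpow :: "nat \<Rightarrow> real list set" where
  "Rpow m = {xs. length xs = m}"

text \<open>The value at \<open>xs\<close> of the real polynomial in \<open>m\<close> variables with coefficients \<open>c\<close>
  and exponents in \<open>A\<close>.\<close>

definition poly_eval ::
  "nat \<Rightarrow> (nat \<Rightarrow> nat) set \<Rightarrow> ((nat \<Rightarrow> nat) \<Rightarrow> real) \<Rightarrow> real list \<Rightarrow> real" where
  "poly_eval m A c xs = (\<Sum>\<alpha>\<in>A. c \<alpha> * (\<Prod>i<m. (xs ! i) ^ \<alpha> i))"

definition o_minimal_structure :: "(nat \<Rightarrow> real list set set) \<Rightarrow> bool" where
  "o_minimal_structure \<O> \<longleftrightarrow>
     (\<forall>m\<ge>1.
        algebra (Rpow m) (\<O> m) \<and>
        (\<forall>A\<in>\<O> m. {xs @ [y] | xs y. xs \<in> A} \<in> \<O> (Suc m) \<and>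
                   {y # xs | y xs. xs \<in> A} \<in> \<O> (Suc m)) \<and>
        (\<forall>A\<in>\<O> (Suc m). butlast ` A \<in> \<O> m) \<and>
        (\<forall>A c. finite A \<longrightarrow> {xs \<in> Rpow m. poly_eval m A c xs = 0} \<in> \<O> m)) \<and>
     \<O> 1 = {(\<lambda>x. [x]) ` \<Union>\<I> | \<I> :: real set set. finite \<I> \<and> (\<forall>I\<in>\<I>. is_interval I)}"

text \<open>The coordinates of a vector, listed in the order of the index type.\<close>

definition coords :: "real ^ 'n::{finite,linorder} \<Rightarrow> real list" where
  "coords x = map (\<lambda>i. x $ i) (sorted_list_of_set UNIV)"

definition definable_set ::
  "(nat \<Rightarrow> real list set set) \<Rightarrow> (real ^ 'n::{finite,linorder}) set \<Rightarrow> bool" where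
  "definable_set \<O> S \<longleftrightarrow> coords ` S \<in> \<O> CARD('n)"

definition definable_fun ::
  "(nat \<Rightarrow> real list set set) \<Rightarrow> (real ^ 'n::{finite,linorder}) set \<Rightarrow> (real ^ 'n::{finite,linorder} \<Rightarrow> real) \<Rightarrow> bool"
  where
  "definable_fun \<O> S g \<longleftrightarrow> {coords x @ [g x] | x. x \<in> S} \<in> \<O> (CARD('n) + 1)"

definition o_minimal_fun ::
  "(real ^ 'n::{finite,linorder}) set \<Rightarrow> (real ^ 'n::{finite,linorder} \<Rightarrow> real) \<Rightarrow> bool" where
  "o_minimal_fun S g \<longleftrightarrow> (\<exists>\<O>. o_minimal_structure \<O> \<and> definable_fun \<O> S g)"


section \<open>Definable approximations and essential o-minimality\<close>

definition eps_nbhd :: "real \<Rightarrow> 'a::euclidean_space set \<Rightarrow> 'a set" where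
  "eps_nbhd \<epsilon> M = (\<Union>y\<in>M. ball y \<epsilon>)"

text \<open>For bounded \<open>M\<close>, the displayed sum of norms is continuous and vanishes off the closure of
  the bounded set \<open>eps_nbhd \<epsilon> M\<close>; so it attains its maximum, and the pointwise strict bound says that this maximum
  is less than \<open>\<epsilon>\<close>.  Isotopies run through $C^1$ diffeomorphisms.\<close>

definition eps_approximation ::
  "real \<Rightarrow> 'a::euclidean_space set \<Rightarrow> 'a set \<Rightarrow> ('a \<Rightarrow> 'a) \<Rightarrow> bool" where
  "eps_approximation \<epsilon> M N F \<longleftrightarrow>
     C1_submanifold N \<and> C1_diffeo M N F \<and> N \<subseteq> eps_nbhd \<epsilon> M \<and>
     (\<exists>G. C1_diffeo UNIV UNIV G \<and> (\<forall>x\<in>M. G x = F x) \<and>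
        homotopic_with_canon (\<lambda>h. C1_diffeo UNIV UNIV h) UNIV UNIV G id \<and>
        (\<forall>x. x \<notin> eps_nbhd \<epsilon> M \<longrightarrow> G x = x) \<and>
        (\<forall>x. norm (G x - x) + onorm (\<lambda>v. frechet_derivative G (at x) v - v) < \<epsilon>))"

definition definable_eps_approximation ::
  "real \<Rightarrow> (real ^ 'n::{finite,linorder}) set \<Rightarrow> (real ^ 'n::{finite,linorder}) set \<Rightarrow> (real ^ 'n::{finite,linorder} \<Rightarrow> real ^ 'n::{finite,linorder}) \<Rightarrow> bool"
  where
  "definable_eps_approximation \<epsilon> M N F \<longleftrightarrow>
     eps_approximation \<epsilon> M N F \<and> (\<exists>\<O>. o_minimal_structure \<O> \<and> definable_set \<O> N)"

definition essentially_o_minimal ::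
  "(real ^ 'n::{finite,linorder}) set \<Rightarrow> (real ^ 'n::{finite,linorder}) set \<Rightarrow> (real ^ 'n::{finite,linorder} \<Rightarrow> real ^ 'n::{finite,linorder}) \<Rightarrow>
    (real ^ 'n::{finite,linorder} \<Rightarrow> real) \<Rightarrow> bool" where
  "essentially_o_minimal M N F f \<longleftrightarrow> o_minimal_fun N (f \<circ> inv_into M F)"

end

theory Submission
  imports Defs
begin

text \<open>
  Let \<open>f\<close> be a Lipschitz first integral of \<open>X\<close> that is essentially o-minimal.  Each level set of
  \<open>f\<close> is compact and invariant under \<open>X\<close>.  On the other hand, for all but finitely many values
  \<open>t\<close> there is a C1 field \<open>V\<close> along which \<open>f\<close> strictly increases near the level \<open>t\<close>.  Since \<open>f\<close> is
  constant along \<open>X\<close> and increases along \<open>V\<close>, it increases along \<open>X + \<eta> V\<close> for every \<open>\<eta> > 0\<close>, at a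
  rate that is uniform on a neighbourhood \<open>R\<close> of the level which does not depend on \<open>\<eta>\<close>.  So fields
  arbitrarily close to \<open>X\<close> push every orbit out of \<open>R\<close>, while \<open>X\<close> keeps an orbit in \<open>R\<close> forever.

  A generic field does not allow this.  Call a field rising on \<open>R\<close> if some Lipschitz function grows
  along it at a uniform positive rate at all points of \<open>R\<close>.  This is an open condition
  (\<open>openin_rising\<close>), and a rising field keeps no complete orbit in \<open>R\<close>, because a continuous function on
  a compact set is bounded (\<open>integral_curve_leaves\<close>).  The fields that are rising on \<open>R\<close> together with
  those that are not limits of such fields form an open dense set, and the finite unions \<open>R\<close> of
  members of a countable basis are enough to approximate every compact level.  A field in the
  intersection of these countably many open dense sets that is a limit of fields rising on \<open>R\<close> is
  itself rising on \<open>R\<close>; so it has no first integral of the above kind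
  (\<open>residual_without_regular_level\<close>).

  O-minimality gives the finiteness of the exceptional values, a Sard theorem for Lipschitz definable
  functions \<open>g\<close> (\<open>finite_critical_values\<close>).  A point is regular if \<open>g\<close> grows at rate at
  least 1/2 along all short steps whose direction lies in a narrow cone around a nearly tangent vector
  \<open>v\<close>; for Lipschitz functions on a submanifold this is a form of Clarke regularity.  If the
  critical values were infinite in number, they would fill an interval, and definable choice would
  give a curve \<open>x(t)\<close> of critical points with \<open>g(x(t)) = t\<close>, nearly straight with velocity \<open>v\<close> on a smaller
  interval.  As \<open>x(t)\<close> is critical, there are points \<open>y(t, r)\<close> within \<open>r\<close> of \<open>x(t)\<close> from which \<open>g\<close> grows
  too slowly along a step \<open>s v\<close>.  The heart of the matter is that a definable family of functions
  which converges pointwise as \<open>r \<rightarrow> 0\<close> also converges in slope, on some subinterval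
  (\<open>slope_of_approximation\<close>, which rests on \<open>slope_dichotomy\<close>).  Hence \<open>y(t + s, r) - y(t, r)\<close> is close to \<open>s v\<close>, and \<open>g\<close> grows by almost \<open>s\<close> from
  \<open>y(t, r)\<close> to \<open>y(t + s, r)\<close>, which contradicts the slow growth.

  Slope convergence only needs definable subsets of the line: their germs at a point are constant,
  and since the line is uncountable, one of countably many definable sets that cover an
  interval contains an interval.

  The geometric part consists of the strict tangency of C1 submanifolds (\<open>strict_tangency\<close>), the
  existence of complete integral curves by Peano's argument (\<open>complete_integral_curve\<close>), fields
  with small support and prescribed direction (\<open>bump_field\<close>), and a calculus of rates of ascent that is
  superadditive in the direction (\<open>ascends_add\<close>).
\<close>

section \<open>Definability in an o-minimal structure\<close>

locale omin =
  fixes \<O> :: "nat \<Rightarrow> real list set set"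
  assumes omin: "o_minimal_structure \<O>"
begin

lemma algebra_of_sets: "m \<ge> 1 \<Longrightarrow> algebra (Rpow m) (\<O> m)"
  using omin unfolding o_minimal_structure_def by blast

lemma sets_Int: "m \<ge> 1 \<Longrightarrow> A \<in> \<O> m \<Longrightarrow> B \<in> \<O> m \<Longrightarrow> A \<inter> B \<in> \<O> m"
  using algebra_of_sets[of m] unfolding algebra_iff_Int by blast

lemma sets_compl: "m \<ge> 1 \<Longrightarrow> A \<in> \<O> m \<Longrightarrow> Rpow m - A \<in> \<O> m"
  using algebra_of_sets[of m] unfolding algebra_iff_Int by blast

lemma sets_top: "m \<ge> 1 \<Longrightarrow> Rpow m \<in> \<O> m"
  using algebra_of_sets[of m] unfolding algebra_iff_Int by (metis Diff_empty)

lemma sets_sub: "m \<ge> 1 \<Longrightarrow> A \<in> \<O> m \<Longrightarrow> xs \<in> A \<Longrightarrow> length xs = m"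
  using algebra_of_sets[of m] unfolding algebra_iff_Int Rpow_def by blast

lemma sets_Cons: "m \<ge> 1 \<Longrightarrow> A \<in> \<O> m \<Longrightarrow> {y # xs | y xs. xs \<in> A} \<in> \<O> (Suc m)"
  and sets_butlast: "m \<ge> 1 \<Longrightarrow> C \<in> \<O> (Suc m) \<Longrightarrow> butlast ` C \<in> \<O> m"
  and sets_poly: "m \<ge> 1 \<Longrightarrow> finite I \<Longrightarrow> {xs \<in> Rpow m. poly_eval m I c xs = 0} \<in> \<O> m"
  using omin unfolding o_minimal_structure_def by blast+

lemma sets_one: "\<O> 1 = {(\<lambda>x. [x]) ` \<Union>\<I> | \<I> :: real set set. finite \<I> \<and> (\<forall>I\<in>\<I>. is_interval I)}"
  using omin unfolding o_minimal_structure_def by blast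

lemma sets_prepend:
  assumes "m \<ge> 1" "A \<in> \<O> m"
  shows "{xs. length xs = k + m \<and> drop k xs \<in> A} \<in> \<O> (k + m)"
proof (induction k)
  case 0
  have "{xs. length xs = m \<and> xs \<in> A} = A" using sets_sub assms by blast
  then show ?case using assms by simp
next
  case (Suc k)
  have "{xs. length xs = Suc k + m \<and> drop (Suc k) xs \<in> A}
     = {y # xs | y xs. xs \<in> {xs. length xs = k + m \<and> drop k xs \<in> A}}"
    by (auto simp: length_Suc_conv)
  then show ?case using sets_Cons[OF _ Suc] assms by simp
qed

lemma sets_proj:
  assumes "m \<ge> 1" "A \<in> \<O> (m + k)"
  shows "take m ` A \<in> \<O> m"
  using assms(2)
proof (induction k arbitrary: A)
  case 0
  have "take m ` A = A" using sets_sub[OF assms(1)] 0 by (force simp: image_iff)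
  then show ?case using 0 by simp
next
  case (Suc k)
  have "butlast ` A \<in> \<O> (m + k)" using sets_butlast[of "m+k" A] Suc.prems assms(1) by simp
  then have "take m ` (butlast ` A) \<in> \<O> m" by (rule Suc.IH)
  moreover have "take m (butlast x) = take m x" if "x \<in> A" for x
    using sets_sub[OF _ Suc.prems that] assms(1) by (simp add: take_butlast)
  ultimately show ?case by (simp add: image_image cong: image_cong)
qed

lemma sets_eq_coord:
  assumes "i < m" "j < m"
  shows "{xs \<in> Rpow m. xs ! i = xs ! j} \<in> \<O> m"
proof (cases "i = j")
  case True
  then show ?thesis using sets_top[of m] assms by simp
next
  case False
  \<comment> \<open>the exponent vector of the monomial \<open>X\<^sub>i\<close>\<close>
  define e where "e = (\<lambda>(i::nat) (l::nat). if l = i then 1 else 0::nat)"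
  have e: "(\<Prod>l<m. (xs ! l) ^ e i l) = xs ! i" if "i < m" for i and xs :: "real list"
  proof -
    have "(\<Prod>l<m. (xs ! l) ^ e i l) = (\<Prod>l<m. if l = i then xs ! l else 1)"
      by (rule prod.cong) (auto simp: e_def)
    then show ?thesis using that by simp
  qed
  have "e i \<noteq> e j" using False by (auto simp: e_def fun_eq_iff)
  then have "poly_eval m {e i, e j} (\<lambda>a. if a = e i then 1 else -1) xs = xs ! i - xs ! j" for xs
    using e assms by (simp add: poly_eval_def)
  then show ?thesis using sets_poly[of m "{e i, e j}" "\<lambda>a. if a = e i then 1 else -1"] assms by simp
qed

text \<open>Substitution of variables, with repetitions and in any order: embed \<open>A\<close> as the last coordinates
  of a larger space, intersect with the diagonals that identify them with the chosen coordinates, and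
  project.  All freedom in naming variables comes from this lemma.\<close>

lemma sets_subst:
  assumes A: "A \<in> \<O> (length is)" and "is \<noteq> []" and less: "\<And>i. i \<in> set is \<Longrightarrow> i < m"
  shows "{xs \<in> Rpow m. map ((!) xs) is \<in> A} \<in> \<O> m"
proof -
  define k where "k = length is"
  have k: "k \<ge> 1" using assms(2) by (simp add: k_def Suc_leI)
  have m: "m \<ge> 1" using less assms(2) by (metis less_one linorder_not_le list.set_intros(1) neq_Nil_conv not_less0)
  have diag: "{zs \<in> Rpow (m + k). \<forall>j<n. zs ! (is ! j) = zs ! (m + j)} \<in> \<O> (m + k)" if "n \<le> k" for n
    using that
  proof (induction n)
    case 0
    then show ?case using sets_top[of "m+k"] m by simp
  next
    case (Suc n)
    have "{zs \<in> Rpow (m + k). \<forall>j<Suc n. zs ! (is ! j) = zs ! (m + j)}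
      = {zs \<in> Rpow (m + k). \<forall>j<n. zs ! (is ! j) = zs ! (m + j)} \<inter> {zs \<in> Rpow (m + k). zs ! (is ! n) = zs ! (m + n)}"
      by (auto simp: less_Suc_eq)
    moreover have "{zs \<in> Rpow (m + k). zs ! (is ! n) = zs ! (m + n)} \<in> \<O> (m+k)"
      using sets_eq_coord[of "is ! n" "m + k" "m + n"] Suc.prems less[of "is ! n"] by (simp add: k_def)
    ultimately show ?case using Suc sets_Int[of "m+k"] m by simp
  qed
  let ?B = "{zs. length zs = m + k \<and> drop m zs \<in> A} \<inter> {zs \<in> Rpow (m + k). \<forall>j<k. zs ! (is ! j) = zs ! (m + j)}"
  have "?B \<in> \<O> (m + k)"
    using sets_prepend[OF k, of A m] A diag[of k] sets_Int[of "m+k"] m by (simp add: k_def)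
  then have "take m ` ?B \<in> \<O> m" using sets_proj m by blast
  moreover have "take m ` ?B = {xs \<in> Rpow m. map ((!) xs) is \<in> A}"
  proof (intro equalityI subsetI)
    fix xs assume "xs \<in> take m ` ?B"
    then obtain zs where zs: "xs = take m zs" "length zs = m + k" "drop m zs \<in> A"
       "\<And>j. j < k \<Longrightarrow> zs ! (is ! j) = zs ! (m + j)" by auto
    have "map ((!) xs) is = drop m zs"
      by (rule nth_equalityI) (use zs less in \<open>auto simp: k_def\<close>)
    then show "xs \<in> {xs \<in> Rpow m. map ((!) xs) is \<in> A}" using zs by (simp add: Rpow_def)
  next
    fix xs assume xs: "xs \<in> {xs \<in> Rpow m. map ((!) xs) is \<in> A}"
    have "xs @ map ((!) xs) is \<in> ?B"
      using xs less by (auto simp: Rpow_def k_def nth_append)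
    moreover have "xs = take m (xs @ map ((!) xs) is)" using xs by (simp add: Rpow_def)
    ultimately show "xs \<in> take m ` ?B" by blast
  qed
  ultimately show ?thesis by simp
qed

text \<open>Definability is carried over to predicates on an arbitrary Euclidean space by reading off
  coordinates with respect to some list of basis vectors.  With products as contexts, bound variables become
  projections \<open>fst\<close> and \<open>snd\<close>, so that definability of a formula is proved by syntax-directed
  introduction rules.  The list may omit or repeat basis vectors; \<open>definable_coordinates\<close> shows
  that any enumeration of the basis serves equally well.\<close>

definition definable_pred :: "('c::euclidean_space \<Rightarrow> bool) \<Rightarrow> bool" where
  "definable_pred P \<longleftrightarrow> (\<exists>bs A. bs \<noteq> [] \<and> set bs \<subseteq> Basis \<and> A \<in> \<O> (length bs) \<and> (\<forall>x. P x \<longleftrightarrow> map ((\<bullet>) x) bs \<in> A))"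

lemma definable_coordinates:
  fixes P :: "'c::euclidean_space \<Rightarrow> bool"
  assumes "definable_pred P" "set cs = Basis"
  obtains A where "A \<in> \<O> (length cs)" "\<And>x. P x \<longleftrightarrow> map ((\<bullet>) x) cs \<in> A"
proof -
  obtain bs A where bs: "bs \<noteq> []" "set bs \<subseteq> Basis" and A: "A \<in> \<O> (length bs)"
      and P: "\<And>x. P x \<longleftrightarrow> map ((\<bullet>) x) bs \<in> A"
    using assms unfolding definable_pred_def by blast
  have "\<exists>i. i < length cs \<and> cs ! i = b" if "b \<in> set bs" for b
    using that bs assms(2) by (metis in_mono in_set_conv_nth)
  then obtain ix where ix: "\<And>b. b \<in> set bs \<Longrightarrow> ix b < length cs \<and> cs ! (ix b) = b" by metis
  have "{xs \<in> Rpow (length cs). map ((!) xs) (map ix bs) \<in> A} \<in> \<O> (length cs)"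
    by (rule sets_subst) (use A bs ix in auto)
  moreover have "P x \<longleftrightarrow> map ((\<bullet>) x) cs \<in> {xs \<in> Rpow (length cs). map ((!) xs) (map ix bs) \<in> A}" for x
  proof -
    have "map ((!) (map ((\<bullet>) x) cs)) (map ix bs) = map ((\<bullet>) x) bs"
      using ix by auto
    then show ?thesis using P by (simp add: Rpow_def del: map_map)
  qed
  ultimately show ?thesis using that by blast
qed

lemma basis_list: obtains bs :: "'c::euclidean_space list" where "set bs = Basis" "distinct bs" "bs \<noteq> []"
  by (metis finite_Basis finite_distinct_list nonempty_Basis set_empty2)

lemma definable_predI: "bs \<noteq> [] \<Longrightarrow> set bs \<subseteq> Basis \<Longrightarrow> A \<in> \<O> (length bs) \<Longrightarrow> (\<And>x. P x \<longleftrightarrow> map ((\<bullet>) x) bs \<in> A) \<Longrightarrow> definable_pred P"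
  unfolding definable_pred_def by blast

lemma definable_not: assumes "definable_pred P" shows "definable_pred (\<lambda>x. \<not> P x)"
proof -
  obtain bs :: "'a list" where bs: "set bs = Basis" "bs \<noteq> []" by (rule basis_list)
  obtain A where A: "A \<in> \<O> (length bs)" "\<And>x. P x \<longleftrightarrow> map ((\<bullet>) x) bs \<in> A"
    using definable_coordinates[OF assms bs(1)] by blast
  show ?thesis
    by (rule definable_predI[of bs "Rpow (length bs) - A"]) (use A bs sets_compl[of "length bs"] in \<open>auto simp: Rpow_def Suc_le_eq\<close>)
qed

lemma definable_conj: assumes "definable_pred P" "definable_pred Q" shows "definable_pred (\<lambda>x. P x \<and> Q x)"
proof -
  obtain bs :: "'a list" where bs: "set bs = Basis" "bs \<noteq> []" by (rule basis_list)
  obtain A where A: "A \<in> \<O> (length bs)" "\<And>x. P x \<longleftrightarrow> map ((\<bullet>) x) bs \<in> A"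
    using definable_coordinates[OF assms(1) bs(1)] by blast
  obtain B where B: "B \<in> \<O> (length bs)" "\<And>x. Q x \<longleftrightarrow> map ((\<bullet>) x) bs \<in> B"
    using definable_coordinates[OF assms(2) bs(1)] by blast
  show ?thesis
    by (rule definable_predI[of bs "A \<inter> B"]) (use A B bs sets_Int[of "length bs"] in \<open>auto simp: Suc_le_eq\<close>)
qed

lemma definable_disj: assumes "definable_pred P" "definable_pred Q" shows "definable_pred (\<lambda>x. P x \<or> Q x)"
  using definable_not[OF definable_conj[OF definable_not[OF assms(1)] definable_not[OF assms(2)]]] by simp

lemma definable_imp: assumes "definable_pred P" "definable_pred Q" shows "definable_pred (\<lambda>x. P x \<longrightarrow> Q x)"
  using definable_disj[OF definable_not[OF assms(1)] assms(2)] by simp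

text \<open>The context \<open>x\<close> is enumerated first and the bound variable \<open>y\<close> last; then quantification is a
  projection to an initial segment of the coordinates.\<close>

lemma definable_ex: assumes "definable_pred (\<lambda>p. Q (fst p) (snd p))" shows "definable_pred (\<lambda>x. \<exists>y. Q x y)"
proof -
  obtain bs :: "'a list" where bs: "set bs = Basis" "bs \<noteq> []" by (rule basis_list)
  obtain cs :: "'b list" where cs: "set cs = Basis" "distinct cs" by (rule basis_list)
  let ?ds = "map (\<lambda>b. (b, 0)) bs @ map (\<lambda>b. (0, b)) cs"
  have ds: "set ?ds = Basis" using bs cs by (simp add: Basis_prod_def)
  have coord: "map ((\<bullet>) (x, y)) ?ds = map ((\<bullet>) x) bs @ map ((\<bullet>) y) cs" for x y by simp
  obtain A where A: "A \<in> \<O> (length ?ds)" "\<And>p. Q (fst p) (snd p) \<longleftrightarrow> map ((\<bullet>) p) ?ds \<in> A"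
    using definable_coordinates[OF assms ds] by blast
  have len: "length xs = length bs + length cs" if "xs \<in> A" for xs
    using sets_sub[OF _ A(1) that] bs by (simp add: Suc_le_eq)
  have "(\<exists>y. Q x y) \<longleftrightarrow> map ((\<bullet>) x) bs \<in> take (length bs) ` A" for x
  proof
    assume "\<exists>y. Q x y"
    then obtain y where "Q x y" by blast
    then have "map ((\<bullet>) x) bs @ map ((\<bullet>) y) cs \<in> A" using A(2)[of "(x, y)", unfolded coord] by simp
    then show "map ((\<bullet>) x) bs \<in> take (length bs) ` A"
      by (rule rev_image_eqI) simp
  next
    assume "map ((\<bullet>) x) bs \<in> take (length bs) ` A"
    then obtain xs where xs: "xs \<in> A" "map ((\<bullet>) x) bs = take (length bs) xs" by blast
    define ys where "ys = drop (length bs) xs"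
    have ys: "length ys = length cs" using len[OF xs(1)] by (simp add: ys_def)
    define ix where "ix = (\<lambda>b. THE i. i < length cs \<and> cs ! i = b)"
    have ix: "ix (cs ! i) = i" if "i < length cs" for i
      unfolding ix_def using that cs(2) by (intro the_equality) (auto simp: nth_eq_iff_index_eq)
    define y where "y = (\<Sum>b\<in>Basis. (ys ! ix b) *\<^sub>R b)"
    have "map ((\<bullet>) y) cs = ys"
    proof (rule nth_equalityI)
      fix i assume "i < length (map ((\<bullet>) y) cs)"
      then have i: "i < length cs" by simp
      have "cs ! i \<in> Basis" using nth_mem[OF i] unfolding cs(1) .
      then have "y \<bullet> (cs ! i) = ys ! ix (cs ! i)" unfolding y_def by (rule inner_sum_left_Basis)
      then show "map ((\<bullet>) y) cs ! i = ys ! i" using i ix by simp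
    qed (simp add: ys)
    then have "map ((\<bullet>) (x, y)) ?ds = xs" using xs(2) by (simp add: coord ys_def del: map_map map_append)
    then have "Q x y" using A(2)[of "(x, y)"] xs(1) by (simp only: fst_conv snd_conv)
    then show "\<exists>y. Q x y" by blast
  qed
  moreover have "take (length bs) ` A \<in> \<O> (length bs)"
    using sets_proj[of "length bs" A "length cs"] A(1) bs(2) by (simp add: Suc_le_eq)
  ultimately show ?thesis using bs by (intro definable_predI[of bs "take (length bs) ` A"]) simp_all
qed

lemma definable_all: assumes "definable_pred (\<lambda>p. Q (fst p) (snd p))" shows "definable_pred (\<lambda>x. \<forall>y. Q x y)"
  using definable_not[OF definable_ex[where Q = "\<lambda>x y. \<not> Q x y", OF definable_not[OF assms]]] by simp

text \<open>Maps that copy coordinates, like the projections of a product.  They are handled before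
  general definable maps, because the rule for composing definable maps needs them.\<close>

definition coordinate_map :: "('c::euclidean_space \<Rightarrow> 'd::euclidean_space) \<Rightarrow> bool" where
  "coordinate_map h \<longleftrightarrow> (\<forall>b\<in>Basis. \<exists>b'\<in>Basis. \<forall>x. h x \<bullet> b = x \<bullet> b')"

lemma coordinate_map_id: "coordinate_map (\<lambda>x. x)" unfolding coordinate_map_def by blast

lemma coordinate_map_fst: assumes "coordinate_map h" shows "coordinate_map (\<lambda>x. fst (h x))"
proof -
  have "\<exists>b'\<in>Basis. \<forall>x. fst (h x) \<bullet> b = x \<bullet> b'" if "b \<in> Basis" for b
  proof -
    have "(b, 0) \<in> Basis" using that by (simp add: Basis_prod_def)
    then obtain b' where "b' \<in> Basis" "\<And>x. h x \<bullet> (b, 0) = x \<bullet> b'" using assms unfolding coordinate_map_def by blast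
    then show ?thesis by (auto simp: inner_prod_def)
  qed
  then show ?thesis unfolding coordinate_map_def by blast
qed

lemma coordinate_map_snd: assumes "coordinate_map h" shows "coordinate_map (\<lambda>x. snd (h x))"
proof -
  have "\<exists>b'\<in>Basis. \<forall>x. snd (h x) \<bullet> b = x \<bullet> b'" if "b \<in> Basis" for b
  proof -
    have "(0, b) \<in> Basis" using that by (simp add: Basis_prod_def)
    then obtain b' where "b' \<in> Basis" "\<And>x. h x \<bullet> (0, b) = x \<bullet> b'" using assms unfolding coordinate_map_def by blast
    then show ?thesis by (auto simp: inner_prod_def)
  qed
  then show ?thesis unfolding coordinate_map_def by blast
qed

lemma coordinate_map_pair: "coordinate_map h \<Longrightarrow> coordinate_map k \<Longrightarrow> coordinate_map (\<lambda>x. (h x, k x))"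
  unfolding coordinate_map_def Basis_prod_def by auto

lemma definable_at_coordinates: assumes "definable_pred P" "coordinate_map h" shows "definable_pred (\<lambda>x. P (h x))"
proof -
  obtain bs A where bs: "bs \<noteq> []" "set bs \<subseteq> Basis" and A: "A \<in> \<O> (length bs)"
      and P: "\<And>x. P x \<longleftrightarrow> map ((\<bullet>) x) bs \<in> A"
    using assms(1) unfolding definable_pred_def by blast
  obtain k where k: "\<And>b. b \<in> Basis \<Longrightarrow> k b \<in> Basis \<and> (\<forall>x. h x \<bullet> b = x \<bullet> k b)"
    using assms(2) unfolding coordinate_map_def by metis
  have "map ((\<bullet>) (h x)) bs = map ((\<bullet>) x) (map k bs)" for x using bs k by auto
  then show ?thesis using bs k A P by (intro definable_predI[of "map k bs" A]) (auto simp del: map_map)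
qed

lemma definable_basis_eq:
  assumes "b \<in> Basis" "b' \<in> Basis" shows "definable_pred (\<lambda>x. x \<bullet> b = x \<bullet> b')"
proof -
  have "{xs \<in> Rpow 2. xs ! 0 = xs ! 1} \<in> \<O> 2" by (rule sets_eq_coord) auto
  then show ?thesis using assms by (intro definable_predI[of "[b, b']" "{xs \<in> Rpow 2. xs ! 0 = xs ! 1}"]) (auto simp: Rpow_def numeral_2_eq_2)
qed

lemma definable_ball_finite: assumes "finite I" "\<And>i. i \<in> I \<Longrightarrow> definable_pred (P i)" shows "definable_pred (\<lambda>x. \<forall>i\<in>I. P i x)"
  using assms
proof (induction I rule: finite_induct)
  case empty
  obtain bs :: "'b list" where bs: "set bs = Basis" "bs \<noteq> []" by (rule basis_list)
  then show ?case
    by (intro definable_predI[of bs "Rpow (length bs)"]) (use sets_top[of "length bs"] in \<open>auto simp: Rpow_def Suc_le_eq\<close>)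
next
  case (insert i I)
  then show ?case using definable_conj[of "P i" "\<lambda>x. \<forall>i\<in>I. P i x"] by simp
qed

definition definable_map :: "('c::euclidean_space \<Rightarrow> 'd::euclidean_space) \<Rightarrow> bool" where
  "definable_map a \<longleftrightarrow> definable_pred (\<lambda>p. snd p = a (fst p))"

lemma definable_graph_at_coordinates:
  assumes "definable_map a" "coordinate_map h" "coordinate_map k" shows "definable_pred (\<lambda>x. k x = a (h x))"
  using definable_at_coordinates[OF assms(1)[unfolded definable_map_def] coordinate_map_pair[OF assms(2,3)]] by simp

lemma definable_subst: assumes "definable_pred P" "definable_map a" shows "definable_pred (\<lambda>x. P (a x))"
proof -
  have "definable_pred (\<lambda>x. \<exists>y. y = a x \<and> P y)"
    by (intro definable_ex definable_conj definable_graph_at_coordinates definable_at_coordinates[OF assms(1)] assms(2) coordinate_map_fst coordinate_map_snd coordinate_map_id)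
  then show ?thesis by simp
qed

lemma definable_map_comp: assumes "definable_map f" "definable_map a" shows "definable_map (\<lambda>x. f (a x))"
proof -
  have "definable_pred (\<lambda>p. \<exists>y. y = a (fst p) \<and> snd p = f y)"
    by (intro definable_ex definable_conj definable_graph_at_coordinates assms coordinate_map_fst coordinate_map_snd coordinate_map_id)
  then show ?thesis unfolding definable_map_def by simp
qed

lemma definable_map_pair: assumes "definable_map a" "definable_map b" shows "definable_map (\<lambda>x. (a x, b x))"
proof -
  have "definable_pred (\<lambda>p. fst (snd p) = a (fst p) \<and> snd (snd p) = b (fst p))"
    by (intro definable_conj definable_graph_at_coordinates assms coordinate_map_fst coordinate_map_snd coordinate_map_id)
  then show ?thesis unfolding definable_map_def by (simp add: prod_eq_iff)
qed

lemma definable_map_coordinate_map: assumes "coordinate_map h" shows "definable_map h"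
proof -
  obtain k where k: "\<And>b. b \<in> Basis \<Longrightarrow> k b \<in> Basis \<and> (\<forall>x. h x \<bullet> b = x \<bullet> k b)"
    using assms unfolding coordinate_map_def by metis
  have "definable_pred (\<lambda>p::'a\<times>'b. \<forall>b\<in>Basis. p \<bullet> (0, b) = p \<bullet> (k b, 0))"
    by (intro definable_ball_finite definable_basis_eq) (use k in \<open>auto simp: Basis_prod_def\<close>)
  moreover have "(\<forall>b\<in>Basis. p \<bullet> (0, b) = p \<bullet> (k b, 0)) \<longleftrightarrow> snd p = h (fst p)" for p :: "'a \<times> 'b"
    using k by (auto simp: euclidean_eq_iff[of "snd p"] inner_prod_def)
  ultimately show ?thesis unfolding definable_map_def by simp
qed

lemma definable_map_id: "definable_map (\<lambda>x. x)" by (rule definable_map_coordinate_map[OF coordinate_map_id])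

lemma definable_map_fst: assumes "definable_map a" shows "definable_map (\<lambda>x. fst (a x))"
  by (rule definable_map_comp[OF definable_map_coordinate_map[OF coordinate_map_fst[OF coordinate_map_id]] assms])

lemma definable_map_snd: assumes "definable_map a" shows "definable_map (\<lambda>x. snd (a x))"
  by (rule definable_map_comp[OF definable_map_coordinate_map[OF coordinate_map_snd[OF coordinate_map_id]] assms])

lemma coordinate_map_inner: "b \<in> Basis \<Longrightarrow> coordinate_map (\<lambda>x. x \<bullet> b)"
  unfolding coordinate_map_def by (auto simp: inner_real_def)

lemma definable_map_inner_Basis: "b \<in> Basis \<Longrightarrow> definable_map a \<Longrightarrow> definable_map (\<lambda>x. a x \<bullet> b)"
  by (rule definable_map_comp[OF definable_map_coordinate_map[OF coordinate_map_inner]])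

lemma definable_eq: assumes "definable_map a" "definable_map b" shows "definable_pred (\<lambda>x. a x = b x)"
proof -
  have "definable_pred (\<lambda>x. (\<lambda>p. snd p = b (fst p)) (x, a x))"
    by (rule definable_subst[OF _ definable_map_pair[OF definable_map_id assms(1)]]) (use assms(2) in \<open>simp add: definable_map_def\<close>)
  then show ?thesis by simp
qed

lemma definable_map_euclidean: assumes "\<And>b. b \<in> Basis \<Longrightarrow> definable_map (\<lambda>x. a x \<bullet> b)" shows "definable_map a"
proof -
  have "definable_pred (\<lambda>p. \<forall>b\<in>Basis. snd p \<bullet> b = a (fst p) \<bullet> b)"
    by (intro definable_ball_finite definable_eq definable_map_inner_Basis definable_map_snd definable_map_id definable_map_comp[OF assms] definable_map_fst) auto
  moreover have "(\<forall>b\<in>Basis. snd p \<bullet> b = a (fst p) \<bullet> b) \<longleftrightarrow> snd p = a (fst p)" for p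
    using euclidean_eq_iff[of "snd p" "a (fst p)"] by blast
  ultimately show ?thesis unfolding definable_map_def by simp
qed

lemma definable_map_const: "definable_map (\<lambda>x. c)"
proof -
  have real: "definable_pred (\<lambda>x::real. x = k)" for k
  proof -
    define e where "e = (\<lambda>(i::nat) (l::nat). if i = 1 \<and> l = 0 then 1 else 0::nat)"
    have ne: "e 0 \<noteq> e 1" by (auto simp: e_def fun_eq_iff)
    have "(\<Prod>l<1. (xs ! l) ^ e 0 l) = 1" "(\<Prod>l<1. (xs ! l) ^ e 1 l) = xs ! 0" for xs :: "real list"
      by (auto simp: e_def)
    then have "poly_eval 1 {e 0, e 1} (\<lambda>a. if a = e 0 then -k else 1) xs = xs ! 0 - k" for xs
      using ne by (simp add: poly_eval_def)
    then have "{xs \<in> Rpow 1. xs ! 0 = k} \<in> \<O> 1"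
      using sets_poly[of 1 "{e 0, e 1}" "\<lambda>a. if a = e 0 then -k else 1"] by simp
    then show ?thesis by (intro definable_predI[of "[1]" "{xs \<in> Rpow 1. xs ! 0 = k}"]) (auto simp: Rpow_def)
  qed
  have "definable_pred (\<lambda>p::'a \<times> 'b. \<forall>b\<in>Basis. snd p \<bullet> b = c \<bullet> b)"
    by (intro definable_ball_finite definable_subst[OF real] definable_map_inner_Basis definable_map_snd definable_map_id) auto
  moreover have "(\<forall>b\<in>Basis. snd p \<bullet> b = c \<bullet> b) \<longleftrightarrow> snd p = c" for p :: "'a \<times> 'b"
    using euclidean_eq_iff[of "snd p" c] by blast
  ultimately show ?thesis unfolding definable_map_def by simp
qed

lemma definable_triple:
  assumes "{xs \<in> Rpow 3. Q (xs!0) (xs!1) (xs!2)} \<in> \<O> 3"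
  shows "definable_pred (\<lambda>p::(real \<times> real) \<times> real. Q (fst (fst p)) (snd (fst p)) (snd p))"
  by (rule definable_predI[of "[((1,0),0), ((0,1),0), (0,1)]" "{xs \<in> Rpow 3. Q (xs!0) (xs!1) (xs!2)}"])
    (use assms in \<open>auto simp: Rpow_def Basis_prod_def numeral_3_eq_3 inner_prod_def\<close>)

lemma definable_map_add_real: assumes "definable_map a" "definable_map b" shows "definable_map (\<lambda>x. a x + b x :: real)"
proof -
  define e where "e = (\<lambda>(i::nat) (l::nat). if l = i then 1 else 0::nat)"
  have ne: "e 0 \<noteq> e 1" "e 0 \<noteq> e 2" "e 1 \<noteq> e 2" by (auto simp: e_def fun_eq_iff)
  have "(\<Prod>l<3. (xs ! l) ^ e i l) = xs ! i" if "i < 3" for xs :: "real list" and i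
  proof -
    have "(\<Prod>l<3. (xs ! l) ^ e i l) = (\<Prod>l<3. if l = i then xs ! l else 1)"
      by (rule prod.cong) (auto simp: e_def)
    then show ?thesis using that by simp
  qed
  then have "poly_eval 3 {e 0, e 1, e 2} (\<lambda>a. if a = e 2 then 1 else -1) xs = xs ! 2 - (xs ! 0 + xs ! 1)" for xs
    using ne by (simp add: poly_eval_def)
  then have "{xs \<in> Rpow 3. xs ! 2 = xs ! 0 + xs ! 1} \<in> \<O> 3"
    using sets_poly[of 3 "{e 0, e 1, e 2}" "\<lambda>a. if a = e 2 then 1 else -1"] by simp
  from definable_triple[of "\<lambda>x y z. z = x + y", OF this]
  have "definable_map (\<lambda>p::real \<times> real. fst p + snd p)" unfolding definable_map_def .
  from definable_map_comp[OF this definable_map_pair[OF assms]] show ?thesis by simp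
qed

lemma definable_map_mult_real: assumes "definable_map a" "definable_map b" shows "definable_map (\<lambda>x. a x * b x :: real)"
proof -
  \<comment> \<open>the exponent vectors of \<open>X\<^sub>0 X\<^sub>1\<close> and \<open>X\<^sub>2\<close>\<close>
  define e where "e = (\<lambda>(i::nat) (l::nat). if (i = 0 \<and> l \<le> 1) \<or> (i = 1 \<and> l = 2) then 1 else 0::nat)"
  have "e 0 0 \<noteq> e 1 0" by (auto simp: e_def)
  then have ne: "e 0 \<noteq> e 1" by force
  have "(\<Prod>l<3. (xs ! l) ^ e 0 l) = xs ! 0 * xs ! 1" "(\<Prod>l<3. (xs ! l) ^ e 1 l) = xs ! 2" for xs :: "real list"
    by (simp_all add: e_def numeral_3_eq_3 numeral_2_eq_2)
  then have "poly_eval 3 {e 0, e 1} (\<lambda>a. if a = e 1 then 1 else -1) xs = xs ! 2 - xs ! 0 * xs ! 1" for xs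
    using ne by (simp add: poly_eval_def)
  then have "{xs \<in> Rpow 3. xs ! 2 = xs ! 0 * xs ! 1} \<in> \<O> 3"
    using sets_poly[of 3 "{e 0, e 1}" "\<lambda>a. if a = e 1 then 1 else -1"] by simp
  from definable_triple[of "\<lambda>x y z. z = x * y", OF this]
  have "definable_map (\<lambda>p::real \<times> real. fst p * snd p)" unfolding definable_map_def .
  from definable_map_comp[OF this definable_map_pair[OF assms]] show ?thesis by simp
qed

lemma definable_map_diff_real: assumes "definable_map a" "definable_map b" shows "definable_map (\<lambda>x. a x - b x :: real)"
  using definable_map_add_real[OF assms(1) definable_map_mult_real[OF definable_map_const[of "-1"] assms(2)]] by simp

lemma definable_map_sum_real: "finite I \<Longrightarrow> (\<And>i. i \<in> I \<Longrightarrow> definable_map (a i)) \<Longrightarrow> definable_map (\<lambda>x. \<Sum>i\<in>I. a i x :: real)"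
  by (induction I rule: finite_induct) (simp_all add: definable_map_const definable_map_add_real)

lemma definable_map_inner: assumes "definable_map a" "definable_map b" shows "definable_map (\<lambda>x. a x \<bullet> b x)"
  by (subst euclidean_inner) (intro definable_map_sum_real definable_map_mult_real definable_map_inner_Basis assms finite_Basis)

lemma definable_map_add: assumes "definable_map a" "definable_map b" shows "definable_map (\<lambda>x. a x + b x)"
  by (rule definable_map_euclidean) (simp add: inner_add_left definable_map_add_real definable_map_inner_Basis assms)

lemma definable_map_diff: assumes "definable_map a" "definable_map b" shows "definable_map (\<lambda>x. a x - b x)"
  by (rule definable_map_euclidean) (simp add: inner_diff_left definable_map_diff_real definable_map_inner_Basis assms)

lemma definable_map_scaleR: assumes "definable_map a" "definable_map b" shows "definable_map (\<lambda>x. a x *\<^sub>R b x)"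
  by (rule definable_map_euclidean) (simp add: definable_map_mult_real definable_map_inner_Basis assms)

lemma definable_le: assumes "definable_map a" "definable_map b" shows "definable_pred (\<lambda>x. a x \<le> (b x :: real))"
proof -
  \<comment> \<open>the order is definable because the nonnegative reals are the squares\<close>
  have "definable_pred (\<lambda>x. \<exists>w. b x = a x + w * w)"
    by (intro definable_ex definable_eq definable_map_add_real definable_map_mult_real definable_map_comp[OF assms(1)] definable_map_comp[OF assms(2)] definable_map_fst definable_map_snd definable_map_id)
  moreover have "(\<exists>w. b x = a x + w * w) \<longleftrightarrow> a x \<le> b x" for x
  proof
    assume "a x \<le> b x"
    then have "b x = a x + sqrt (b x - a x) * sqrt (b x - a x)" by simp
    then show "\<exists>w. b x = a x + w * w" by blast
  qed auto
  ultimately show ?thesis by simp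
qed

lemma definable_less: assumes "definable_map a" "definable_map b" shows "definable_pred (\<lambda>x. a x < (b x :: real))"
  using definable_not[OF definable_le[OF assms(2,1)]] by (simp add: not_le)

lemma definable_norm_le: assumes "definable_map a" "definable_map b" shows "definable_pred (\<lambda>x. norm (a x) \<le> b x)"
proof -
  have "definable_pred (\<lambda>x. 0 \<le> b x \<and> a x \<bullet> a x \<le> b x * b x)"
    by (intro definable_conj definable_le definable_map_mult_real definable_map_inner definable_map_const assms)
  moreover have "(0 \<le> b x \<and> a x \<bullet> a x \<le> b x * b x) \<longleftrightarrow> norm (a x) \<le> b x" for x
  proof -
    have "a x \<bullet> a x = norm (a x) * norm (a x)" by (simp add: dot_square_norm power2_eq_square)
    moreover have "norm (a x) \<le> b x" if "0 \<le> b x" "norm (a x) * norm (a x) \<le> b x * b x"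
      using power2_le_imp_le[of "norm (a x)" "b x"] that by (simp add: power2_eq_square)
    moreover have "norm (a x) * norm (a x) \<le> b x * b x" "0 \<le> b x" if "norm (a x) \<le> b x"
      using mult_mono[OF that that] order_trans[OF norm_ge_zero that] by simp_all
    ultimately show ?thesis by auto
  qed
  ultimately show ?thesis by simp
qed

lemma definable_norm_less: assumes "definable_map a" "definable_map b" shows "definable_pred (\<lambda>x. norm (a x) < b x)"
proof -
  have "definable_pred (\<lambda>x. norm (a x) \<le> b x \<and> \<not> a x \<bullet> a x = b x * b x)"
    by (intro definable_conj definable_not definable_norm_le definable_eq definable_map_inner definable_map_mult_real assms)
  moreover have "(norm (a x) \<le> b x \<and> \<not> a x \<bullet> a x = b x * b x) \<longleftrightarrow> norm (a x) < b x" for x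
  proof -
    have "a x \<bullet> a x = norm (a x) * norm (a x)" by (simp add: dot_square_norm power2_eq_square)
    moreover have "norm (a x) * norm (a x) < b x * b x" if "norm (a x) < b x"
      using mult_strict_mono'[OF that that] by simp
    ultimately show ?thesis by (cases "norm (a x) = b x") auto
  qed
  ultimately show ?thesis by simp
qed

lemmas definable_intros = definable_conj definable_disj definable_imp definable_not definable_ex definable_all definable_le definable_less definable_norm_le definable_norm_less definable_eq
lemmas definable_map_intros = definable_map_add definable_map_diff definable_map_mult_real definable_map_scaleR definable_map_inner_Basis definable_map_pair definable_map_fst definable_map_snd definable_map_id definable_map_const

text \<open>The link between the list-based notion of a definable function and predicates on Euclidean spaces.\<close>

lemma definable_graph:
  fixes g :: "real ^ 'n::{finite,linorder} \<Rightarrow> real"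
  assumes "definable_fun \<O> N g"
  shows "definable_pred (\<lambda>p. fst p \<in> N \<and> snd p = g (fst p))"
proof -
  let ?l = "sorted_list_of_set (UNIV :: 'n set)"
  let ?bs = "map (\<lambda>i. (axis i (1::real), 0::real)) ?l @ [(0, 1)]"
  have co: "map ((\<bullet>) (x, y)) ?bs = coords x @ [y]" for x :: "(real, 'n) vec" and y
    by (simp add: coords_def inner_axis o_def)
  have inj: "x = x'" if "coords x = coords x'" for x x' :: "(real, 'n) vec"
    using that by (simp add: coords_def vec_eq_iff)
  show ?thesis
  proof (rule definable_predI[of ?bs "{coords x @ [g x] | x. x \<in> N}"])
    show "set ?bs \<subseteq> Basis" by (auto simp: Basis_prod_def Basis_vec_def axis_eq_axis)
    show "{coords x @ [g x] |x. x \<in> N} \<in> \<O> (length ?bs)"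
      using assms by (simp add: definable_fun_def)
    show "fst p \<in> N \<and> snd p = g (fst p) \<longleftrightarrow> map ((\<bullet>) p) ?bs \<in> {coords x @ [g x] |x. x \<in> N}" for p
      using co[of "fst p" "snd p"] inj by auto
  qed simp
qed

end

section \<open>Definable subsets of the line and definable choice\<close>

text \<open>A first-order description of one element of a nonempty set \<open>A\<close> that is bounded below: the infimum
  \<open>m\<close> if it is attained, and otherwise the midpoint of the longest interval \<open>(m, m + d)\<close>
  inside \<open>A\<close> with \<open>d \<le> 1\<close>.  Being first-order in \<open>A\<close>, it depends definably on parameters.\<close>

definition canonical_element :: "(real \<Rightarrow> bool) \<Rightarrow> real \<Rightarrow> bool" where
  "canonical_element A c \<longleftrightarrow> A c \<and> (\<exists>m. (\<forall>z. A z \<longrightarrow> m \<le> z) \<and> (\<forall>m'. (\<forall>z. A z \<longrightarrow> m' \<le> z) \<longrightarrow> m' \<le> m) \<and>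
     ((A m \<and> c = m) \<or>
      (\<not> A m \<and> (\<exists>d. d \<le> 1 \<and> (\<forall>z. m < z \<and> z < m + d \<longrightarrow> A z) \<and>
         (\<forall>d'. d' \<le> 1 \<and> (\<forall>z. m < z \<and> z < m + d' \<longrightarrow> A z) \<longrightarrow> d' \<le> d) \<and> 2 * (c - m) = d))))"

lemma canonical_element_unique: "canonical_element A c \<Longrightarrow> canonical_element A c' \<Longrightarrow> c = c'"
  unfolding canonical_element_def
proof (elim conjE exE)
  fix m m'
  assume "\<forall>z. A z \<longrightarrow> m \<le> z" "\<forall>m'. (\<forall>z. A z \<longrightarrow> m' \<le> z) \<longrightarrow> m' \<le> m"
    "\<forall>z. A z \<longrightarrow> m' \<le> z" "\<forall>m''. (\<forall>z. A z \<longrightarrow> m'' \<le> z) \<longrightarrow> m'' \<le> m'"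
  then have m: "m' = m" by (meson order_antisym)
  assume 1: "A m \<and> c = m \<or> \<not> A m \<and>
        (\<exists>d\<le>1. (\<forall>z. m < z \<and> z < m + d \<longrightarrow> A z) \<and>
               (\<forall>d'. d' \<le> 1 \<and> (\<forall>z. m < z \<and> z < m + d' \<longrightarrow> A z) \<longrightarrow> d' \<le> d) \<and> 2 * (c - m) = d)"
    and 2: "A m' \<and> c' = m' \<or> \<not> A m' \<and>
        (\<exists>d\<le>1. (\<forall>z. m' < z \<and> z < m' + d \<longrightarrow> A z) \<and>
               (\<forall>d'. d' \<le> 1 \<and> (\<forall>z. m' < z \<and> z < m' + d' \<longrightarrow> A z) \<longrightarrow> d' \<le> d) \<and> 2 * (c' - m') = d)"
  show "c = c'"
  proof (cases "A m")
    case True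
    then show ?thesis using 1 2 m by simp
  next
    case False
    with 1 2 m obtain d d' where d: "2 * (c - m) = d" "2 * (c' - m) = d'"
      "d \<le> 1" "\<forall>z. m < z \<and> z < m + d \<longrightarrow> A z" "d' \<le> 1" "\<forall>z. m < z \<and> z < m + d' \<longrightarrow> A z"
      "\<forall>d'. d' \<le> 1 \<and> (\<forall>z. m < z \<and> z < m + d' \<longrightarrow> A z) \<longrightarrow> d' \<le> d"
      "\<forall>d. d \<le> 1 \<and> (\<forall>z. m < z \<and> z < m + d \<longrightarrow> A z) \<longrightarrow> d \<le> d'"
      by auto
    then have "d = d'" by (meson order_antisym)
    then have "2 * (c - m) = 2 * (c' - m)" using d(1,2) by simp
    then show ?thesis by simp
  qed
qed

text \<open>Induction along an interval: a property that propagates a little to the right, and to left limits,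
  propagates to the end.\<close>

lemma real_induction:
  fixes a b :: real
  assumes "a \<le> b" and base: "P a"
    and right: "\<And>s. a \<le> s \<Longrightarrow> s < b \<Longrightarrow> P s \<Longrightarrow> \<exists>\<rho>>0. \<forall>t. s < t \<and> t < s + \<rho> \<longrightarrow> P t"
    and left: "\<And>s. a < s \<Longrightarrow> s \<le> b \<Longrightarrow> (\<And>t. a \<le> t \<Longrightarrow> t < s \<Longrightarrow> P t) \<Longrightarrow> P s"
  shows "P b"
proof -
  define S where "S = {s. a \<le> s \<and> s \<le> b \<and> (\<forall>t. a \<le> t \<and> t \<le> s \<longrightarrow> P t)}"
  have aS: "a \<in> S" using assms(1) base by (auto simp: S_def)
  have bdd: "bdd_above S" unfolding S_def bdd_above_def by blast
  define m where "m = Sup S"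
  have am: "a \<le> m" unfolding m_def using aS bdd by (rule cSup_upper)
  have mb: "m \<le> b" unfolding m_def using aS by (intro cSup_least) (auto simp: S_def)
  have below: "P t" if "a \<le> t" and tm: "t < m" for t
  proof -
    obtain s where "s \<in> S" "t < s"
      using less_cSupE[of t S] tm aS unfolding m_def by (metis empty_iff)
    then show ?thesis using that by (auto simp: S_def)
  qed
  have Pm: "P m" using left[of m] base below am mb by (cases "a = m") auto
  have "m = b"
  proof (rule ccontr)
    assume "m \<noteq> b"
    then have "m < b" using mb by simp
    then obtain \<rho> where \<rho>: "\<rho> > 0" "\<And>t. m < t \<Longrightarrow> t < m + \<rho> \<Longrightarrow> P t" using right[OF am _ Pm] by blast
    define s where "s = min b (m + \<rho> / 2)"
    have "s > m" "s < m + \<rho>" "s \<le> b" using \<rho> \<open>m < b\<close> by (auto simp: s_def min_less_iff_disj)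
    then have "s \<in> S" using am below Pm \<rho>(2) unfolding S_def
      by (smt (verit, best) mem_Collect_eq)
    then have "s \<le> m" unfolding m_def using bdd by (rule cSup_upper)
    then show False using \<open>s > m\<close> by simp
  qed
  then show ?thesis using Pm by simp
qed

lemma nondecreasing_from_germs:
  fixes \<phi> :: "real \<Rightarrow> real"
  assumes right: "\<And>t. a < t \<Longrightarrow> t < b \<Longrightarrow> \<exists>\<rho>>0. \<forall>t'. t < t' \<and> t' < t + \<rho> \<longrightarrow> \<phi> t \<le> \<phi> t'"
    and left: "\<And>t. a < t \<Longrightarrow> t < b \<Longrightarrow> \<exists>\<rho>>0. \<forall>t'. t - \<rho> < t' \<and> t' < t \<longrightarrow> \<phi> t' \<le> \<phi> t"
    and "a < s" "s < t" "t < b"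
  shows "\<phi> s \<le> \<phi> t"
proof (rule real_induction[of s t])
  show "s \<le> t" "\<phi> s \<le> \<phi> s" using assms by auto
next
  fix x assume x: "s \<le> x" "x < t" "\<phi> s \<le> \<phi> x"
  then show "\<exists>\<rho>>0. \<forall>t. x < t \<and> t < x + \<rho> \<longrightarrow> \<phi> s \<le> \<phi> t"
    using right[of x] assms by (meson order_trans order_less_le_trans order_less_trans)
next
  fix x assume x: "s < x" "x \<le> t" "\<And>y. s \<le> y \<Longrightarrow> y < x \<Longrightarrow> \<phi> s \<le> \<phi> y"
  then obtain \<rho> where \<rho>: "\<rho> > 0" "\<And>t'. x - \<rho> < t' \<Longrightarrow> t' < x \<Longrightarrow> \<phi> t' \<le> \<phi> x"
    using left[of x] assms by (meson order_le_less_trans order_less_trans)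
  obtain y where "max s (x - \<rho>) < y" "y < x" using dense[of "max s (x - \<rho>)" x] \<rho>(1) x(1) by auto
  then show "\<phi> s \<le> \<phi> x" using x(3)[of y] \<rho>(2)[of y] by auto
qed

context omin
begin

lemma definable_real_intervals:
  fixes P :: "real \<Rightarrow> bool"
  assumes "definable_pred P"
  obtains \<I> where "finite \<I>" "\<And>I. I \<in> \<I> \<Longrightarrow> is_interval I" "\<And>x. P x \<longleftrightarrow> x \<in> \<Union>\<I>"
proof -
  obtain A where A: "A \<in> \<O> (length [1::real])" "\<And>x. P x \<longleftrightarrow> map ((\<bullet>) x) [1] \<in> A"
    using definable_coordinates[OF assms, of "[1]"] by auto
  have "length [1::real] = 1" by simp
  then have "A \<in> {(\<lambda>x. [x]) ` \<Union>\<I> | \<I> :: real set set. finite \<I> \<and> (\<forall>I\<in>\<I>. is_interval I)}"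
    using A(1) sets_one by simp
  then obtain \<I> where "A = (\<lambda>x. [x]) ` \<Union>\<I>" "finite \<I>" "\<forall>I\<in>\<I>. is_interval I"
    by blast
  then show ?thesis using that[of \<I>] A(2) by auto
qed

text \<open>A finite union of intervals is infinite only if one of the intervals has two points.\<close>

lemma definable_infinite_interval:
  fixes P :: "real \<Rightarrow> bool"
  assumes "definable_pred P" "infinite {x. P x}"
  obtains a b where "a < b" "\<And>x. a < x \<Longrightarrow> x < b \<Longrightarrow> P x"
proof -
  obtain \<I> where I: "finite \<I>" "\<And>I. I \<in> \<I> \<Longrightarrow> is_interval I" "\<And>x. P x \<longleftrightarrow> x \<in> \<Union>\<I>"
    using definable_real_intervals[OF assms(1)] by blast
  have "{x. P x} = \<Union>\<I>" using I(3) by auto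
  then obtain I where inf: "I \<in> \<I>" "infinite I" using assms(2) I(1) by (metis finite_Union)
  obtain a where a: "a \<in> I" using inf(2) by (metis all_not_in_conv finite.emptyI)
  have "I \<noteq> {a}" using inf(2) by auto
  then obtain b where b: "b \<in> I" "b \<noteq> a" using a by auto
  have "min a b \<in> I" "max a b \<in> I" using a b(1) by (auto simp: min_def max_def)
  then have "x \<in> I" if "min a b < x" "x < max a b" for x
    using I(2)[OF inf(1)] that unfolding is_interval_1 by (meson less_imp_le)
  then have "P x" if "min a b < x" "x < max a b" for x using I(3)[of x] inf(1) that by blast
  moreover have "min a b < max a b" using b(2) by auto
  ultimately show ?thesis using that[of "min a b" "max a b"] by blast
qed

text \<open>The form in which o-minimality is used most: a definable predicate on the line
  does not oscillate at a point.\<close>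

lemma germ_right:
  fixes P :: "real \<Rightarrow> bool"
  assumes "definable_pred P"
  obtains \<rho> where "\<rho> > 0" "(\<forall>t. x < t \<and> t < x + \<rho> \<longrightarrow> P t) \<or> (\<forall>t. x < t \<and> t < x + \<rho> \<longrightarrow> \<not> P t)"
proof -
  obtain \<I> where I: "finite \<I>" "\<And>I. I \<in> \<I> \<Longrightarrow> is_interval I" "\<And>x. P x \<longleftrightarrow> x \<in> \<Union>\<I>"
    using definable_real_intervals[OF assms(1)] by blast
  have "\<exists>\<rho>>0. (\<forall>t. x < t \<and> t < x + \<rho> \<longrightarrow> t \<in> \<Union>\<I>) \<or> (\<forall>t. x < t \<and> t < x + \<rho> \<longrightarrow> t \<notin> \<Union>\<I>)"
    using I(1,2)
  proof (induction \<I> rule: finite_induct)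
    case empty
    then show ?case by (auto intro: exI[of _ 1])
  next
    case (insert I \<I>)
    then obtain \<rho> where \<rho>: "\<rho> > 0" "(\<forall>t. x < t \<and> t < x + \<rho> \<longrightarrow> t \<in> \<Union>\<I>) \<or> (\<forall>t. x < t \<and> t < x + \<rho> \<longrightarrow> t \<notin> \<Union>\<I>)"
      by auto
    show ?case
    proof (cases "\<exists>\<sigma>>0. \<forall>t. x < t \<and> t < x + \<sigma> \<longrightarrow> t \<notin> I")
      case True
      then obtain \<sigma> where "\<sigma> > 0" "\<forall>t. x < t \<and> t < x + \<sigma> \<longrightarrow> t \<notin> I" by blast
      then show ?thesis using \<rho> by (intro exI[of _ "min \<rho> \<sigma>"]) auto
    next
      case False
      then obtain t1 where t1: "x < t1" "t1 \<in> I" by (metis zero_less_one)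
      have "t \<in> I" if "x < t" "t < t1" for t
      proof -
        have "t - x > 0" using that(1) by simp
        then obtain t0 where t0: "x < t0" "t0 < x + (t - x)" "t0 \<in> I" using False by blast
        then have "t0 \<le> t" "t \<le> t1" using that(2) by auto
        then show ?thesis using insert.prems[of I] t1(2) t0(3) unfolding is_interval_1 by blast
      qed
      then show ?thesis using t1(1) by (intro exI[of _ "t1 - x"]) auto
    qed
  qed
  then show ?thesis using that I(3) by metis
qed

lemma definable_subst2: assumes "definable_pred (\<lambda>p. A (fst p) (snd p))" "definable_map h" "definable_map k" shows "definable_pred (\<lambda>x. A (h x) (k x))"
  using definable_subst[OF assms(1) definable_map_pair[OF assms(2,3)]] by simp

lemma definable_map_subst2: assumes "definable_map (\<lambda>p. u (fst p) (snd p))" "definable_map h" "definable_map k" shows "definable_map (\<lambda>x. u (h x) (k x))"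
  using definable_map_comp[OF assms(1) definable_map_pair[OF assms(2,3)]] by simp

lemma germ_left:
  fixes P :: "real \<Rightarrow> bool"
  assumes "definable_pred P"
  obtains \<rho> where "\<rho> > 0" "(\<forall>t. x - \<rho> < t \<and> t < x \<longrightarrow> P t) \<or> (\<forall>t. x - \<rho> < t \<and> t < x \<longrightarrow> \<not> P t)"
proof -
  have "definable_pred (\<lambda>t. P (0 - t))" by (intro definable_subst[OF assms] definable_map_intros)
  then obtain \<rho> where \<rho>: "\<rho> > 0" "(\<forall>t. - x < t \<and> t < - x + \<rho> \<longrightarrow> P (0 - t)) \<or> (\<forall>t. - x < t \<and> t < - x + \<rho> \<longrightarrow> \<not> P (0 - t))"
    using germ_right by blast
  have "(\<forall>t. x - \<rho> < t \<and> t < x \<longrightarrow> P t) \<or> (\<forall>t. x - \<rho> < t \<and> t < x \<longrightarrow> \<not> P t)"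
    using \<rho>(2)
  proof (elim disjE)
    assume h: "\<forall>t. - x < t \<and> t < - x + \<rho> \<longrightarrow> P (0 - t)"
    have "P t" if "x - \<rho> < t" "t < x" for t using h[rule_format, of "-t"] that by simp
    then show ?thesis by blast
  next
    assume h: "\<forall>t. - x < t \<and> t < - x + \<rho> \<longrightarrow> \<not> P (0 - t)"
    have "\<not> P t" if "x - \<rho> < t" "t < x" for t using h[rule_format, of "-t"] that by simp
    then show ?thesis by blast
  qed
  then show ?thesis using that \<rho>(1) by blast
qed

lemma definable_canonical_element:
  assumes A: "definable_pred (\<lambda>p. A (fst p) (snd p))" and c: "definable_map c"
  shows "definable_pred (\<lambda>x. canonical_element (A x) (c x))"
  unfolding canonical_element_def
  by (intro definable_intros definable_map_intros definable_subst2[OF A] definable_map_comp[OF c])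

lemma canonical_element_exists:
  assumes "definable_pred A" "A a" "\<And>z. A z \<Longrightarrow> lo \<le> z"
  shows "\<exists>c. canonical_element A c"
proof -
  define m where "m = Inf {z. A z}"
  have bdd: "bdd_below {z. A z}" unfolding bdd_below_def using assms(3) by auto
  have low: "\<And>z. A z \<Longrightarrow> m \<le> z" unfolding m_def using bdd by (auto intro: cInf_lower)
  have gr: "\<And>m'. (\<forall>z. A z \<longrightarrow> m' \<le> z) \<Longrightarrow> m' \<le> m" unfolding m_def using assms(2) by (intro cInf_greatest) auto
  show ?thesis
  proof (cases "A m")
    case True
    then have "canonical_element A m" unfolding canonical_element_def using low gr by (intro conjI exI[of _ m]) auto
    then show ?thesis by blast
  next
    case False
    obtain \<rho> where \<rho>: "\<rho> > 0" "(\<forall>t. m < t \<and> t < m + \<rho> \<longrightarrow> A t) \<or> (\<forall>t. m < t \<and> t < m + \<rho> \<longrightarrow> \<not> A t)"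
      using germ_right[OF assms(1)] by blast
    have "\<not> (\<forall>t. m < t \<and> t < m + \<rho> \<longrightarrow> \<not> A t)"
    proof
      assume "\<forall>t. m < t \<and> t < m + \<rho> \<longrightarrow> \<not> A t"
      then have "\<forall>z. A z \<longrightarrow> m + \<rho> \<le> z" using low False by (metis linorder_not_less order_less_le)
      then have "m + \<rho> \<le> m" by (rule gr)
      then show False using \<rho>(1) by simp
    qed
    then have A: "\<And>t. m < t \<Longrightarrow> t < m + \<rho> \<Longrightarrow> A t" using \<rho>(2) by blast
    define D where "D = {d. d \<le> 1 \<and> (\<forall>z. m < z \<and> z < m + d \<longrightarrow> A z)}"
    define d where "d = Sup D"
    have bD: "bdd_above D" unfolding D_def bdd_above_def by blast
    have mem: "min \<rho> 1 \<in> D" unfolding D_def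
    proof (intro CollectI conjI allI impI)
      fix z assume "m < z \<and> z < m + min \<rho> 1"
      then show "A z" using A[of z] by linarith
    qed simp
    have d0: "d > 0" using cSup_upper[OF mem bD] \<rho>(1) unfolding d_def by auto
    have d1: "d \<le> 1" unfolding d_def
    proof (rule cSup_least)
      show "D \<noteq> {}" using mem by blast
    qed (simp add: D_def)
    have dA: "A z" if mz: "m < z" "z < m + d" for z
    proof -
      have "z - m < Sup D" using mz by (simp add: d_def)
      then obtain d' where d': "d' \<in> D" "z - m < d'" using mem less_cSupE[of "z - m" D] by (metis empty_iff)
      then have "m < z \<and> z < m + d'" using mz by simp
      then show ?thesis using d'(1) unfolding D_def by blast
    qed
    have dup: "\<And>d'. d' \<le> 1 \<and> (\<forall>z. m < z \<and> z < m + d' \<longrightarrow> A z) \<Longrightarrow> d' \<le> d"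
      unfolding d_def using bD by (intro cSup_upper) (auto simp: D_def)
    have "A (m + d / 2)" using dA d0 by simp
    moreover have "2 * (m + d / 2 - m) = d" by simp
    ultimately have "canonical_element A (m + d / 2)" unfolding canonical_element_def
      using low gr False dA dup d1 by (intro conjI exI[of _ m]) blast+
    then show ?thesis by blast
  qed
qed

text \<open>The coordinates of the chosen point are fixed one after the other: once the coordinates in \<open>I\<close> are
  determined by the parameter, the next one is the canonical element of its set of possible values.\<close>

lemma definable_choice:
  fixes P :: "'c::euclidean_space \<Rightarrow> 'd::euclidean_space \<Rightarrow> bool"
  assumes P: "definable_pred (\<lambda>p. P (fst p) (snd p))" and lo: "\<And>x y b. P x y \<Longrightarrow> b \<in> Basis \<Longrightarrow> lo \<le> y \<bullet> b"
  obtains C where "definable_map C" "\<And>x y. P x y \<Longrightarrow> P x (C x)"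
proof -
  have "\<exists>Q. definable_pred (\<lambda>p. Q (fst p) (snd p)) \<and> (\<forall>x y. Q x y \<longrightarrow> P x y) \<and> (\<forall>x y. P x y \<longrightarrow> (\<exists>y. Q x y)) \<and>
        (\<forall>x y y'. Q x y \<longrightarrow> Q x y' \<longrightarrow> (\<forall>b\<in>I. y \<bullet> b = y' \<bullet> b))"
    if "finite I" "I \<subseteq> (Basis :: 'd set)" for I
    using that
  proof (induction I rule: finite_induct)
    case empty
    then show ?case using P by (intro exI[of _ P]) auto
  next
    case (insert b I)
    then have b: "b \<in> Basis" by simp
    obtain Q where Q: "definable_pred (\<lambda>p. Q (fst p) (snd p))" "\<And>x y. Q x y \<Longrightarrow> P x y" "\<And>x y. P x y \<Longrightarrow> \<exists>y. Q x y"
      "\<And>x y y'. Q x y \<Longrightarrow> Q x y' \<Longrightarrow> \<forall>b\<in>I. y \<bullet> b = y' \<bullet> b" using insert by blast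
    define A where "A = (\<lambda>x c. \<exists>y. Q x y \<and> y \<bullet> b = c)"
    have A: "definable_pred (\<lambda>p. A (fst p) (snd p))" unfolding A_def
      by (intro definable_intros definable_map_intros definable_subst2[OF Q(1)] b)
    have Ax: "definable_pred (A x)" for x
      using definable_subst2[OF A definable_map_const definable_map_id] by simp
    define Q' where "Q' = (\<lambda>x y. Q x y \<and> canonical_element (A x) (y \<bullet> b))"
    show ?case
    proof (intro exI[of _ Q'] conjI allI impI)
      have "definable_pred (\<lambda>p. canonical_element (A (fst p)) (snd p))"
        by (rule definable_canonical_element[of "\<lambda>p. A (fst p)" snd]) (intro definable_subst2[OF A] definable_map_intros)+
      note pk = definable_subst2[of "\<lambda>x c. canonical_element (A x) c", OF this]
      show "definable_pred (\<lambda>p. Q' (fst p) (snd p))" unfolding Q'_def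
        by (intro definable_conj pk definable_subst2[OF Q(1)] definable_map_intros b)
      show "P x y" if "Q' x y" for x y using that Q(2) by (simp add: Q'_def)
      show "\<exists>y. Q' x y" if Pxy: "P x y" for x y
      proof -
        obtain y0 where "Q x y0" using Q(3)[OF Pxy] by blast
        then have "\<exists>c. canonical_element (A x) c"
          by (intro canonical_element_exists[OF Ax, of x "y0 \<bullet> b" lo]) (use lo[OF Q(2) b] in \<open>auto simp: A_def\<close>)
        then obtain c where c: "canonical_element (A x) c" by blast
        then have "A x c" by (simp add: canonical_element_def)
        then show ?thesis using c by (auto simp: A_def Q'_def)
      qed
      show "\<forall>b\<in>insert b I. y \<bullet> b = y' \<bullet> b" if "Q' x y" "Q' x y'" for x y y'
        using that Q(4) canonical_element_unique by (auto simp: Q'_def)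
    qed
  qed
  from this[OF finite_Basis order_refl] obtain Q where Q: "definable_pred (\<lambda>p. Q (fst p) (snd p))" "\<And>x y. Q x y \<Longrightarrow> P x y" "\<And>x y. P x y \<Longrightarrow> \<exists>y. Q x y"
      "\<And>x y y'. Q x y \<Longrightarrow> Q x y' \<Longrightarrow> \<forall>b\<in>Basis. y \<bullet> b = y' \<bullet> b" by blast
  have uniq: "y = y'" if "Q x y" "Q x y'" for x y y'
    using Q(4)[OF that] by (auto intro: euclidean_eqI)
  define C where "C = (\<lambda>x. if \<exists>y. Q x y then (SOME y. Q x y) else 0)"
  have C: "Q x (C x)" if "Q x y" for x y using that unfolding C_def by (auto intro: someI)
  have "snd p = C (fst p) \<longleftrightarrow> Q (fst p) (snd p) \<or> (\<not> (\<exists>y. Q (fst p) y) \<and> snd p = 0)" for p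
  proof (cases "\<exists>y. Q (fst p) y")
    case True
    then have "Q (fst p) (C (fst p))" using C by blast
    then show ?thesis using uniq True by auto
  next
    case False
    then have "C (fst p) = 0" by (auto simp: C_def)
    then show ?thesis using False by auto
  qed
  moreover have "definable_pred (\<lambda>p. Q (fst p) (snd p) \<or> (\<not> (\<exists>y. Q (fst p) y) \<and> snd p = 0))"
    by (intro definable_intros definable_map_intros definable_subst2[OF Q(1)])
  ultimately have "definable_map C" unfolding definable_map_def by simp
  then show ?thesis
  proof (rule that)
    fix x y assume "P x y"
    then obtain y' where "Q x y'" using Q(3) by blast
    then show "P x (C x)" using C Q(2) by blast
  qed
qed

end

section \<open>Slopes of definable functions\<close>

text \<open>Two points of an interval for which the same radius \<open>1 / (n + 1)\<close> works and which are closer than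
  that radius give contradictory information about the step between them.  Such a pair exists because an
  uncountable set cannot be split into countably many pieces with at most one point.
  For instance, a function cannot have a strict local minimum everywhere.\<close>

lemma incompatible_germs:
  fixes A :: "real \<Rightarrow> real \<Rightarrow> bool"
  assumes "a < b"
    and germs: "\<And>t. a < t \<Longrightarrow> t < b \<Longrightarrow> \<exists>\<rho>>0. (\<forall>t'. t < t' \<and> t' < t + \<rho> \<longrightarrow> A t t') \<and> (\<forall>t'. t - \<rho> < t' \<and> t' < t \<longrightarrow> \<not> A t' t)"
  shows False
proof -
  define d where "d = (\<lambda>n. inverse (real (Suc n)))"
  \<comment> \<open>the integer \<open>k\<close> confines \<open>t\<close> to an interval of length \<open>d n\<close>\<close>
  define S where "S = (\<lambda>n (k::int). {t. a < t \<and> t < b \<and> k = \<lfloor>t * real (Suc n)\<rfloor> \<and>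
    (\<forall>t'. t < t' \<and> t' < t + d n \<longrightarrow> A t t') \<and> (\<forall>t'. t - d n < t' \<and> t' < t \<longrightarrow> \<not> A t' t)})"
  have "{a<..<b} \<subseteq> (\<Union>n. \<Union>k. S n k)"
  proof
    fix t assume "t \<in> {a<..<b}"
    then have t: "a < t" "t < b" by auto
    then obtain \<rho> where \<rho>: "\<rho> > 0" "\<forall>t'. t < t' \<and> t' < t + \<rho> \<longrightarrow> A t t'" "\<forall>t'. t - \<rho> < t' \<and> t' < t \<longrightarrow> \<not> A t' t"
      using germs by blast
    obtain n where "d n < \<rho>" using reals_Archimedean[OF \<rho>(1)] by (auto simp: d_def)
    then have "t \<in> S n \<lfloor>t * real (Suc n)\<rfloor>" using t \<rho>(2,3) unfolding S_def by auto
    then show "t \<in> (\<Union>n. \<Union>k. S n k)" by blast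
  qed
  moreover have "uncountable {a<..<b}" using \<open>a < b\<close> by (simp add: uncountable_open_interval)
  ultimately have "uncountable (\<Union>n. \<Union>k. S n k)" using countable_subset by blast
  then obtain n k where "uncountable (S n k)" by (meson countable_UN countableI_type)
  then have "infinite (S n k)" using countable_finite by blast
  then obtain s where s: "s \<in> S n k" "S n k \<noteq> {s}" by (metis finite.emptyI finite.insertI all_not_in_conv)
  then obtain t where t: "t \<in> S n k" "t \<noteq> s" by blast
  have close: "y - x < d n" if "x \<in> S n k" "y \<in> S n k" for x y
  proof -
    have "\<lfloor>x * real (Suc n)\<rfloor> = \<lfloor>y * real (Suc n)\<rfloor>" using that by (auto simp: S_def)
    then have "y * real (Suc n) - x * real (Suc n) < 1" by linarith
    then show ?thesis unfolding d_def by (simp add: field_simps)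
  qed
  have "False" if "x \<in> S n k" "y \<in> S n k" "x < y" for x y
    using that close[OF that(1,2)] unfolding S_def by (smt (verit) mem_Collect_eq)
  then show False using s t by (metis linorder_neqE_linordered_idom)
qed

context omin
begin

text \<open>For a fixed slope \<open>q\<close>, the function \<open>u(\<cdot>, r) - q t\<close> has at each point \<open>t\<close> one of four types, according to
  its behaviour in the right and left germs of \<open>t\<close>.  For fixed \<open>t\<close>, the type is constant for small \<open>r\<close>
  by o-minimality.  By uncountability some type occurs, with the same bound on \<open>r\<close>, on a whole
  interval.  Two of the types mean that the function is monotone there; the other two are
  impossible.  The point is that the subinterval and the bound on \<open>r\<close> are uniform.\<close>

lemma slope_dichotomy:
  fixes u :: "real \<Rightarrow> real \<Rightarrow> real"
  assumes u: "definable_map (\<lambda>p. u (fst p) (snd p))" and "a < b"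
  obtains a' b' \<delta> where "a \<le> a'" "a' < b'" "b' \<le> b" "\<delta> > 0"
    "(\<forall>r s t. 0 < r \<and> r < \<delta> \<and> a' < s \<and> s < t \<and> t < b' \<longrightarrow> q * (t - s) \<le> u t r - u s r) \<or>
     (\<forall>r s t. 0 < r \<and> r < \<delta> \<and> a' < s \<and> s < t \<and> t < b' \<longrightarrow> u t r - u s r \<le> q * (t - s))"
proof -
  define R where "R = (\<lambda>t r. \<exists>\<rho>>0. \<forall>t'. t < t' \<and> t' < t + \<rho> \<longrightarrow> q * (t' - t) \<le> u t' r - u t r)"
  define L where "L = (\<lambda>t r. \<exists>\<rho>>0. \<forall>t'. t - \<rho> < t' \<and> t' < t \<longrightarrow> q * (t - t') \<le> u t r - u t' r)"
  have R: "definable_pred (\<lambda>p. R (fst p) (snd p))" unfolding R_def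
    by (intro definable_intros definable_map_intros definable_map_subst2[OF u])
  have L: "definable_pred (\<lambda>p. L (fst p) (snd p))" unfolding L_def
    by (intro definable_intros definable_map_intros definable_map_subst2[OF u])
  have notR: "\<exists>\<rho>>0. \<forall>t'. t < t' \<and> t' < t + \<rho> \<longrightarrow> u t' r - u t r < q * (t' - t)" if "\<not> R t r" for t r
  proof -
    have "definable_pred (\<lambda>t'. q * (t' - t) \<le> u t' r - u t r)" by (intro definable_intros definable_map_intros definable_map_diff definable_map_subst2[OF u])
    then obtain \<rho> where \<rho>: "\<rho> > 0" "(\<forall>t'. t < t' \<and> t' < t + \<rho> \<longrightarrow> q * (t' - t) \<le> u t' r - u t r) \<or> (\<forall>t'. t < t' \<and> t' < t + \<rho> \<longrightarrow> \<not> q * (t' - t) \<le> u t' r - u t r)"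
      by (rule germ_right)
    then show ?thesis using that unfolding R_def by (meson not_le_imp_less)
  qed
  have notL: "\<exists>\<rho>>0. \<forall>t'. t - \<rho> < t' \<and> t' < t \<longrightarrow> u t r - u t' r < q * (t - t')" if "\<not> L t r" for t r
  proof -
    have "definable_pred (\<lambda>t'. q * (t - t') \<le> u t r - u t' r)" by (intro definable_intros definable_map_intros definable_map_diff definable_map_subst2[OF u])
    then obtain \<rho> where \<rho>: "\<rho> > 0" "(\<forall>t'. t - \<rho> < t' \<and> t' < t \<longrightarrow> q * (t - t') \<le> u t r - u t' r) \<or> (\<forall>t'. t - \<rho> < t' \<and> t' < t \<longrightarrow> \<not> q * (t - t') \<le> u t r - u t' r)"
      by (rule germ_left)
    then show ?thesis using that unfolding L_def by (meson not_le_imp_less)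
  qed
  define T where "T = (\<lambda>(\<sigma>::bool \<times> bool) n. {t. a < t \<and> t < b \<and> (\<forall>r. 0 < r \<and> r < inverse (real (Suc n)) \<longrightarrow> R t r = fst \<sigma> \<and> L t r = snd \<sigma>)})"
  have "{a<..<b} \<subseteq> (\<Union>\<sigma>. \<Union>n. T \<sigma> n)"
  proof
    fix t assume t: "t \<in> {a<..<b}"
    have "definable_pred (R t)" "definable_pred (L t)" using definable_subst2[OF R definable_map_const definable_map_id] definable_subst2[OF L definable_map_const definable_map_id] by simp_all
    then obtain \<rho>1 \<rho>2 where "\<rho>1 > 0" "\<rho>2 > 0" and
      1: "(\<forall>r. 0 < r \<and> r < 0 + \<rho>1 \<longrightarrow> R t r) \<or> (\<forall>r. 0 < r \<and> r < 0 + \<rho>1 \<longrightarrow> \<not> R t r)" and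
      2: "(\<forall>r. 0 < r \<and> r < 0 + \<rho>2 \<longrightarrow> L t r) \<or> (\<forall>r. 0 < r \<and> r < 0 + \<rho>2 \<longrightarrow> \<not> L t r)"
      using germ_right[of "R t" 0] germ_right[of "L t" 0] by metis
    obtain x where x: "\<And>r. 0 < r \<and> r < \<rho>1 \<Longrightarrow> R t r = x" using 1 by auto
    obtain y where y: "\<And>r. 0 < r \<and> r < \<rho>2 \<Longrightarrow> L t r = y" using 2 by auto
    obtain n where "inverse (real (Suc n)) < min \<rho>1 \<rho>2"
      using \<open>\<rho>1 > 0\<close> \<open>\<rho>2 > 0\<close> reals_Archimedean[of "min \<rho>1 \<rho>2"] by auto
    then have "t \<in> T (x, y) n" using t x y unfolding T_def by simp
    then show "t \<in> (\<Union>\<sigma>. \<Union>n. T \<sigma> n)" by blast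
  qed
  moreover have "uncountable {a<..<b}" using \<open>a < b\<close> by (simp add: uncountable_open_interval)
  ultimately have "uncountable (\<Union>\<sigma>. \<Union>n. T \<sigma> n)" using countable_subset by blast
  then obtain \<sigma> n where "uncountable (T \<sigma> n)" by (meson countable_UN countableI_type)
  then have inf: "infinite (T \<sigma> n)" using countable_finite by blast
  define \<delta> where "\<delta> = inverse (real (Suc n))"
  have \<delta>: "\<delta> > 0" by (simp add: \<delta>_def)
  have T: "T \<sigma> n = {t. a < t \<and> t < b \<and> (\<forall>r. 0 < r \<and> r < \<delta> \<longrightarrow> R t r = fst \<sigma> \<and> L t r = snd \<sigma>)}"
    unfolding T_def \<delta>_def ..
  have dpc: "definable_pred (\<lambda>p. A (fst p) (snd p) = c)" if "definable_pred (\<lambda>p::real \<times> real. A (fst p) (snd p))" for A c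
    using that definable_not[OF that] by (cases c) simp_all
  have "definable_pred (\<lambda>t. a < t \<and> t < b \<and> (\<forall>r. 0 < r \<and> r < \<delta> \<longrightarrow> R t r = fst \<sigma> \<and> L t r = snd \<sigma>))"
    by (intro definable_conj definable_all definable_imp definable_less definable_map_intros dpc R L)
  note intv = definable_infinite_interval[OF this inf[unfolded T]]
  obtain a0 b0 where ab: "a0 < b0" "\<And>t. a0 < t \<Longrightarrow> t < b0 \<Longrightarrow> t \<in> T \<sigma> n"
    by (rule intv) (simp add: T)
  \<comment> \<open>shrink the interval so that its end points also lie in \<open>T \<sigma> n\<close>\<close>
  define a' where "a' = (2 * a0 + b0) / 3"
  define b' where "b' = (a0 + 2 * b0) / 3"
  have ab': "a0 < a'" "a' < b'" "b' < b0" using ab(1) by (auto simp: a'_def b'_def field_simps)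
  have in_T: "t \<in> T \<sigma> n" if "a' \<le> t" "t \<le> b'" for t using ab(2)[of t] ab' that by auto
  have "a \<le> a'" "b' \<le> b" using in_T[of a'] in_T[of b'] ab' unfolding T by auto
  moreover have "(\<forall>r s t. 0 < r \<and> r < \<delta> \<and> a' < s \<and> s < t \<and> t < b' \<longrightarrow> q * (t - s) \<le> u t r - u s r) \<or>
     (\<forall>r s t. 0 < r \<and> r < \<delta> \<and> a' < s \<and> s < t \<and> t < b' \<longrightarrow> u t r - u s r \<le> q * (t - s))"
  proof -
    have Rr: "R t r = fst \<sigma>" and Lr: "L t r = snd \<sigma>" if "0 < r" "r < \<delta>" "a' < t" "t < b'" for r t
      using in_T[of t] that unfolding T by auto
    consider "fst \<sigma>" "snd \<sigma>" | "\<not> fst \<sigma>" "\<not> snd \<sigma>" | "fst \<sigma>" "\<not> snd \<sigma>" | "\<not> fst \<sigma>" "snd \<sigma>" by blast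
    then show ?thesis
    proof cases
      case 1
      have "q * (t - s) \<le> u t r - u s r" if h: "0 < r" "r < \<delta>" "a' < s" "s < t" "t < b'" for r s t
      proof -
        have "u s r - q * s \<le> u t r - q * t"
        proof (rule nondecreasing_from_germs[of a' b' "\<lambda>t. u t r - q * t"])
          fix t assume t: "a' < t" "t < b'"
          then have "R t r" "L t r" using Rr Lr h 1 by auto
          then show "\<exists>\<rho>>0. \<forall>t'. t < t' \<and> t' < t + \<rho> \<longrightarrow> u t r - q * t \<le> u t' r - q * t'"
             "\<exists>\<rho>>0. \<forall>t'. t - \<rho> < t' \<and> t' < t \<longrightarrow> u t' r - q * t' \<le> u t r - q * t"
            unfolding R_def L_def by (auto simp: algebra_simps)
        qed (use h in auto)
        then show ?thesis by (simp add: algebra_simps)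
      qed
      then show ?thesis by blast
    next
      case 2
      have "u t r - u s r \<le> q * (t - s)" if h: "0 < r" "r < \<delta>" "a' < s" "s < t" "t < b'" for r s t
      proof -
        have "q * s - u s r \<le> q * t - u t r"
        proof (rule nondecreasing_from_germs[of a' b' "\<lambda>t. q * t - u t r"])
          fix t assume t: "a' < t" "t < b'"
          then have "\<not> R t r" "\<not> L t r" using Rr Lr h 2 by auto
          from notR[OF this(1)] notL[OF this(2)]
          show "\<exists>\<rho>>0. \<forall>t'. t < t' \<and> t' < t + \<rho> \<longrightarrow> q * t - u t r \<le> q * t' - u t' r"
             "\<exists>\<rho>>0. \<forall>t'. t - \<rho> < t' \<and> t' < t \<longrightarrow> q * t' - u t' r \<le> q * t - u t r"
            by (force simp: algebra_simps)+
        qed (use h in auto)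
        then show ?thesis by (simp add: algebra_simps)
      qed
      then show ?thesis by blast
    next
      case 3
      have "\<exists>\<rho>>0. (\<forall>t'. t < t' \<and> t' < t + \<rho> \<longrightarrow> q * (t' - t) \<le> u t' (\<delta>/2) - u t (\<delta>/2)) \<and>
           (\<forall>t'. t - \<rho> < t' \<and> t' < t \<longrightarrow> \<not> q * (t - t') \<le> u t (\<delta>/2) - u t' (\<delta>/2))" if t: "a' < t" "t < b'" for t
      proof -
        have "R t (\<delta>/2)" "\<not> L t (\<delta>/2)" using Rr[of "\<delta>/2" t] Lr[of "\<delta>/2" t] \<delta> t 3 by auto
        then obtain \<rho>1 \<rho>2 where "\<rho>1 > 0" "\<rho>2 > 0"
          "\<forall>t'. t < t' \<and> t' < t + \<rho>1 \<longrightarrow> q * (t' - t) \<le> u t' (\<delta>/2) - u t (\<delta>/2)"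
          "\<forall>t'. t - \<rho>2 < t' \<and> t' < t \<longrightarrow> u t (\<delta>/2) - u t' (\<delta>/2) < q * (t - t')"
          using notL unfolding R_def by blast
        then show ?thesis by (intro exI[of _ "min \<rho>1 \<rho>2"]) (auto simp: not_le)
      qed
      from incompatible_germs[OF ab'(2) this] show ?thesis by simp
    next
      case 4
      have "\<exists>\<rho>>0. (\<forall>t'. t < t' \<and> t' < t + \<rho> \<longrightarrow> u t' (\<delta>/2) - u t (\<delta>/2) < q * (t' - t)) \<and>
           (\<forall>t'. t - \<rho> < t' \<and> t' < t \<longrightarrow> \<not> u t (\<delta>/2) - u t' (\<delta>/2) < q * (t - t'))" if t: "a' < t" "t < b'" for t
      proof -
        have "\<not> R t (\<delta>/2)" "L t (\<delta>/2)" using Rr[of "\<delta>/2" t] Lr[of "\<delta>/2" t] \<delta> t 4 by auto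
        then obtain \<rho>1 \<rho>2 where "\<rho>1 > 0" "\<rho>2 > 0"
          "\<forall>t'. t < t' \<and> t' < t + \<rho>1 \<longrightarrow> u t' (\<delta>/2) - u t (\<delta>/2) < q * (t' - t)"
          "\<forall>t'. t - \<rho>2 < t' \<and> t' < t \<longrightarrow> q * (t - t') \<le> u t (\<delta>/2) - u t' (\<delta>/2)"
          using notR unfolding L_def by blast
        then show ?thesis by (intro exI[of _ "min \<rho>1 \<rho>2"]) (auto simp: not_less)
      qed
      from incompatible_germs[OF ab'(2) this] show ?thesis by simp
    qed
  qed
  ultimately show ?thesis using that[of a' b' \<delta>] ab'(2) \<delta> by simp
qed

lemma nondecreasing_or_nonincreasing_slope:
  fixes w :: "real \<Rightarrow> real"
  assumes "definable_map w" "a < b"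
  obtains a' b' where "a \<le> a'" "a' < b'" "b' \<le> b"
    "(\<forall>s t. a' < s \<and> s < t \<and> t < b' \<longrightarrow> q * (t - s) \<le> w t - w s) \<or>
     (\<forall>s t. a' < s \<and> s < t \<and> t < b' \<longrightarrow> w t - w s \<le> q * (t - s))"
proof -
  have "definable_map (\<lambda>p::real \<times> real. w (fst p))" by (intro definable_map_comp[OF assms(1)] definable_map_intros)
  from this assms(2) show ?thesis
  proof (rule slope_dichotomy[where u = "\<lambda>t r. w t" and q = q])
    fix a' b' \<delta> :: real
    assume ab: "a \<le> a'" "a' < b'" "b' \<le> b" and \<delta>: "0 < \<delta>"
    assume h: "(\<forall>r s t. 0 < r \<and> r < \<delta> \<and> a' < s \<and> s < t \<and> t < b' \<longrightarrow> q * (t - s) \<le> w t - w s) \<or>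
     (\<forall>r s t. 0 < r \<and> r < \<delta> \<and> a' < s \<and> s < t \<and> t < b' \<longrightarrow> w t - w s \<le> q * (t - s))"
    have "0 < \<delta> / 2 \<and> \<delta> / 2 < \<delta>" using \<delta> by simp
    then have "(\<forall>s t. a' < s \<and> s < t \<and> t < b' \<longrightarrow> q * (t - s) \<le> w t - w s) \<or>
     (\<forall>s t. a' < s \<and> s < t \<and> t < b' \<longrightarrow> w t - w s \<le> q * (t - s))"
      using h by blast
    then show ?thesis by (rule that[OF ab])
  qed
qed

text \<open>If the right slopes exceeded the constant \<open>Q\<close> in the right germ of each point of \<open>[p, p')\<close>, then \<open>w\<close> would
  gain more than \<open>w p' - w p\<close> between \<open>p\<close> and \<open>p'\<close>.  So they fail to do so on
  some interval, where the slope dichotomy applies.\<close>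

lemma bounded_slope:
  fixes w :: "real \<Rightarrow> real"
  assumes w: "definable_map w" and "a < b" and mono: "\<And>s t. a < s \<Longrightarrow> s < t \<Longrightarrow> t < b \<Longrightarrow> w s \<le> w t"
  obtains a' b' Q where "a \<le> a'" "a' < b'" "b' \<le> b" "\<And>s t. a' < s \<Longrightarrow> s < t \<Longrightarrow> t < b' \<Longrightarrow> w t - w s \<le> Q * (t - s)"
proof -
  define p where "p = (2 * a + b) / 3"
  define p' where "p' = (a + 2 * b) / 3"
  have p: "a < p" "p < p'" "p' < b" using \<open>a < b\<close> by (auto simp: p_def p'_def field_simps)
  \<comment> \<open>larger than the mean slope\<close>
  define Q where "Q = (w p' - w p) / (p' - p) + 1"
  define R where "R = (\<lambda>t. \<exists>\<rho>>0. \<forall>t'. t < t' \<and> t' < t + \<rho> \<longrightarrow> Q * (t' - t) \<le> w t' - w t)"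
  have R: "definable_pred R" unfolding R_def by (intro definable_intros definable_map_intros definable_map_comp[OF w])
  have "\<exists>s. p \<le> s \<and> s < p' \<and> (\<exists>\<rho>>0. \<forall>t. s < t \<and> t < s + \<rho> \<longrightarrow> \<not> R t)"
  proof (rule ccontr)
    assume neg: "\<not> ?thesis"
    have RR: "\<exists>\<rho>>0. \<forall>t. s < t \<and> t < s + \<rho> \<longrightarrow> R t" if "p \<le> s" "s < p'" for s
      using germ_right[OF R, of s] neg that by metis
    have "0 \<le> (w p' - Q * p') - (w p - Q * p)"
    proof (rule real_induction[of p p' "\<lambda>s. 0 \<le> (w s - Q * s) - (w p - Q * p)"])
      fix s assume s: "p \<le> s" "s < p'" and ih: "0 \<le> (w s - Q * s) - (w p - Q * p)"
      obtain \<rho> where \<rho>: "\<rho> > 0" "\<And>t. s < t \<Longrightarrow> t < s + \<rho> \<Longrightarrow> R t" using RR[OF s] by blast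
      define e where "e = min p' (s + \<rho>)"
      have inner: "Q * (y - x) \<le> w y - w x" if xy: "s < x" "x < y" "y < e" for x y
      proof -
        have "0 \<le> (w y - Q * y) - (w x - Q * x)"
        proof (rule real_induction[of x y "\<lambda>y. 0 \<le> (w y - Q * y) - (w x - Q * x)"])
          fix z assume z: "x \<le> z" "z < y" "0 \<le> (w z - Q * z) - (w x - Q * x)"
          then have "R z" using \<rho>(2) xy by (auto simp: e_def)
          then obtain \<sigma> where \<sigma>: "\<sigma> > 0" "\<And>t'. z < t' \<Longrightarrow> t' < z + \<sigma> \<Longrightarrow> Q * (t' - z) \<le> w t' - w z"
            unfolding R_def by blast
          have "0 \<le> (w t - Q * t) - (w x - Q * x)" if "z < t" "t < z + \<sigma>" for t
            using \<sigma>(2)[OF that] z(3) by (simp add: algebra_simps)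
          then show "\<exists>\<rho>>0. \<forall>t. z < t \<and> t < z + \<rho> \<longrightarrow> 0 \<le> (w t - Q * t) - (w x - Q * x)"
            using \<sigma>(1) by blast
        next
          fix z assume z: "x < z" "z \<le> y" and below: "\<And>t. x \<le> t \<Longrightarrow> t < z \<Longrightarrow> 0 \<le> (w t - Q * t) - (w x - Q * x)"
          show "0 \<le> (w z - Q * z) - (w x - Q * x)"
          proof (rule field_le_epsilon)
            fix \<epsilon> :: real assume "\<epsilon> > 0"
            define t where "t = max x (z - \<epsilon> / (\<bar>Q\<bar> + 1))"
            have t: "x \<le> t" "t < z" "z - t \<le> \<epsilon> / (\<bar>Q\<bar> + 1)" using z \<open>\<epsilon> > 0\<close> by (auto simp: t_def)
            have "w t \<le> w z" using mono[of t z] t z xy s p by (auto simp: e_def)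
            moreover have "Q * (z - t) \<le> (\<bar>Q\<bar> + 1) * (\<epsilon> / (\<bar>Q\<bar> + 1))" by (intro mult_mono) (use t in auto)
            moreover have "(\<bar>Q\<bar> + 1) * (\<epsilon> / (\<bar>Q\<bar> + 1)) = \<epsilon>" by (simp add: field_simps)
            ultimately show "0 \<le> (w z - Q * z) - (w x - Q * x) + \<epsilon>" using below[OF t(1,2)] by (simp add: algebra_simps)
          qed
        qed (use xy in auto)
        then show ?thesis by (simp add: algebra_simps)
      qed
      have "0 \<le> (w y - Q * y) - (w p - Q * p)" if y: "s < y" "y < e" for y
      proof -
        have "Q * (y - s) \<le> w y - w s"
        proof (rule field_le_epsilon)
          fix \<epsilon> :: real assume "\<epsilon> > 0"
          obtain x where x: "s < x" "x < min y (s + \<epsilon> / (\<bar>Q\<bar> + 1))" using dense[of s "min y (s + \<epsilon> / (\<bar>Q\<bar> + 1))"] y \<open>\<epsilon> > 0\<close> by auto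
          have "w s \<le> w x" using mono[of s x] x y s p by (auto simp: e_def)
          moreover have "Q * (y - x) \<le> w y - w x" using inner x y by auto
          moreover have "Q * (x - s) \<le> (\<bar>Q\<bar> + 1) * (\<epsilon> / (\<bar>Q\<bar> + 1))" by (intro mult_mono) (use x in auto)
          moreover have "(\<bar>Q\<bar> + 1) * (\<epsilon> / (\<bar>Q\<bar> + 1)) = \<epsilon>" by (simp add: field_simps)
          ultimately show "Q * (y - s) \<le> w y - w s + \<epsilon>" by (simp add: algebra_simps)
        qed
        then show ?thesis using ih by (simp add: algebra_simps)
      qed
      moreover have "e - s > 0" using s \<rho>(1) by (auto simp: e_def)
      ultimately show "\<exists>\<rho>>0. \<forall>t. s < t \<and> t < s + \<rho> \<longrightarrow> 0 \<le> (w t - Q * t) - (w p - Q * p)"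
        by (intro exI[of _ "e - s"]) auto
    next
      fix z assume z: "p < z" "z \<le> p'" and below: "\<And>t. p \<le> t \<Longrightarrow> t < z \<Longrightarrow> 0 \<le> (w t - Q * t) - (w p - Q * p)"
      show "0 \<le> (w z - Q * z) - (w p - Q * p)"
      proof (rule field_le_epsilon)
        fix \<epsilon> :: real assume "\<epsilon> > 0"
        define t where "t = max p (z - \<epsilon> / (\<bar>Q\<bar> + 1))"
        have t: "p \<le> t" "t < z" "z - t \<le> \<epsilon> / (\<bar>Q\<bar> + 1)" using z \<open>\<epsilon> > 0\<close> by (auto simp: t_def)
        have "w t \<le> w z" using mono[of t z] t z p by auto
        moreover have "Q * (z - t) \<le> (\<bar>Q\<bar> + 1) * (\<epsilon> / (\<bar>Q\<bar> + 1))" by (intro mult_mono) (use t in auto)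
        moreover have "(\<bar>Q\<bar> + 1) * (\<epsilon> / (\<bar>Q\<bar> + 1)) = \<epsilon>" by (simp add: field_simps)
        ultimately show "0 \<le> (w z - Q * z) - (w p - Q * p) + \<epsilon>" using below[OF t(1,2)] by (simp add: algebra_simps)
      qed
    qed (use p in auto)
    moreover have "Q * (p' - p) = (w p' - w p) + (p' - p)" using p by (simp add: Q_def field_simps)
    ultimately show False using p by (simp add: algebra_simps)
  qed
  then obtain s \<rho> where s: "p \<le> s" "s < p'" "\<rho> > 0" "\<And>t. s < t \<Longrightarrow> t < s + \<rho> \<Longrightarrow> \<not> R t" by blast
  define e where "e = min p' (s + \<rho>)"
  have "s < e" using s by (auto simp: e_def)
  obtain a' b' where ab: "s \<le> a'" "a' < b'" "b' \<le> e"
    "(\<forall>s t. a' < s \<and> s < t \<and> t < b' \<longrightarrow> Q * (t - s) \<le> w t - w s) \<or>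
     (\<forall>s t. a' < s \<and> s < t \<and> t < b' \<longrightarrow> w t - w s \<le> Q * (t - s))"
    by (rule nondecreasing_or_nonincreasing_slope[OF w \<open>s < e\<close>])
  have "\<not> (\<forall>s t. a' < s \<and> s < t \<and> t < b' \<longrightarrow> Q * (t - s) \<le> w t - w s)"
  proof
    assume h: "\<forall>s t. a' < s \<and> s < t \<and> t < b' \<longrightarrow> Q * (t - s) \<le> w t - w s"
    define m where "m = (a' + b') / 2"
    have m: "a' < m" "m < b'" using ab by (auto simp: m_def)
    have "R m" unfolding R_def using h m by (intro exI[of _ "b' - m"]) auto
    then show False using s(4)[of m] m ab by (auto simp: e_def)
  qed
  then have "w t - w s \<le> Q * (t - s)" if "a' < s" "s < t" "t < b'" for s t using ab(4) that by blast
  moreover have "a \<le> a'" "b' \<le> b" using ab s p by (auto simp: e_def)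
  ultimately show ?thesis using that[of a' b' Q] ab(2) by simp
qed

text \<open>Bisection: the slope dichotomy for the middle of the current range of slopes halves the range on a
  smaller interval.\<close>

lemma small_slope_interval:
  fixes w :: "real \<Rightarrow> real"
  assumes w: "definable_map w" and "a < b" and "\<epsilon> > 0"
  obtains a' b' v where "a \<le> a'" "a' < b'" "b' \<le> b" "\<And>s t. a' < s \<Longrightarrow> s < t \<Longrightarrow> t < b' \<Longrightarrow> \<bar>w t - w s - v * (t - s)\<bar> \<le> \<epsilon> * (t - s)"
proof -
  have mono: "\<exists>a' b' v. a \<le> a' \<and> a' < b' \<and> b' \<le> b \<and> (\<forall>s t. a' < s \<and> s < t \<and> t < b' \<longrightarrow> \<bar>w t - w s - v * (t - s)\<bar> \<le> \<epsilon> * (t - s))"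
    if w: "definable_map w" and "a < b" and mono: "\<And>s t. a < s \<Longrightarrow> s < t \<Longrightarrow> t < b \<Longrightarrow> w s \<le> w t" for w :: "real \<Rightarrow> real" and a b
  proof -
    obtain a1 b1 Q where 1: "a \<le> a1" "a1 < b1" "b1 \<le> b" "\<And>s t. a1 < s \<Longrightarrow> s < t \<Longrightarrow> t < b1 \<Longrightarrow> w t - w s \<le> Q * (t - s)"
      using bounded_slope[OF w \<open>a < b\<close>] mono by metis
    have "\<exists>a' b' lo. a1 \<le> a' \<and> a' < b' \<and> b' \<le> b1 \<and> (\<forall>s t. a' < s \<and> s < t \<and> t < b' \<longrightarrow>
        lo * (t - s) \<le> w t - w s \<and> w t - w s \<le> (lo + Q / 2 ^ n) * (t - s))" for n
    proof (induction n)
      case 0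
      show ?case using 1 mono by (intro exI[of _ a1] exI[of _ b1] exI[of _ 0]) auto
    next
      case (Suc n)
      then obtain a' b' lo where ab: "a1 \<le> a'" "a' < b'" "b' \<le> b1" and
        lo: "\<And>s t. a' < s \<Longrightarrow> s < t \<Longrightarrow> t < b' \<Longrightarrow> lo * (t - s) \<le> w t - w s"
            "\<And>s t. a' < s \<Longrightarrow> s < t \<Longrightarrow> t < b' \<Longrightarrow> w t - w s \<le> (lo + Q / 2 ^ n) * (t - s)" by blast
      define q where "q = lo + Q / 2 ^ Suc n"
      obtain a2 b2 where 2: "a' \<le> a2" "a2 < b2" "b2 \<le> b'" and
        q: "(\<forall>s t. a2 < s \<and> s < t \<and> t < b2 \<longrightarrow> q * (t - s) \<le> w t - w s) \<or>
         (\<forall>s t. a2 < s \<and> s < t \<and> t < b2 \<longrightarrow> w t - w s \<le> q * (t - s))"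
        by (rule nondecreasing_or_nonincreasing_slope[OF w ab(2)])
      have q2: "q + Q / 2 ^ Suc n = lo + Q / 2 ^ n" by (simp add: q_def field_simps)
      from q show ?case
      proof
        assume "\<forall>s t. a2 < s \<and> s < t \<and> t < b2 \<longrightarrow> q * (t - s) \<le> w t - w s"
        then have "q * (t - s) \<le> w t - w s \<and> w t - w s \<le> (q + Q / 2 ^ Suc n) * (t - s)" if "a2 < s" "s < t" "t < b2" for s t
          unfolding q2 using lo(2)[of s t] 2 that by simp
        moreover have "a1 \<le> a2" "b2 \<le> b1" using 2 ab by auto
        ultimately show ?thesis using 2(2) by blast
      next
        assume "\<forall>s t. a2 < s \<and> s < t \<and> t < b2 \<longrightarrow> w t - w s \<le> q * (t - s)"
        then have "lo * (t - s) \<le> w t - w s \<and> w t - w s \<le> (lo + Q / 2 ^ Suc n) * (t - s)" if "a2 < s" "s < t" "t < b2" for s t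
          unfolding q_def[symmetric] using lo(1)[of s t] 2 that by simp
        moreover have "a1 \<le> a2" "b2 \<le> b1" using 2 ab by auto
        ultimately show ?thesis using 2(2) by blast
      qed
    qed
    moreover obtain n where n: "Q / 2 ^ n \<le> \<epsilon>"
    proof -
      obtain n where "\<bar>Q\<bar> / \<epsilon> < 2 ^ n" using real_arch_pow[of 2 "\<bar>Q\<bar> / \<epsilon>"] by auto
      then have "\<bar>Q\<bar> \<le> \<epsilon> * 2 ^ n" using \<open>\<epsilon> > 0\<close> by (simp add: field_simps)
      then have "Q / 2 ^ n \<le> \<epsilon>" by (simp add: field_simps abs_le_iff)
      then show ?thesis by (rule that)
    qed
    ultimately obtain a' b' lo where ab: "a1 \<le> a'" "a' < b'" "b' \<le> b1" and
       lo: "\<And>s t. a' < s \<Longrightarrow> s < t \<Longrightarrow> t < b' \<Longrightarrow> lo * (t - s) \<le> w t - w s \<and> w t - w s \<le> (lo + Q / 2 ^ n) * (t - s)" by blast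
    have "\<bar>w t - w s - lo * (t - s)\<bar> \<le> \<epsilon> * (t - s)" if "a' < s" "s < t" "t < b'" for s t
    proof -
      have "Q / 2 ^ n * (t - s) \<le> \<epsilon> * (t - s)" using n that by (intro mult_right_mono) auto
      then show ?thesis using lo[OF that] by (simp add: algebra_simps abs_le_iff)
    qed
    then show ?thesis using ab 1 by (intro exI[of _ a'] exI[of _ b'] exI[of _ lo]) auto
  qed
  obtain a1 b1 where 1: "a \<le> a1" "a1 < b1" "b1 \<le> b" and
    q: "(\<forall>s t. a1 < s \<and> s < t \<and> t < b1 \<longrightarrow> 0 * (t - s) \<le> w t - w s) \<or>
         (\<forall>s t. a1 < s \<and> s < t \<and> t < b1 \<longrightarrow> w t - w s \<le> 0 * (t - s))"
    by (rule nondecreasing_or_nonincreasing_slope[OF w \<open>a < b\<close>])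
  from q have "\<exists>a' b' v. a1 \<le> a' \<and> a' < b' \<and> b' \<le> b1 \<and> (\<forall>s t. a' < s \<and> s < t \<and> t < b' \<longrightarrow> \<bar>w t - w s - v * (t - s)\<bar> \<le> \<epsilon> * (t - s))"
  proof
    assume "\<forall>s t. a1 < s \<and> s < t \<and> t < b1 \<longrightarrow> 0 * (t - s) \<le> w t - w s"
    then show ?thesis by (intro mono w 1) auto
  next
    assume h: "\<forall>s t. a1 < s \<and> s < t \<and> t < b1 \<longrightarrow> w t - w s \<le> 0 * (t - s)"
    have neg: "definable_map (\<lambda>t. 0 - w t)" by (intro definable_map_intros w)
    have "0 - w s \<le> 0 - w t" if "a1 < s" "s < t" "t < b1" for s t
      using h that by force
    from mono[OF neg 1(2) this] obtain a' b' v where 2: "a1 \<le> a'" "a' < b'" "b' \<le> b1"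
      and v: "\<And>s t. a' < s \<Longrightarrow> s < t \<Longrightarrow> t < b' \<Longrightarrow> \<bar>0 - w t - (0 - w s) - v * (t - s)\<bar> \<le> \<epsilon> * (t - s)" by blast
    have "\<bar>w t - w s - (- v) * (t - s)\<bar> \<le> \<epsilon> * (t - s)" if "a' < s" "s < t" "t < b'" for s t
    proof -
      have "w t - w s - (- v) * (t - s) = - (0 - w t - (0 - w s) - v * (t - s))" by simp
      then show ?thesis using v[OF that] by (simp only: abs_minus)
    qed
    then show ?thesis using 2 by (intro exI[of _ a'] exI[of _ b'] exI[of _ "- v"]) auto
  qed
  then obtain a' b' v where "a1 \<le> a'" "a' < b'" "b' \<le> b1" "\<And>s t. a' < s \<Longrightarrow> s < t \<Longrightarrow> t < b' \<Longrightarrow> \<bar>w t - w s - v * (t - s)\<bar> \<le> \<epsilon> * (t - s)"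
    by blast
  then show ?thesis using that[of a' b' v] 1 by simp
qed

lemma small_slope_interval_vector:
  fixes w :: "real \<Rightarrow> 'd::euclidean_space"
  assumes w: "definable_map w" and "a < b" and "\<epsilon> > 0"
  obtains a' b' v where "a \<le> a'" "a' < b'" "b' \<le> b"
    "\<And>s t. a' < s \<Longrightarrow> s < t \<Longrightarrow> t < b' \<Longrightarrow> norm (w t - w s - (t - s) *\<^sub>R v) \<le> \<epsilon> * (t - s)"
proof -
  define e where "e = \<epsilon> / real DIM('d)"
  have e: "e > 0" using assms(3) by (simp add: e_def)
  have "\<exists>a' b' v. a \<le> a' \<and> a' < b' \<and> b' \<le> b \<and> (\<forall>s t. a' < s \<and> s < t \<and> t < b' \<longrightarrow>
      (\<forall>i\<in>I. \<bar>(w t - w s) \<bullet> i - v i * (t - s)\<bar> \<le> e * (t - s)))" if "finite I" "I \<subseteq> (Basis::'d set)" for I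
    using that
  proof (induction I rule: finite_induct)
    case empty
    then show ?case using \<open>a < b\<close> by auto
  next
    case (insert i I)
    have "I \<subseteq> Basis" using insert.prems by simp
    from insert.IH[OF this] obtain a' b' v where 1: "a \<le> a'" "a' < b'" "b' \<le> b" and
      v: "\<And>s t. a' < s \<Longrightarrow> s < t \<Longrightarrow> t < b' \<Longrightarrow> \<forall>i\<in>I. \<bar>(w t - w s) \<bullet> i - v i * (t - s)\<bar> \<le> e * (t - s)" by blast
    have "definable_map (\<lambda>t. w t \<bullet> i)" using insert.prems by (intro definable_map_inner_Basis w) auto
    from small_slope_interval[OF this 1(2) e] obtain a2 b2 c where 2: "a' \<le> a2" "a2 < b2" "b2 \<le> b'" and
      c: "\<And>s t. a2 < s \<Longrightarrow> s < t \<Longrightarrow> t < b2 \<Longrightarrow> \<bar>w t \<bullet> i - w s \<bullet> i - c * (t - s)\<bar> \<le> e * (t - s)" by metis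
    have "\<forall>j\<in>insert i I. \<bar>(w t - w s) \<bullet> j - (v(i := c)) j * (t - s)\<bar> \<le> e * (t - s)"
      if "a2 < s" "s < t" "t < b2" for s t
      using c[OF that] v[of s t] that 2 insert.hyps(2) by (auto simp: inner_diff_left)
    then show ?case using 1 2 by (intro exI[of _ a2] exI[of _ b2] exI[of _ "v(i := c)"]) auto
  qed
  from this[OF finite_Basis order_refl] obtain a' b' v where 1: "a \<le> a'" "a' < b'" "b' \<le> b" and
      v: "\<And>s t i. a' < s \<Longrightarrow> s < t \<Longrightarrow> t < b' \<Longrightarrow> i \<in> Basis \<Longrightarrow> \<bar>(w t - w s) \<bullet> i - v i * (t - s)\<bar> \<le> e * (t - s)" by metis
  define V where "V = (\<Sum>i\<in>Basis. v i *\<^sub>R i)"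
  have "norm (w t - w s - (t - s) *\<^sub>R V) \<le> \<epsilon> * (t - s)" if st: "a' < s" "s < t" "t < b'" for s t
  proof -
    have "norm (w t - w s - (t - s) *\<^sub>R V) \<le> (\<Sum>i\<in>Basis. \<bar>(w t - w s - (t - s) *\<^sub>R V) \<bullet> i\<bar>)" by (rule norm_le_l1)
    also have "\<dots> \<le> (\<Sum>i\<in>(Basis::'d set). e * (t - s))"
    proof (rule sum_mono)
      fix i :: 'd assume i: "i \<in> Basis"
      have "V \<bullet> i = v i" using i by (simp add: V_def)
      then show "\<bar>(w t - w s - (t - s) *\<^sub>R V) \<bullet> i\<bar> \<le> e * (t - s)"
        using v[OF st i] by (simp add: inner_diff_left mult.commute)
    qed
    also have "\<dots> = \<epsilon> * (t - s)" by (simp add: e_def)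
    finally show ?thesis .
  qed
  then show ?thesis using that[of a' b' V] 1 by simp
qed

text \<open>Convergence of slopes.  In the slope dichotomy for \<open>q = v + 2 \<epsilon>\<close>, slopes of at least \<open>q\<close> would
  pass to the limit \<open>w\<close>, whose slopes are at most \<open>v + \<epsilon>\<close>; similarly for \<open>q = v - 2 \<epsilon>\<close>.\<close>

lemma slope_of_approximation:
  fixes u :: "real \<Rightarrow> real \<Rightarrow> real"
  assumes u: "definable_map (\<lambda>p. u (fst p) (snd p))" and "a < b" and "\<epsilon> > 0" and "\<eta> > 0"
    and lim: "\<And>t r. a < t \<Longrightarrow> t < b \<Longrightarrow> 0 < r \<Longrightarrow> r < \<eta> \<Longrightarrow> \<bar>u t r - w t\<bar> \<le> C * r"
    and w: "\<And>s t. a < s \<Longrightarrow> s < t \<Longrightarrow> t < b \<Longrightarrow> \<bar>w t - w s - v * (t - s)\<bar> \<le> \<epsilon> * (t - s)"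
  obtains a' b' \<delta> where "a \<le> a'" "a' < b'" "b' \<le> b" "\<delta> > 0"
    "\<And>r s t. 0 < r \<Longrightarrow> r < \<delta> \<Longrightarrow> a' < s \<Longrightarrow> s < t \<Longrightarrow> t < b' \<Longrightarrow> \<bar>u t r - u s r - v * (t - s)\<bar> \<le> 2 * \<epsilon> * (t - s)"
proof -
  have small: "\<exists>r>0. r < \<delta> \<and> \<bar>u t r - w t\<bar> < \<kappa> \<and> \<bar>u s r - w s\<bar> < \<kappa>"
    if "a < s" "s < b" "a < t" "t < b" "\<delta> > 0" "\<kappa> > 0" for s t \<delta> \<kappa>
  proof -
    define r where "r = min (\<eta> / 2) (min (\<delta> / 2) (\<kappa> / (2 * (\<bar>C\<bar> + 1))))"
    have r: "r > 0" "r < \<delta>" "r < \<eta>" "r \<le> \<kappa> / (2 * (\<bar>C\<bar> + 1))" using that \<open>\<eta> > 0\<close> by (auto simp: r_def)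
    have "C * r \<le> (\<bar>C\<bar> + 1) * (\<kappa> / (2 * (\<bar>C\<bar> + 1)))" by (intro mult_mono) (use r in auto)
    also have "\<dots> = \<kappa> / 2" by (simp add: field_simps)
    finally have "C * r < \<kappa>" using that by simp
    then show ?thesis using lim[of t r] lim[of s r] r that by (intro exI[of _ r]) auto
  qed
  obtain a1 b1 \<delta>1 where 1: "a \<le> a1" "a1 < b1" "b1 \<le> b" "\<delta>1 > 0" and
    d1: "(\<forall>r s t. 0 < r \<and> r < \<delta>1 \<and> a1 < s \<and> s < t \<and> t < b1 \<longrightarrow> (v + 2 * \<epsilon>) * (t - s) \<le> u t r - u s r) \<or>
     (\<forall>r s t. 0 < r \<and> r < \<delta>1 \<and> a1 < s \<and> s < t \<and> t < b1 \<longrightarrow> u t r - u s r \<le> (v + 2 * \<epsilon>) * (t - s))"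
    by (rule slope_dichotomy[OF u \<open>a < b\<close>])
  obtain a2 b2 \<delta>2 where 2: "a1 \<le> a2" "a2 < b2" "b2 \<le> b1" "\<delta>2 > 0" and
    d2: "(\<forall>r s t. 0 < r \<and> r < \<delta>2 \<and> a2 < s \<and> s < t \<and> t < b2 \<longrightarrow> (v - 2 * \<epsilon>) * (t - s) \<le> u t r - u s r) \<or>
     (\<forall>r s t. 0 < r \<and> r < \<delta>2 \<and> a2 < s \<and> s < t \<and> t < b2 \<longrightarrow> u t r - u s r \<le> (v - 2 * \<epsilon>) * (t - s))"
    by (rule slope_dichotomy[OF u 1(2)])
  define s where "s = (2 * a2 + b2) / 3"
  define t where "t = (a2 + 2 * b2) / 3"
  have st: "a2 < s" "s < t" "t < b2" using 2(2) by (auto simp: s_def t_def field_simps)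
  have \<kappa>: "\<epsilon> * (t - s) / 2 > 0" using st assms(3) by simp
  have st': "a < s" "s < b" "a < t" "t < b" "a1 < s" "t < b1" using st 1 2 by auto
  have A: "\<forall>r s t. 0 < r \<and> r < \<delta>1 \<and> a1 < s \<and> s < t \<and> t < b1 \<longrightarrow> u t r - u s r \<le> (v + 2 * \<epsilon>) * (t - s)"
  proof (rule ccontr)
    assume "\<not> ?thesis"
    then have h: "\<forall>r s t. 0 < r \<and> r < \<delta>1 \<and> a1 < s \<and> s < t \<and> t < b1 \<longrightarrow> (v + 2 * \<epsilon>) * (t - s) \<le> u t r - u s r" using d1 by blast
    obtain r where r: "r > 0" "r < \<delta>1" "\<bar>u t r - w t\<bar> < \<epsilon> * (t - s) / 2" "\<bar>u s r - w s\<bar> < \<epsilon> * (t - s) / 2"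
      using small[OF st'(1-4) 1(4) \<kappa>] by blast
    have "(v + 2 * \<epsilon>) * (t - s) \<le> u t r - u s r" using h r(1,2) st' st by blast
    moreover have "w t - w s \<le> v * (t - s) + \<epsilon> * (t - s)" using w[of s t] st st' by auto
    moreover have "(v + 2 * \<epsilon>) * (t - s) = v * (t - s) + \<epsilon> * (t - s) + \<epsilon> * (t - s)" by (simp add: algebra_simps)
    ultimately show False using r(3,4) by linarith
  qed
  have B: "\<forall>r s t. 0 < r \<and> r < \<delta>2 \<and> a2 < s \<and> s < t \<and> t < b2 \<longrightarrow> (v - 2 * \<epsilon>) * (t - s) \<le> u t r - u s r"
  proof (rule ccontr)
    assume "\<not> ?thesis"
    then have h: "\<forall>r s t. 0 < r \<and> r < \<delta>2 \<and> a2 < s \<and> s < t \<and> t < b2 \<longrightarrow> u t r - u s r \<le> (v - 2 * \<epsilon>) * (t - s)" using d2 by blast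
    obtain r where r: "r > 0" "r < \<delta>2" "\<bar>u t r - w t\<bar> < \<epsilon> * (t - s) / 2" "\<bar>u s r - w s\<bar> < \<epsilon> * (t - s) / 2"
      using small[OF st'(1-4) 2(4) \<kappa>] by blast
    have "u t r - u s r \<le> (v - 2 * \<epsilon>) * (t - s)" using h r(1,2) st' st by blast
    moreover have "w t - w s \<ge> v * (t - s) - \<epsilon> * (t - s)" using w[of s t] st st' by auto
    moreover have "(v - 2 * \<epsilon>) * (t - s) = v * (t - s) - \<epsilon> * (t - s) - \<epsilon> * (t - s)" by (simp add: algebra_simps)
    ultimately show False using r(3,4) by linarith
  qed
  show ?thesis
  proof (rule that[of a2 b2 "min \<delta>1 \<delta>2"])
    fix r s t assume h: "0 < r" "r < min \<delta>1 \<delta>2" "a2 < s" "s < t" "t < b2"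
    then have "u t r - u s r \<le> (v + 2 * \<epsilon>) * (t - s)" "(v - 2 * \<epsilon>) * (t - s) \<le> u t r - u s r"
      using A[rule_format, of r s t] B[rule_format, of r s t] 2 by auto
    then show "\<bar>u t r - u s r - v * (t - s)\<bar> \<le> 2 * \<epsilon> * (t - s)" by (simp add: algebra_simps abs_le_iff)
  qed (use 1 2 in auto)
qed

end

section \<open>Finiteness of the critical values\<close>

text \<open>The first half says that \<open>v\<close> is a tangent direction of \<open>N\<close> at \<open>x\<close>, up to an error \<open>\<rho>\<close>.  It
  excludes directions for which the second half holds vacuously.  The
  tolerance \<open>2 \<rho>\<close> of the second half leaves room to replace \<open>v\<close> by an exactly tangent vector.
  All quantifiers range over points and reals, so that the notion is definable.\<close>

definition regular_point :: "real \<Rightarrow> 'd::euclidean_space set \<Rightarrow> ('d \<Rightarrow> real) \<Rightarrow> 'd \<Rightarrow> bool" where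
  "regular_point \<rho> N g x \<longleftrightarrow> (\<exists>v.
     (\<forall>r. 0 < r \<longrightarrow> (\<exists>y z s. y \<in> N \<and> z \<in> N \<and> norm (y - x) < r \<and> norm (z - x) < r \<and> 0 < s \<and> s < r \<and>
        norm (z - y - s *\<^sub>R v) \<le> \<rho> * s)) \<and>
     (\<exists>r. 0 < r \<and> (\<forall>y z s. y \<in> N \<and> z \<in> N \<and> norm (y - x) < r \<and> norm (z - x) < r \<and> 0 < s \<and> s < r \<and>
        norm (z - y - s *\<^sub>R v) \<le> (2 * \<rho>) * s \<longrightarrow> (1/2) * s \<le> g z - g y)))"

context omin
begin

text \<open>With \<open>16 \<rho> L \<le> 1\<close>, an error of \<open>4 \<rho> s\<close> in a point changes \<open>g\<close> by at most \<open>s / 4\<close>; this is the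
  difference between the slope of at least 3/4 that the family \<open>g(y(t, r))\<close> inherits from \<open>g(x(t)) = t\<close>
  and the slope 1/2 that fails at critical points.\<close>

theorem finite_critical_values:
  fixes N :: "'d::euclidean_space set" and g :: "'d \<Rightarrow> real"
  assumes N: "definable_pred (\<lambda>x. x \<in> N)" and g: "definable_map g" and "bounded N"
    and lip: "\<And>y z. y \<in> N \<Longrightarrow> z \<in> N \<Longrightarrow> \<bar>g z - g y\<bar> \<le> L * norm (z - y)"
    and "L \<ge> 0" "\<rho> > 0" and \<rho>L: "16 * \<rho> * L \<le> 1"
  shows "finite (g ` {x \<in> N. \<not> regular_point \<rho> N g x})"
proof (rule ccontr)
  define D where "D = real DIM('d)"
  have D: "D \<ge> 1" unfolding D_def using DIM_positive[where 'a='d] by simp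
  have reg: "definable_pred (regular_point \<rho> N g)"
    unfolding regular_point_def
    by (intro definable_intros definable_map_intros definable_subst[OF N] definable_map_comp[OF g])
  assume "infinite (g ` {x \<in> N. \<not> regular_point \<rho> N g x})"
  moreover have "g ` {x \<in> N. \<not> regular_point \<rho> N g x} = {t. \<exists>x. x \<in> N \<and> \<not> regular_point \<rho> N g x \<and> g x = t}" by auto
  ultimately have inf: "infinite {t. \<exists>x. x \<in> N \<and> \<not> regular_point \<rho> N g x \<and> g x = t}" by simp
  have "definable_pred (\<lambda>t. \<exists>x. x \<in> N \<and> \<not> regular_point \<rho> N g x \<and> g x = t)"
    by (intro definable_intros definable_map_intros definable_subst[OF N] definable_subst[OF reg] definable_map_comp[OF g])
  from definable_infinite_interval[OF this inf] obtain a b where ab: "a < b"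
    and crit: "\<And>t. a < t \<Longrightarrow> t < b \<Longrightarrow> \<exists>x. x \<in> N \<and> \<not> regular_point \<rho> N g x \<and> g x = t" by metis
  obtain B where B: "\<And>x. x \<in> N \<Longrightarrow> norm x \<le> B" using \<open>bounded N\<close> unfolding bounded_iff by blast
  have lo: "- B \<le> x \<bullet> i" if "x \<in> N" "i \<in> Basis" for x i
    using Basis_le_norm[OF that(2), of x] B[OF that(1)] by linarith
  \<comment> \<open>a definable curve of critical points, parametrized by the critical value\<close>
  define PX where "PX = (\<lambda>t y. y \<in> N \<and> \<not> regular_point \<rho> N g y \<and> g y = t)"
  have PX: "definable_pred (\<lambda>p. PX (fst p) (snd p))" unfolding PX_def
    by (intro definable_intros definable_map_intros definable_subst[OF N] definable_subst[OF reg] definable_map_comp[OF g])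
  have PXlo: "- B \<le> y \<bullet> i" if "PX t y" "i \<in> Basis" for t y i using lo that unfolding PX_def by blast
  have "\<exists>x. definable_map x \<and> (\<forall>t y. PX t y \<longrightarrow> PX t (x t))"
  proof (rule definable_choice[OF PX])
    show "- B \<le> y \<bullet> i" if "PX t y" "i \<in> Basis" for t y i using that by (rule PXlo)
  qed blast
  then obtain x where x: "definable_map x" and xP: "\<And>t y. PX t y \<Longrightarrow> PX t (x t)" by blast
  have "PX t (x t)" if "a < t" "t < b" for t
    using crit[OF that] xP[of t] unfolding PX_def by blast
  then have xN: "x t \<in> N" and xreg: "\<not> regular_point \<rho> N g (x t)" and gx: "g (x t) = t" if "a < t" "t < b" for t
    using that unfolding PX_def by blast+
  \<comment> \<open>slopes are controlled coordinate by coordinate, hence the factor \<open>D\<close>\<close>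
  define e where "e = \<rho> / D"
  have e: "e > 0" "e \<le> \<rho>" using D \<open>\<rho> > 0\<close> by (auto simp: e_def field_simps)
  obtain a1 b1 v where 1: "a \<le> a1" "a1 < b1" "b1 \<le> b" and
    v: "\<And>s t. a1 < s \<Longrightarrow> s < t \<Longrightarrow> t < b1 \<Longrightarrow> norm (x t - x s - (t - s) *\<^sub>R v) \<le> e * (t - s)"
    using small_slope_interval_vector[OF x ab e(1)] by metis
  \<comment> \<open>the pair \<open>p = (t, r)\<close>; \<open>y\<close> starts a step of length \<open>s\<close> that violates regularity of \<open>x t\<close> for \<open>v\<close>\<close>
  define K where "K = (\<lambda>p y. y \<in> N \<and> norm (y - x (fst p)) < snd p \<and> (\<exists>z s. z \<in> N \<and> norm (z - x (fst p)) < snd p \<and>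
     0 < s \<and> s < snd p \<and> norm (z - y - s *\<^sub>R v) \<le> (2 * \<rho>) * s \<and> g z - g y < (1/2) * s))"
  have Kex: "\<exists>y. K (t, r) y" if t: "a1 < t" "t < b1" and r: "0 < r" for t r
  proof -
    have tangent: "\<exists>y z s. y \<in> N \<and> z \<in> N \<and> norm (y - x t) < r \<and> norm (z - x t) < r \<and> 0 < s \<and> s < r \<and>
        norm (z - y - s *\<^sub>R v) \<le> \<rho> * s" if "0 < r" for r
    proof -
      define c where "c = norm v + \<rho> + 1"
      have c: "c \<ge> 1" using \<open>\<rho> > 0\<close> by (simp add: c_def)
      define s where "s = min (r / (2 * c)) ((b1 - t) / 2)"
      have s0: "0 < s" using that t c by (auto simp: s_def)
      have "s \<le> r / (2 * c)" by (simp add: s_def)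
      then have cs: "c * s \<le> r / 2" using c by (simp add: field_simps)
      have "t + s < b1" using t s0 by (auto simp: s_def min_def field_simps)
      then have n: "norm (x (t + s) - x t - s *\<^sub>R v) \<le> e * s" using v[of t "t + s"] t s0 by simp
      then have n': "norm (x (t + s) - x t - s *\<^sub>R v) \<le> \<rho> * s" using e(2) s0 by (meson mult_right_mono order_trans less_imp_le)
      have "norm (x (t + s) - x t) \<le> norm (x (t + s) - x t - s *\<^sub>R v) + norm (s *\<^sub>R v)" by (metis diff_add_cancel norm_triangle_ineq)
      also have "\<dots> \<le> \<rho> * s + s * norm v" using n' s0 by simp
      also have "\<dots> < c * s" using s0 by (simp add: c_def algebra_simps)
      finally have "norm (x (t + s) - x t) < r" using cs that by linarith
      moreover have "s < r" using cs mult_right_mono[OF c less_imp_le[OF s0]] s0 that by linarith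
      ultimately show ?thesis using n' s0 that xN[of t] xN[of "t + s"] t 1 \<open>t + s < b1\<close>
        by (intro exI[of _ "x t"] exI[of _ "x (t + s)"] exI[of _ s]) auto
    qed
    have "\<not> regular_point \<rho> N g (x t)" using xreg t 1 by auto
    then have "\<not> (\<forall>y z s. y \<in> N \<and> z \<in> N \<and> norm (y - x t) < r \<and> norm (z - x t) < r \<and> 0 < s \<and> s < r \<and>
        norm (z - y - s *\<^sub>R v) \<le> (2 * \<rho>) * s \<longrightarrow> (1/2) * s \<le> g z - g y)"
      unfolding regular_point_def using tangent r by blast
    then show ?thesis unfolding K_def by (simp add: not_le) blast
  qed
  have K: "definable_pred (\<lambda>p. K (fst p) (snd p))" unfolding K_def
    by (intro definable_intros definable_map_intros definable_subst[OF N] definable_map_comp[OF g] definable_map_comp[OF x])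
  have Klo: "- B \<le> y \<bullet> i" if "K p y" "i \<in> Basis" for p y i using lo that unfolding K_def by blast
  have "\<exists>Y. definable_map Y \<and> (\<forall>p y. K p y \<longrightarrow> K p (Y p))"
  proof (rule definable_choice[OF K])
    show "- B \<le> y \<bullet> i" if "K p y" "i \<in> Basis" for p y i using that by (rule Klo)
  qed blast
  then obtain Y where Y: "definable_map Y" and "\<And>p y. K p y \<Longrightarrow> K p (Y p)" by blast
  then have KY: "K (t, r) (Y (t, r))" if "a1 < t" "t < b1" "0 < r" for t r using Kex[OF that] by blast
  have eval: "\<exists>a' b' \<delta>. a1 \<le> a' \<and> a' < b' \<and> b' \<le> b1 \<and> 0 < \<delta> \<and> (\<forall>r s t. 0 < r \<and> r < \<delta> \<and> a' < s \<and> s < t \<and> t < b' \<longrightarrow>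
      (\<forall>i\<in>I. \<bar>(Y (t, r) - Y (s, r)) \<bullet> i - (t - s) * (v \<bullet> i)\<bar> \<le> 2 * e * (t - s)))" if "finite I" "I \<subseteq> (Basis::'d set)" for I
    using that
  proof (induction I rule: finite_induct)
    case empty
    then show ?case using 1 by (intro exI[of _ a1] exI[of _ b1] exI[of _ 1]) auto
  next
    case (insert i I)
    have i: "i \<in> Basis" and "I \<subseteq> Basis" using insert.prems by auto
    from insert.IH[OF this(2)] obtain a' b' \<delta> where 2: "a1 \<le> a'" "a' < b'" "b' \<le> b1" "0 < \<delta>" and
      ih: "\<And>r s t. 0 < r \<Longrightarrow> r < \<delta> \<Longrightarrow> a' < s \<Longrightarrow> s < t \<Longrightarrow> t < b' \<Longrightarrow>
      (\<forall>i\<in>I. \<bar>(Y (t, r) - Y (s, r)) \<bullet> i - (t - s) * (v \<bullet> i)\<bar> \<le> 2 * e * (t - s))" by blast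
    have dmi: "definable_map (\<lambda>p. Y (fst p, snd p) \<bullet> i)" by (intro definable_map_intros definable_map_comp[OF Y] i)
    have lim: "\<bar>Y (t, r) \<bullet> i - x t \<bullet> i\<bar> \<le> 1 * r" if "a' < t" "t < b'" "0 < r" "r < 1" for t r
      using KY[of t r] Basis_le_norm[OF i, of "Y (t, r) - x t"] that 2 unfolding K_def by (simp add: inner_diff_left)
    have slope: "\<bar>x t \<bullet> i - x s \<bullet> i - v \<bullet> i * (t - s)\<bar> \<le> e * (t - s)" if "a' < s" "s < t" "t < b'" for s t
      using v[of s t] Basis_le_norm[OF i, of "x t - x s - (t - s) *\<^sub>R v"] that 2 by (simp add: inner_diff_left algebra_simps)
    obtain a2 b2 \<delta>2 where 3: "a' \<le> a2" "a2 < b2" "b2 \<le> b'" "\<delta>2 > 0" and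
      s: "\<And>r s t. 0 < r \<Longrightarrow> r < \<delta>2 \<Longrightarrow> a2 < s \<Longrightarrow> s < t \<Longrightarrow> t < b2 \<Longrightarrow> \<bar>Y (t, r) \<bullet> i - Y (s, r) \<bullet> i - v \<bullet> i * (t - s)\<bar> \<le> 2 * e * (t - s)"
      using slope_of_approximation[OF dmi 2(2) e(1) zero_less_one, of "\<lambda>t. x t \<bullet> i" 1 "v \<bullet> i"] lim slope by auto
    have "\<forall>j\<in>insert i I. \<bar>(Y (t, r) - Y (s, r)) \<bullet> j - (t - s) * (v \<bullet> j)\<bar> \<le> 2 * e * (t - s)"
      if "0 < r" "r < min \<delta> \<delta>2" "a2 < s" "s < t" "t < b2" for r s t
      using s[of r s t] ih[of r s t] that 3 by (auto simp: inner_diff_left mult.commute)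
    then show ?case using 2 3 by (intro exI[of _ a2] exI[of _ b2] exI[of _ "min \<delta> \<delta>2"]) auto
  qed
  from eval[OF finite_Basis order_refl] obtain a2 b2 \<delta> where 2: "a1 \<le> a2" "a2 < b2" "b2 \<le> b1" "0 < \<delta>" and
      sl: "\<And>r s t i. 0 < r \<Longrightarrow> r < \<delta> \<Longrightarrow> a2 < s \<Longrightarrow> s < t \<Longrightarrow> t < b2 \<Longrightarrow> i \<in> Basis \<Longrightarrow>
      \<bar>(Y (t, r) - Y (s, r)) \<bullet> i - (t - s) * (v \<bullet> i)\<bar> \<le> 2 * e * (t - s)" by metis
  have slope: "norm (Y (t, r) - Y (s, r) - (t - s) *\<^sub>R v) \<le> 2 * \<rho> * (t - s)"
    if h: "0 < r" "r < \<delta>" "a2 < s" "s < t" "t < b2" for r s t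
  proof -
    have "norm (Y (t, r) - Y (s, r) - (t - s) *\<^sub>R v) \<le> (\<Sum>i\<in>Basis. \<bar>(Y (t, r) - Y (s, r) - (t - s) *\<^sub>R v) \<bullet> i\<bar>)" by (rule norm_le_l1)
    also have "\<dots> \<le> (\<Sum>i\<in>(Basis::'d set). 2 * e * (t - s))"
      by (rule sum_mono) (use sl[OF h] in \<open>simp add: inner_diff_left\<close>)
    also have "\<dots> = 2 * \<rho> * (t - s)" using D by (simp add: e_def D_def)
    finally show ?thesis .
  qed
  have dmg: "definable_map (\<lambda>p. g (Y (fst p, snd p)))" by (intro definable_map_intros definable_map_comp[OF Y] definable_map_comp[OF g])
  have lim: "\<bar>g (Y (t, r)) - t\<bar> \<le> L * r" if "a2 < t" "t < b2" "0 < r" "r < 1" for t r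
  proof -
    have t: "a < t" "t < b" using that 1 2 by auto
    have "K (t, r) (Y (t, r))" using KY that 2 by auto
    then have "Y (t, r) \<in> N" "norm (Y (t, r) - x t) \<le> r" by (auto simp: K_def)
    then have "\<bar>g (Y (t, r)) - g (x t)\<bar> \<le> L * r"
      using lip[OF xN[OF t], of "Y (t, r)"] mult_left_mono[of _ _ L] \<open>L \<ge> 0\<close> by (meson order_trans)
    then show ?thesis using gx[OF t] by simp
  qed
  obtain a3 b3 \<delta>3 where 3: "a2 \<le> a3" "a3 < b3" "b3 \<le> b2" "\<delta>3 > 0" and
      gs: "\<And>r s t. 0 < r \<Longrightarrow> r < \<delta>3 \<Longrightarrow> a3 < s \<Longrightarrow> s < t \<Longrightarrow> t < b3 \<Longrightarrow> \<bar>g (Y (t, r)) - g (Y (s, r)) - 1 * (t - s)\<bar> \<le> 2 * (1/8) * (t - s)"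
    using slope_of_approximation[OF dmg 2(2), of "1/8" 1 "\<lambda>t. t" L 1] lim by auto
  define t where "t = (a3 + b3) / 2"
  define m where "m = min (min \<delta> \<delta>3) (b3 - t)"
  define r where "r = m / 2"
  have t: "a3 < t" "t < b3" using 3 by (auto simp: t_def)
  have "0 < m" "m \<le> \<delta>" "m \<le> \<delta>3" "m \<le> b3 - t" using t 2 3 by (auto simp: m_def)
  then have r: "0 < r" "r < \<delta>" "r < \<delta>3" "t + r < b3" unfolding r_def by linarith+
  have "K (t, r) (Y (t, r))" using KY t r 1 2 3 by auto
  then obtain z s where YN: "Y (t, r) \<in> N" and z: "z \<in> N" "0 < s" "s < r" "norm (z - Y (t, r) - s *\<^sub>R v) \<le> 2 * \<rho> * s"
     "g z - g (Y (t, r)) < 1/2 * s" unfolding K_def by auto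
  \<comment> \<open>the length \<open>s\<close> of the violating step is used as an increment of the parameter \<open>t\<close>\<close>
  let ?y = "Y (t + s, r)"
  have ts: "t + s < b3" using z(3) r(4) by linarith
  have "K (t + s, r) ?y" using KY[of "t + s" r] t r z 1 2 3 ts by simp
  then have yN: "?y \<in> N" by (simp add: K_def)
  have "norm (?y - Y (t, r) - s *\<^sub>R v) \<le> 2 * \<rho> * s" using slope[of r t "t + s"] t r z 3 ts by simp
  moreover have "norm (z - ?y) \<le> norm (z - Y (t, r) - s *\<^sub>R v) + norm (?y - Y (t, r) - s *\<^sub>R v)"
    using norm_triangle_ineq4[of "z - Y (t, r) - s *\<^sub>R v" "?y - Y (t, r) - s *\<^sub>R v"] by (simp add: algebra_simps)
  ultimately have "norm (z - ?y) \<le> 4 * \<rho> * s" using z by linarith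
  then have "\<bar>g z - g ?y\<bar> \<le> L * (4 * \<rho> * s)" using lip[OF yN z(1)] mult_left_mono[of _ _ L] \<open>L \<ge> 0\<close> by (meson order_trans)
  also have "\<dots> = (16 * \<rho> * L) * (s / 4)" by simp
  also have "\<dots> \<le> 1 * (s / 4)" using \<rho>L z by (intro mult_right_mono) auto
  finally have "g z \<ge> g ?y - s / 4" by linarith
  moreover have "\<bar>g ?y - g (Y (t, r)) - s\<bar> \<le> s / 4" using gs[of r t "t + s"] t r z ts by simp
  then have "g ?y - g (Y (t, r)) \<ge> 3 / 4 * s" unfolding abs_le_iff by argo
  ultimately show False using z(5) z(2) by linarith
qed

end

section \<open>C1 maps\<close>

abbreviation der :: "('a::real_normed_vector \<Rightarrow> 'b::real_normed_vector) \<Rightarrow> 'a \<Rightarrow> 'a \<Rightarrow> 'b" where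
  "der g x \<equiv> frechet_derivative g (at x)"

lemma C1_openE:
  assumes "C1_open U g"
  obtains g' where "open U" "\<And>x. x \<in> U \<Longrightarrow> (g has_derivative blinfun_apply (g' x)) (at x)" "continuous_on U g'"
    "\<And>x. x \<in> U \<Longrightarrow> blinfun_apply (g' x) = der g x"
proof -
  obtain g' where g: "open U" "\<And>x. x \<in> U \<Longrightarrow> (g has_derivative blinfun_apply (g' x)) (at x)" "continuous_on U g'"
    using assms unfolding C1_open_def by blast
  show ?thesis by (rule that[OF g frechet_derivative_at[OF g(2)]])
qed

lemma C1_openI:
  assumes "open U" "\<And>x. x \<in> U \<Longrightarrow> (g has_derivative blinfun_apply (g' x)) (at x)" "continuous_on U g'"
  shows "C1_open U g"
  using assms unfolding C1_open_def by blast

lemma C1_open_has_derivative: "C1_open U g \<Longrightarrow> x \<in> U \<Longrightarrow> (g has_derivative der g x) (at x)"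
  by (metis C1_openE)

lemma C1_open_linear: "C1_open U g \<Longrightarrow> x \<in> U \<Longrightarrow> bounded_linear (der g x)"
  by (rule has_derivative_bounded_linear[OF C1_open_has_derivative])

lemma C1_open_continuous: "C1_open U g \<Longrightarrow> continuous_on U g"
  by (meson C1_open_has_derivative continuous_at_imp_continuous_on has_derivative_continuous)

text \<open>Continuity of the derivative makes the linear approximation uniform in both end points of a step.\<close>

lemma C1_open_strict:
  assumes "C1_open U g" "x \<in> U" "e > 0"
  obtains d where "d > 0" "ball x d \<subseteq> U"
    "\<And>y z. y \<in> ball x d \<Longrightarrow> z \<in> ball x d \<Longrightarrow> norm (g z - g y - der g x (z - y)) \<le> e * norm (z - y)"
proof -
  obtain g' where g: "open U" "\<And>x. x \<in> U \<Longrightarrow> (g has_derivative blinfun_apply (g' x)) (at x)" "continuous_on U g'"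
    "\<And>x. x \<in> U \<Longrightarrow> blinfun_apply (g' x) = der g x" using C1_openE[OF assms(1)] by metis
  obtain d1 where d1: "d1 > 0" "ball x d1 \<subseteq> U" using g(1) assms(2) openE by blast
  obtain d2 where d2: "d2 > 0" "\<And>y. y \<in> U \<Longrightarrow> dist y x < d2 \<Longrightarrow> dist (g' y) (g' x) < e"
    using g(3) assms(2,3) unfolding continuous_on_iff by metis
  define d where "d = min d1 d2"
  have d: "d > 0" "ball x d \<subseteq> U" using d1 d2 by (auto simp: d_def)
  show ?thesis
  proof (rule that[OF d])
    fix y z assume yz: "y \<in> ball x d" "z \<in> ball x d"
    have "norm (g z - g y - blinfun_apply (g' x) (z - y)) \<le> norm (z - y) * e"
    proof (rule differentiable_bound_linearization[where S = "ball x d"])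
      show "y + t *\<^sub>R (z - y) \<in> ball x d" if "t \<in> {0..1}" for t
      proof -
        have "(1 - t) *\<^sub>R y + t *\<^sub>R z \<in> ball x d" using that yz by (intro convexD[OF convex_ball]) auto
        then show ?thesis by (simp add: algebra_simps)
      qed
      show "(g has_derivative blinfun_apply (g' w)) (at w within ball x d)" if "w \<in> ball x d" for w
        using g(2)[of w] d(2) that has_derivative_at_withinI by blast
      show "onorm (blinfun_apply (g' w) - blinfun_apply (g' x)) \<le> e" if "w \<in> ball x d" for w
      proof -
        have "w \<in> U" using d(2) that by blast
        moreover have "dist w x < d2" using that by (simp add: d_def dist_commute)
        ultimately have "dist (g' w) (g' x) < e" by (rule d2(2))
        then show ?thesis by (simp add: dist_norm norm_blinfun.rep_eq minus_blinfun.rep_eq fun_diff_def)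
      qed
      show "x \<in> ball x d" using d by simp
    qed
    then show "norm (g z - g y - der g x (z - y)) \<le> e * norm (z - y)" using g(4)[OF assms(2)] by (simp add: mult.commute)
  qed
qed

lemma C1_open_der_continuous: "C1_open U g \<Longrightarrow> continuous_on U (\<lambda>x. der g x v)"
proof -
  assume "C1_open U g"
  then obtain g' where g: "continuous_on U g'" "\<And>x. x \<in> U \<Longrightarrow> blinfun_apply (g' x) = der g x" by (metis C1_openE)
  have "continuous_on U (\<lambda>x. blinfun_apply (g' x) v)" by (intro continuous_intros g)
  then show ?thesis using g(2) by (simp cong: continuous_on_cong)
qed

lemma C1_open_der_continuous2:
  assumes "C1_open U g" "continuous_on S a" "continuous_on S v" "a ` S \<subseteq> U"
  shows "continuous_on S (\<lambda>x. der g (a x) (v x))"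
proof -
  obtain g' where g: "continuous_on U g'" "\<And>x. x \<in> U \<Longrightarrow> blinfun_apply (g' x) = der g x" using assms by (metis C1_openE)
  have "continuous_on S (\<lambda>x. g' (a x))" by (rule continuous_on_compose2[OF g(1) assms(2,4)])
  then have "continuous_on S (\<lambda>x. blinfun_apply (g' (a x)) (v x))" by (intro continuous_intros assms)
  then show ?thesis using g(2) assms(4) by (simp add: image_subset_iff cong: continuous_on_cong)
qed

lemma C1_open_subset: "C1_open U g \<Longrightarrow> open V \<Longrightarrow> V \<subseteq> U \<Longrightarrow> C1_open V g"
  unfolding C1_open_def by (meson continuous_on_subset subsetD)

lemma C1_open_const: "open U \<Longrightarrow> C1_open U (\<lambda>x. c)"
  by (rule C1_openI[where g' = "\<lambda>x. 0"]) (auto intro!: derivative_eq_intros)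

lemma C1_open_add: assumes "C1_open U g" "C1_open U h" shows "C1_open U (\<lambda>x. g x + h x)"
proof -
  obtain g' where g: "open U" "\<And>x. x \<in> U \<Longrightarrow> (g has_derivative blinfun_apply (g' x)) (at x)" "continuous_on U g'"
    using assms(1) by (metis C1_openE)
  obtain h' where h: "\<And>x. x \<in> U \<Longrightarrow> (h has_derivative blinfun_apply (h' x)) (at x)" "continuous_on U h'"
    using assms(2) by (metis C1_openE)
  show ?thesis
    by (rule C1_openI[where g' = "\<lambda>x. g' x + h' x"]) (auto intro!: g h continuous_intros derivative_eq_intros simp: plus_blinfun.rep_eq)
qed

lemma C1_open_scaleR: assumes "C1_open U b" "C1_open U h" shows "C1_open U (\<lambda>x. b x *\<^sub>R h x)"
proof -
  obtain b' where b: "open U" "\<And>x. x \<in> U \<Longrightarrow> (b has_derivative blinfun_apply (b' x)) (at x)" "continuous_on U b'"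
    using assms(1) by (metis C1_openE)
  obtain h' where h: "\<And>x. x \<in> U \<Longrightarrow> (h has_derivative blinfun_apply (h' x)) (at x)" "continuous_on U h'"
    using assms(2) by (metis C1_openE)
  have c: "continuous_on U b" "continuous_on U h" using assms C1_open_continuous by auto
  show ?thesis
  proof (rule C1_openI[where g' = "\<lambda>x. b x *\<^sub>R h' x + (blinfun_scaleR_left (h x) o\<^sub>L b' x)"])
    show "((\<lambda>x. b x *\<^sub>R h x) has_derivative blinfun_apply (b x *\<^sub>R h' x + (blinfun_scaleR_left (h x) o\<^sub>L b' x))) (at x)" if "x \<in> U" for x
      using that by (auto intro!: derivative_eq_intros b h simp: plus_blinfun.rep_eq scaleR_blinfun.rep_eq)
    show "continuous_on U (\<lambda>x. b x *\<^sub>R h' x + (blinfun_scaleR_left (h x) o\<^sub>L b' x))"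
      by (intro continuous_intros b h c bounded_linear.continuous_on[OF bounded_linear_blinfun_scaleR_left])
  qed (rule b)
qed

lemma C1_open_compose:
  assumes "C1_open U f" "C1_open V g" shows "C1_open (U \<inter> f -` V) (\<lambda>x. g (f x))"
proof -
  obtain f' where f: "open U" "\<And>x. x \<in> U \<Longrightarrow> (f has_derivative blinfun_apply (f' x)) (at x)" "continuous_on U f'"
    using assms(1) by (metis C1_openE)
  obtain g' where g: "open V" "\<And>x. x \<in> V \<Longrightarrow> (g has_derivative blinfun_apply (g' x)) (at x)" "continuous_on V g'"
    using assms(2) by (metis C1_openE)
  have cf: "continuous_on U f" using assms C1_open_continuous by auto
  show ?thesis
  proof (rule C1_openI[where g' = "\<lambda>x. g' (f x) o\<^sub>L f' x"])
    show "open (U \<inter> f -` V)" by (rule continuous_open_preimage[OF cf f(1) g(1)])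
    show "((\<lambda>x. g (f x)) has_derivative blinfun_apply (g' (f x) o\<^sub>L f' x)) (at x)" if "x \<in> U \<inter> f -` V" for x
    proof -
      have "blinfun_apply (g' (f x) o\<^sub>L f' x) = (\<lambda>v. blinfun_apply (g' (f x)) (blinfun_apply (f' x) v))" by (rule ext) simp
      then show ?thesis using has_derivative_compose[OF f(2) g(2), of x] that by simp
    qed
    show "continuous_on (U \<inter> f -` V) (\<lambda>x. g' (f x) o\<^sub>L f' x)"
      by (intro continuous_intros continuous_on_compose2[OF g(3) continuous_on_subset[OF cf]] continuous_on_subset[OF f(3)]) auto
  qed
qed

lemma C1_open_blinfun_apply: assumes "C1_open U A" shows "C1_open U (\<lambda>x. blinfun_apply (A x) v)"
proof -
  obtain A' where A: "open U" "\<And>x. x \<in> U \<Longrightarrow> (A has_derivative blinfun_apply (A' x)) (at x)" "continuous_on U A'"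
    using assms(1) by (metis C1_openE)
  have bl: "bounded_linear (\<lambda>B::'b \<Rightarrow>\<^sub>L 'c. blinfun_apply B v)"
    by (rule bounded_bilinear.bounded_linear_left[OF bounded_bilinear_blinfun_apply])
  show ?thesis
  proof (rule C1_openI[where g' = "\<lambda>x. Blinfun (\<lambda>B. blinfun_apply B v) o\<^sub>L A' x"])
    show "((\<lambda>x. blinfun_apply (A x) v) has_derivative blinfun_apply (Blinfun (\<lambda>B. blinfun_apply B v) o\<^sub>L A' x)) (at x)" if "x \<in> U" for x
    proof -
      have "blinfun_apply (Blinfun (\<lambda>B. blinfun_apply B v) o\<^sub>L A' x) = (\<lambda>h. blinfun_apply (blinfun_apply (A' x) h) v)"
        by (rule ext) (simp add: bounded_linear_Blinfun_apply[OF bl])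
      then show ?thesis using bounded_linear.has_derivative[OF bl A(2)[OF that]] by simp
    qed
    show "continuous_on U (\<lambda>x. Blinfun (\<lambda>B. blinfun_apply B v) o\<^sub>L A' x)" by (intro continuous_intros A)
  qed (rule A)
qed

lemma C1_open_cong: assumes "C1_open U g" "\<And>x. x \<in> U \<Longrightarrow> h x = g x" shows "C1_open U h"
proof -
  obtain g' where g: "open U" "\<And>x. x \<in> U \<Longrightarrow> (g has_derivative blinfun_apply (g' x)) (at x)" "continuous_on U g'"
    using assms(1) by (metis C1_openE)
  show ?thesis
    by (rule C1_openI[OF g(1) _ g(3)]) (metis g(1,2) assms(2) has_derivative_transform_within_open)
qed

text \<open>The local extensions agree with the map on an open set, so their derivatives agree there, too.\<close>

lemma C1_on_open:
  assumes "C1_on U f" "open U" shows "C1_open U f"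
proof -
  have loc: "\<exists>W. x \<in> W \<and> W \<subseteq> U \<and> C1_open W f" if x: "x \<in> U" for x
  proof -
    obtain V g where V: "x \<in> V" "C1_open V g" "\<forall>y\<in>V \<inter> U. g y = f y"
      using assms(1) x unfolding C1_on_def by blast
    have oV: "open V" using V(2) by (simp add: C1_open_def)
    have "C1_open (V \<inter> U) f"
      by (rule C1_open_cong[OF C1_open_subset[OF V(2)]]) (use V oV assms(2) in auto)
    then show ?thesis using V(1) x by blast
  qed
  have d: "(f has_derivative der f x) (at x)" if "x \<in> U" for x
    using loc[OF that] C1_open_has_derivative by blast
  have ap: "blinfun_apply (Blinfun (der f x)) = der f x" if "x \<in> U" for x
    using bounded_linear_Blinfun_apply[OF has_derivative_bounded_linear[OF d[OF that]]] .
  show ?thesis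
  proof (rule C1_openI[OF assms(2), where g' = "\<lambda>x. Blinfun (der f x)"])
    show "(f has_derivative blinfun_apply (Blinfun (der f x))) (at x)" if "x \<in> U" for x
      using d[OF that] ap[OF that] by simp
    show "continuous_on U (\<lambda>x. Blinfun (der f x))"
    proof (rule continuous_at_imp_continuous_on, rule ballI)
      fix x assume "x \<in> U"
      then obtain W where W: "x \<in> W" "W \<subseteq> U" "C1_open W f" using loc by blast
      obtain g' where g: "open W" "continuous_on W g'" "\<And>x. x \<in> W \<Longrightarrow> blinfun_apply (g' x) = der f x"
        using C1_openE[OF W(3)] by metis
      have "continuous_on W (\<lambda>x. Blinfun (der f x))"
        by (rule continuous_on_eq[OF g(2)]) (metis g(3) blinfun_apply_inverse)
      then show "isCont (\<lambda>x. Blinfun (der f x)) x" using g(1) W(1) by (simp add: continuous_on_eq_continuous_at)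
    qed
  qed
qed

lemma C1_on_add: assumes "C1_on S f" "C1_on S g" shows "C1_on S (\<lambda>x. f x + g x)"
  unfolding C1_on_def
proof
  fix x assume x: "x \<in> S"
  obtain U f' where f: "x \<in> U" "C1_open U f'" "\<forall>y\<in>U \<inter> S. f' y = f y" using assms(1) x unfolding C1_on_def by blast
  obtain V g' where g: "x \<in> V" "C1_open V g'" "\<forall>y\<in>V \<inter> S. g' y = g y" using assms(2) x unfolding C1_on_def by blast
  have o: "open (U \<inter> V)" using f(2) g(2) by (auto simp: C1_open_def)
  have "C1_open (U \<inter> V) (\<lambda>y. f' y + g' y)"
    by (rule C1_open_add[OF C1_open_subset[OF f(2) o] C1_open_subset[OF g(2) o]]) auto
  then show "\<exists>U h. x \<in> U \<and> C1_open U h \<and> (\<forall>y\<in>U \<inter> S. h y = f y + g y)" using f g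
    by (intro exI[of _ "U \<inter> V"] exI[of _ "\<lambda>y. f' y + g' y"]) auto
qed

lemma C1_on_scale: assumes "C1_on S f" shows "C1_on S (\<lambda>x. c *\<^sub>R f x)"
  unfolding C1_on_def
proof
  fix x assume x: "x \<in> S"
  obtain U f' where f: "x \<in> U" "C1_open U f'" "\<forall>y\<in>U \<inter> S. f' y = f y" using assms(1) x unfolding C1_on_def by blast
  have "C1_open U (\<lambda>y. c *\<^sub>R f' y)"
    by (rule C1_open_scaleR[OF C1_open_const f(2)]) (use f(2) in \<open>simp add: C1_open_def\<close>)
  then show "\<exists>U h. x \<in> U \<and> C1_open U h \<and> (\<forall>y\<in>U \<inter> S. h y = c *\<^sub>R f y)" using f
    by (intro exI[of _ U] exI[of _ "\<lambda>y. c *\<^sub>R f' y"]) auto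
qed

lemma C1_on_cong: "C1_on S f \<Longrightarrow> (\<And>x. x \<in> S \<Longrightarrow> f x = g x) \<Longrightarrow> C1_on S g"
  unfolding C1_on_def by (metis IntD2)

lemma C1_on_continuous: assumes "C1_on S f" shows "continuous_on S f"
  unfolding continuous_on_eq_continuous_within
proof
  fix x assume x: "x \<in> S"
  obtain U g where g: "x \<in> U" "C1_open U g" "\<forall>y\<in>U \<inter> S. g y = f y" using assms(1) x unfolding C1_on_def by blast
  have "open U" using g(2) by (simp add: C1_open_def)
  then obtain d where d: "d > 0" "ball x d \<subseteq> U" using g(1) openE by blast
  have "continuous (at x within S) g" using C1_open_has_derivative[OF g(2,1)]
    by (meson continuous_at_imp_continuous_at_within has_derivative_continuous)
  then show "continuous (at x within S) f"
    by (rule continuous_transform_within[OF _ d(1) x]) (use d g(3) in \<open>auto simp: dist_commute subset_iff\<close>)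
qed

section \<open>Charts and tangent vectors\<close>

locale chart =
  fixes E M U :: "'a::euclidean_space set" and \<phi> :: "'a \<Rightarrow> 'a"
  assumes E: "subspace E" and sl: "slice_chart E M U \<phi>"
begin

abbreviation "\<psi> \<equiv> inv_into U \<phi>"

lemma openU: "open U" and openV: "open (\<phi> ` U)" and inj: "inj_on \<phi> U"
  and slice: "\<phi> ` (U \<inter> M) = \<phi> ` U \<inter> E"
  using sl unfolding slice_chart_def C1_diffeo_def bij_betw_def by auto

lemma C1\<phi>: "C1_open U \<phi>" and C1\<psi>: "C1_open (\<phi> ` U) \<psi>"
  using sl C1_on_open openU openV unfolding slice_chart_def C1_diffeo_def by auto

lemma \<psi>\<phi>: "x \<in> U \<Longrightarrow> \<psi> (\<phi> x) = x" using inj by simp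
lemma \<phi>\<psi>: "w \<in> \<phi> ` U \<Longrightarrow> \<phi> (\<psi> w) = w" by (rule f_inv_into_f)
lemma \<psi>_in: "w \<in> \<phi> ` U \<Longrightarrow> \<psi> w \<in> U" by (rule inv_into_into)

lemma \<phi>_in_E: "x \<in> U \<Longrightarrow> \<phi> x \<in> E \<longleftrightarrow> x \<in> M"
proof -
  assume x: "x \<in> U"
  have "x \<in> M" if "\<phi> x \<in> E"
  proof -
    have "\<phi> x \<in> \<phi> ` (U \<inter> M)" using slice x that by blast
    then show ?thesis using inj x by (auto dest: inj_onD)
  qed
  then show ?thesis using slice x by blast
qed

lemma \<psi>_in_M: "w \<in> \<phi> ` U \<Longrightarrow> w \<in> E \<Longrightarrow> \<psi> w \<in> M"
  using \<phi>_in_E[OF \<psi>_in] \<phi>\<psi> by simp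

lemma der_inverse:
  assumes "x \<in> U" shows "der \<psi> (\<phi> x) (der \<phi> x v) = v" "der \<phi> x (der \<psi> (\<phi> x) v) = v"
proof -
  have 1: "(\<phi> has_derivative der \<phi> x) (at x)" by (rule C1_open_has_derivative[OF C1\<phi> assms])
  have 2: "(\<psi> has_derivative der \<psi> (\<phi> x)) (at (\<phi> x))" using C1_open_has_derivative[OF C1\<psi>] assms by blast
  have "((\<lambda>x. \<psi> (\<phi> x)) has_derivative (\<lambda>v. der \<psi> (\<phi> x) (der \<phi> x v))) (at x)"
    by (rule has_derivative_compose[OF 1 2])
  then have "((\<lambda>x. x) has_derivative (\<lambda>v. der \<psi> (\<phi> x) (der \<phi> x v))) (at x)"
    by (rule has_derivative_transform_within_open[OF _ openU assms]) (rule \<psi>\<phi>)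
  then have "(\<lambda>v. der \<psi> (\<phi> x) (der \<phi> x v)) = (\<lambda>v. v)" by (rule has_derivative_unique[OF _ has_derivative_ident])
  then show "der \<psi> (\<phi> x) (der \<phi> x v) = v" by metis
  have one': "(\<phi> has_derivative der \<phi> x) (at (\<psi> (\<phi> x)))" using 1 \<psi>\<phi>[OF assms] by simp
  have "((\<lambda>w. \<phi> (\<psi> w)) has_derivative (\<lambda>v. der \<phi> x (der \<psi> (\<phi> x) v))) (at (\<phi> x))"
    by (rule has_derivative_compose[OF 2 one'])
  then have "((\<lambda>x. x) has_derivative (\<lambda>v. der \<phi> x (der \<psi> (\<phi> x) v))) (at (\<phi> x))"
    by (rule has_derivative_transform_within_open[OF _ openV]) (use assms \<phi>\<psi> in auto)
  then have "(\<lambda>v. der \<phi> x (der \<psi> (\<phi> x) v)) = (\<lambda>v. v)" by (rule has_derivative_unique[OF _ has_derivative_ident])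
  then show "der \<phi> x (der \<psi> (\<phi> x) v) = v" by metis
qed

text \<open>Moving from \<open>y\<close> along a fixed tangent vector of the base point \<open>x\<close> stays close to \<open>M\<close> with an error that is
  uniform in \<open>y\<close>: make the step \<open>s (der \<phi> x v)\<close> in the chart, where \<open>M\<close> is linear.\<close>

lemma strict_tangency:
  assumes x: "x \<in> U" "x \<in> M" and v: "der \<phi> x v \<in> E" and "e > 0"
  obtains d where "d > 0" "\<And>y s. y \<in> M \<Longrightarrow> dist y x < d \<Longrightarrow> \<bar>s\<bar> < d \<Longrightarrow> \<exists>z\<in>M. norm (z - y - s *\<^sub>R v) \<le> e * \<bar>s\<bar>"
proof -
  define W where "W = der \<phi> x v"
  define e' where "e' = e / (norm W + 1)"
  have e': "0 < e'" unfolding e'_def using assms(4) by (intro divide_pos_pos add_nonneg_pos) auto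
  obtain d1 where d1: "d1 > 0" "ball (\<phi> x) d1 \<subseteq> \<phi> ` U" and
    str: "\<And>y z. y \<in> ball (\<phi> x) d1 \<Longrightarrow> z \<in> ball (\<phi> x) d1 \<Longrightarrow> norm (\<psi> z - \<psi> y - der \<psi> (\<phi> x) (z - y)) \<le> e' * norm (z - y)"
    using C1_open_strict[OF C1\<psi> imageI[OF x(1)] e'] by metis
  have "isCont \<phi> x" using C1_open_continuous[OF C1\<phi>] openU x(1) by (simp add: continuous_on_eq_continuous_at)
  then obtain d2 where d2: "d2 > 0" "\<And>y. dist y x < d2 \<Longrightarrow> dist (\<phi> y) (\<phi> x) < d1 / 2"
    unfolding continuous_at_eps_delta using d1(1) by (metis half_gt_zero)
  obtain d3 where d3: "d3 > 0" "ball x d3 \<subseteq> U" using openU x(1) openE by blast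
  define d where "d = min (min d2 d3) (d1 / (2 * (norm W + 1)))"
  have nW: "norm W + 1 > 0" by (intro add_nonneg_pos) auto
  have "d > 0" using d1 d2 d3 nW by (simp add: d_def)
  moreover have "\<exists>z\<in>M. norm (z - y - s *\<^sub>R v) \<le> e * \<bar>s\<bar>" if y: "y \<in> M" "dist y x < d" and s: "\<bar>s\<bar> < d" for y s
  proof -
    have yU: "y \<in> U" using y d3 by (auto simp: d_def dist_commute)
    have y1: "dist (\<phi> y) (\<phi> x) < d1 / 2" using d2 y by (simp add: d_def)
    have "\<bar>s\<bar> * (norm W + 1) \<le> d1 / 2" using s nW by (simp add: d_def field_simps)
    then have sW: "norm (s *\<^sub>R W) \<le> d1 / 2" by (simp add: algebra_simps)
    let ?w = "\<phi> y + s *\<^sub>R W"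
    have "dist ?w (\<phi> x) \<le> dist (\<phi> y) (\<phi> x) + norm (s *\<^sub>R W)"
      using norm_triangle_ineq[of "\<phi> y - \<phi> x" "s *\<^sub>R W"] by (simp add: dist_norm algebra_simps)
    then have wb: "?w \<in> ball (\<phi> x) d1" using y1 sW by (simp add: dist_commute)
    have yb: "\<phi> y \<in> ball (\<phi> x) d1" using y1 d1(1) by (simp add: dist_commute)
    have "?w \<in> E" using E y(1) yU v \<phi>_in_E[OF yU] unfolding W_def by (simp add: subspace_add subspace_scale)
    then have zM: "\<psi> ?w \<in> M" using \<psi>_in_M wb d1(2) by blast
    have "der \<psi> (\<phi> x) (s *\<^sub>R W) = s *\<^sub>R v"
      using C1_open_linear[OF C1\<psi> imageI[OF x(1)]] der_inverse(1)[OF x(1)] by (simp add: W_def linear_cmul bounded_linear.linear)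
    then have "norm (\<psi> ?w - y - s *\<^sub>R v) \<le> e' * norm (s *\<^sub>R W)"
      using str[OF yb wb] \<psi>\<phi>[OF yU] by simp
    also have "\<dots> \<le> e' * (\<bar>s\<bar> * (norm W + 1))" using e' by (intro mult_left_mono) (auto simp: algebra_simps)
    also have "\<dots> = e * \<bar>s\<bar>" using nW by (simp add: e'_def)
    finally show ?thesis using zM by blast
  qed
  ultimately show ?thesis by (rule that)
qed

text \<open>Limits of secant directions are tangent even if both end points move: in the
  chart, the secants lie in \<open>E\<close>, which is closed.\<close>

lemma paratangent_limit:
  assumes x: "x \<in> U" "x \<in> M"
    and lim: "\<And>e. e > 0 \<Longrightarrow> \<exists>y z s. y \<in> M \<and> z \<in> M \<and> dist y x < e \<and> dist z x < e \<and> 0 < s \<and> norm (z - y - s *\<^sub>R u) \<le> e * s"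
  shows "der \<phi> x u \<in> E"
proof -
  have "der \<phi> x u \<in> closure E"
    unfolding closure_approachable
  proof (intro allI impI)
    fix \<epsilon> :: real assume "\<epsilon> > 0"
    obtain K where K: "K > 0" "\<And>h. norm (der \<phi> x h) \<le> norm h * K"
      using bounded_linear.pos_bounded[OF C1_open_linear[OF C1\<phi> x(1)]] by blast
    define e1 where "e1 = \<epsilon> / (2 * (norm u + 2))"
    have nu: "norm u + 2 > 0" by (intro add_nonneg_pos) auto
    have e1: "e1 > 0" using \<open>\<epsilon> > 0\<close> nu by (simp add: e1_def)
    obtain d where d: "d > 0" "ball x d \<subseteq> U"
      "\<And>y z. y \<in> ball x d \<Longrightarrow> z \<in> ball x d \<Longrightarrow> norm (\<phi> z - \<phi> y - der \<phi> x (z - y)) \<le> e1 * norm (z - y)"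
      using C1_open_strict[OF C1\<phi> x(1) e1] by metis
    define e where "e = min (min d 1) (\<epsilon> / (4 * K))"
    have e: "e > 0" "e \<le> d" "e \<le> 1" using d K \<open>\<epsilon> > 0\<close> by (auto simp: e_def)
    have "e \<le> \<epsilon> / (4 * K)" by (simp add: e_def)
    then have eK: "e * K \<le> \<epsilon> / 4" using K by (simp add: field_simps)
    obtain y z s where yz: "y \<in> M" "z \<in> M" "dist y x < e" "dist z x < e" "0 < s" and n: "norm (z - y - s *\<^sub>R u) \<le> e * s"
      using lim[OF e(1)] by blast
    have b: "y \<in> ball x d" "z \<in> ball x d" using yz e by (auto simp: dist_commute)
    have lin: "linear (der \<phi> x)" using C1_open_linear[OF C1\<phi> x(1)] by (rule bounded_linear.linear)
    have "norm (z - y) \<le> norm (z - y - s *\<^sub>R u) + norm (s *\<^sub>R u)" by (metis diff_add_cancel norm_triangle_ineq)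
    also have "\<dots> \<le> e * s + s * norm u" using n yz by simp
    also have "\<dots> \<le> (norm u + 2) * s" using e(3) yz(5) by (simp add: algebra_simps mult_right_mono)
    finally have nzy: "norm (z - y) \<le> (norm u + 2) * s" .
    have "der \<phi> x (z - y - s *\<^sub>R u) = der \<phi> x (z - y) - s *\<^sub>R der \<phi> x u"
      using lin by (simp add: linear_diff linear_cmul)
    then have "norm (\<phi> z - \<phi> y - s *\<^sub>R der \<phi> x u) = norm ((\<phi> z - \<phi> y - der \<phi> x (z - y)) + der \<phi> x (z - y - s *\<^sub>R u))" by simp
    also have "\<dots> \<le> e1 * norm (z - y) + norm (z - y - s *\<^sub>R u) * K"
      by (intro norm_triangle_mono d(3) b K)
    also have "\<dots> \<le> e1 * ((norm u + 2) * s) + (e * s) * K"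
      using nzy n e1 K by (intro add_mono mult_left_mono mult_right_mono) auto
    also have "\<dots> = \<epsilon> / 2 * s + (e * K) * s"
    proof -
      have "e1 * (norm u + 2) = \<epsilon> / 2" using nu unfolding e1_def by (simp add: divide_simps)
      then have "e1 * ((norm u + 2) * s) = \<epsilon> / 2 * s" by (metis mult.assoc)
      then show ?thesis by (simp add: mult.commute mult.left_commute)
    qed
    also have "\<dots> \<le> \<epsilon> / 2 * s + \<epsilon> / 4 * s" using eK yz(5) by (intro add_left_mono mult_right_mono) auto
    also have "\<dots> < \<epsilon> * s" using yz(5) \<open>\<epsilon> > 0\<close> by simp
    finally have main: "norm (\<phi> z - \<phi> y - s *\<^sub>R der \<phi> x u) < \<epsilon> * s" .
    have "norm ((1/s) *\<^sub>R (\<phi> z - \<phi> y) - der \<phi> x u) = norm ((1/s) *\<^sub>R (\<phi> z - \<phi> y - s *\<^sub>R der \<phi> x u))"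
      using yz(5) by (simp add: scaleR_diff_right)
    also have "\<dots> = norm (\<phi> z - \<phi> y - s *\<^sub>R der \<phi> x u) / s" using yz(5) unfolding norm_scaleR by simp
    also have "\<dots> < \<epsilon>" using main yz(5) by (simp only: pos_divide_less_eq)
    finally have "dist ((1/s) *\<^sub>R (\<phi> z - \<phi> y)) (der \<phi> x u) < \<epsilon>" by (simp add: dist_norm)
    moreover have "(1/s) *\<^sub>R (\<phi> z - \<phi> y) \<in> E"
      using E yz b d(2) \<phi>_in_E by (intro subspace_scale subspace_diff) auto
    ultimately show "\<exists>p\<in>E. dist p (der \<phi> x u) < \<epsilon>" by blast
  qed
  then show ?thesis using closed_subspace[OF E] by (simp add: closure_closed)
qed

lemma tangent_space_eq:
  assumes x: "x \<in> U" "x \<in> M" shows "tangent_space M x = {v. der \<phi> x v \<in> E}"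
proof (intro equalityI subsetI)
  fix v assume "v \<in> tangent_space M x"
  then obtain r \<gamma> where r: "r > 0" "\<gamma> ` {-r<..<r} \<subseteq> M" "\<gamma> 0 = x" and \<gamma>: "(\<gamma> has_vector_derivative v) (at 0)"
    unfolding tangent_space_def by blast
  have "der \<phi> x v \<in> E"
  proof (rule paratangent_limit[OF x])
    fix e :: real assume e: "e > 0"
    obtain d1 where d1: "d1 > 0" "\<And>h. norm (h - 0) < d1 \<Longrightarrow> norm (\<gamma> h - \<gamma> 0 - (h - 0) *\<^sub>R v) \<le> e * norm (h - 0)"
      using \<gamma> e unfolding has_vector_derivative_def has_derivative_at_alt by blast
    have "isCont \<gamma> 0" using \<gamma> has_vector_derivative_continuous by blast
    then obtain d2 where d2: "d2 > 0" "\<And>h. dist h 0 < d2 \<Longrightarrow> dist (\<gamma> h) (\<gamma> 0) < e"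
      unfolding continuous_at_eps_delta using e by blast
    define s where "s = min (min d1 d2) r / 2"
    have s: "0 < s" "s < d1" "s < d2" "s < r" using d1 d2 r by (auto simp: s_def min_def)
    show "\<exists>y z s. y \<in> M \<and> z \<in> M \<and> dist y x < e \<and> dist z x < e \<and> 0 < s \<and> norm (z - y - s *\<^sub>R v) \<le> e * s"
      using s d1(2)[of s] d2(2)[of s] r x e by (intro exI[of _ x] exI[of _ "\<gamma> s"] exI[of _ s]) auto
  qed
  then show "v \<in> {v. der \<phi> x v \<in> E}" by simp
next
  fix v assume "v \<in> {v. der \<phi> x v \<in> E}"
  then have v: "der \<phi> x v \<in> E" by simp
  define W where "W = der \<phi> x v"
  obtain d where d: "d > 0" "ball (\<phi> x) d \<subseteq> \<phi> ` U" using openV x(1) openE by blast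
  define e where "e = d / (norm W + 1)"
  have nW: "norm W + 1 > 0" by (intro add_nonneg_pos) auto
  have e: "e > 0" using d nW by (simp add: e_def)
  define \<gamma> where "\<gamma> = (\<lambda>s. \<psi> (\<phi> x + s *\<^sub>R W))"
  have inV: "\<phi> x + s *\<^sub>R W \<in> \<phi> ` U" if "s \<in> {-e<..<e}" for s
  proof -
    have "\<bar>s\<bar> < e" using that by auto
    then have "\<bar>s\<bar> * (norm W + 1) < d" using nW by (simp add: e_def field_simps)
    moreover have "norm (s *\<^sub>R W) \<le> \<bar>s\<bar> * (norm W + 1)" by (simp add: mult_left_mono)
    ultimately have "norm (s *\<^sub>R W) < d" by linarith
    then have "\<phi> x + s *\<^sub>R W \<in> ball (\<phi> x) d" by (simp add: dist_norm)
    then show ?thesis using d by blast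
  qed
  have deriv: "(\<gamma> has_vector_derivative der \<psi> (\<phi> x + s *\<^sub>R W) W) (at s)" if "s \<in> {-e<..<e}" for s
  proof -
    have 1: "((\<lambda>s. \<phi> x + s *\<^sub>R W) has_derivative (\<lambda>h. h *\<^sub>R W)) (at s)"
      by (auto intro!: derivative_eq_intros)
    have 2: "(\<psi> has_derivative der \<psi> (\<phi> x + s *\<^sub>R W)) (at (\<phi> x + s *\<^sub>R W))"
      by (rule C1_open_has_derivative[OF C1\<psi> inV[OF that]])
    have "linear (der \<psi> (\<phi> x + s *\<^sub>R W))"
      using C1_open_linear[OF C1\<psi> inV[OF that]] by (rule bounded_linear.linear)
    then show ?thesis using has_derivative_compose[OF 1 2]
      unfolding \<gamma>_def has_vector_derivative_def by (simp add: linear_cmul)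
  qed
  have cont: "continuous_on {-e<..<e} (\<lambda>s. der \<psi> (\<phi> x + s *\<^sub>R W) W)"
    by (intro C1_open_der_continuous2[OF C1\<psi>] continuous_intros) (use inV in blast)
  have "\<gamma> C1_differentiable_on {-e<..<e}" unfolding C1_differentiable_on_def
    by (intro exI[of _ "\<lambda>s. der \<psi> (\<phi> x + s *\<^sub>R W) W"] conjI ballI deriv cont)
  moreover have "\<gamma> ` {-e<..<e} \<subseteq> M"
  proof -
    have "\<phi> x + s *\<^sub>R W \<in> E" for s
      using E v x \<phi>_in_E[OF x(1)] unfolding W_def by (simp add: subspace_add subspace_scale)
    then show ?thesis unfolding \<gamma>_def using \<psi>_in_M inV by blast
  qed
  moreover have "\<gamma> 0 = x" using \<psi>\<phi>[OF x(1)] by (simp add: \<gamma>_def)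
  moreover have "(\<gamma> has_vector_derivative v) (at 0)"
    using deriv[of 0] e der_inverse(1)[OF x(1)] by (simp add: W_def)
  ultimately show "v \<in> tangent_space M x" unfolding tangent_space_def
    by (intro CollectI exI[of _ e] exI[of _ \<gamma>] conjI e)
qed

end

section \<open>Complete integral curves\<close>

lemma finite_positive_lower_bound:
  fixes f :: "'a \<Rightarrow> real"
  assumes "finite Q" "\<forall>q\<in>Q. 0 < f q"
  shows "\<exists>e>0. \<forall>q\<in>Q. e \<le> f q"
proof (intro exI[of _ "Min (insert 1 (f ` Q))"] conjI ballI)
  show "0 < Min (insert 1 (f ` Q))" using assms by auto
  show "Min (insert 1 (f ` Q)) \<le> f q" if "q \<in> Q" for q using assms(1) that by (intro Min_le) auto
qed

text \<open>A step function with values in \<open>M\<close> that follows \<open>X\<close> up to small errors.  The estimate relates arbitrary times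
  \<open>t\<close> and \<open>t'\<close>, in either order, and involves the mesh \<open>\<tau>\<close> only through small additive terms;
  this form survives limits of step functions.\<close>

lemma euler_polygon:
  fixes X :: "'a::euclidean_space \<Rightarrow> 'a"
  assumes "p \<in> M" and "\<tau> > 0" and "e \<le> 1" and B: "\<And>y. y \<in> M \<Longrightarrow> norm (X y) \<le> B"
    and step: "\<And>y. y \<in> M \<Longrightarrow> \<exists>z\<in>M. norm (z - y - \<tau> *\<^sub>R X y) \<le> e * \<tau>"
  obtains \<gamma> :: "real \<Rightarrow> 'a" where "\<gamma> 0 = p" "\<And>t. \<gamma> t \<in> M"
    "\<And>t t' \<delta> \<eta>. 0 \<le> t \<Longrightarrow> 0 \<le> t' \<Longrightarrow> (\<And>x y. x \<in> M \<Longrightarrow> y \<in> M \<Longrightarrow> dist x y < \<delta> \<Longrightarrow> norm (X x - X y) \<le> \<eta>) \<Longrightarrow>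
       (\<bar>t' - t\<bar> + \<tau>) * (B + 1) < \<delta> \<Longrightarrow>
       norm (\<gamma> t' - \<gamma> t - (t' - t) *\<^sub>R X (\<gamma> t)) \<le> (e + \<eta>) * (\<bar>t' - t\<bar> + \<tau>) + B * \<tau>"
proof -
  obtain nxt where nxt: "\<And>y. y \<in> M \<Longrightarrow> nxt y \<in> M" "\<And>y. y \<in> M \<Longrightarrow> norm (nxt y - y - \<tau> *\<^sub>R X y) \<le> e * \<tau>"
    using step by metis
  have B0: "B \<ge> 0" using B[OF assms(1)] norm_ge_zero order_trans by blast
  have e0: "e \<ge> 0" using order_trans[OF norm_ge_zero nxt(2)[OF assms(1)]] assms(2) by (simp add: zero_le_mult_iff)
  define x where "x = (\<lambda>n::nat. (nxt ^^ n) p)"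
  have xM: "x n \<in> M" for n unfolding x_def by (induction n) (use assms(1) nxt(1) in auto)
  have xs: "x (Suc n) = nxt (x n)" for n by (simp add: x_def)
  have near: "norm (x (i + k) - x i) \<le> real k * \<tau> * (B + 1)" for i k
  proof (induction k)
    case (Suc k)
    have "norm (x (i + Suc k) - x (i + k)) \<le> norm (x (i + Suc k) - x (i + k) - \<tau> *\<^sub>R X (x (i + k))) + norm (\<tau> *\<^sub>R X (x (i + k)))"
      by (metis diff_add_cancel norm_triangle_ineq)
    also have "\<dots> \<le> 1 * \<tau> + \<tau> * B"
    proof (rule add_mono)
      have "norm (x (i + Suc k) - x (i + k) - \<tau> *\<^sub>R X (x (i + k))) \<le> e * \<tau>" using nxt(2)[OF xM] by (simp add: xs)
      also have "\<dots> \<le> 1 * \<tau>" using assms by (intro mult_right_mono) auto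
      finally show "norm (x (i + Suc k) - x (i + k) - \<tau> *\<^sub>R X (x (i + k))) \<le> 1 * \<tau>" .
    qed (use B[OF xM] assms(2) in auto)
    finally have "norm (x (i + Suc k) - x (i + k)) \<le> \<tau> * (B + 1)" by (simp add: algebra_simps)
    moreover have "norm (x (i + Suc k) - x i) \<le> norm (x (i + Suc k) - x (i + k)) + norm (x (i + k) - x i)"
      by (metis diff_add_cancel norm_triangle_ineq add_diff_eq diff_add_eq)
    ultimately show ?case using Suc by (simp add: algebra_simps)
  qed simp
  have lin: "norm (x (i + k) - x i - (real k * \<tau>) *\<^sub>R v) \<le> real k * \<tau> * (e + \<eta>)"
    if "\<And>l. l \<le> k \<Longrightarrow> norm (X (x (i + l)) - v) \<le> \<eta>" for i k v \<eta>
    using that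
  proof (induction k)
    case (Suc k)
    have "norm (X (x (i + k)) - v) \<le> \<eta>" using Suc.prems[of k] by simp
    then have "norm (\<tau> *\<^sub>R (X (x (i + k)) - v)) \<le> \<tau> * \<eta>" using assms(2) by simp
    moreover have "norm (x (i + Suc k) - x (i + k) - \<tau> *\<^sub>R X (x (i + k))) \<le> e * \<tau>" using nxt(2)[OF xM] by (simp add: xs)
    moreover have "norm (x (i + k) - x i - (real k * \<tau>) *\<^sub>R v) \<le> real k * \<tau> * (e + \<eta>)" using Suc by auto
    moreover have "x (i + Suc k) - x i - (real (Suc k) * \<tau>) *\<^sub>R v = (x (i + k) - x i - (real k * \<tau>) *\<^sub>R v)
       + ((x (i + Suc k) - x (i + k) - \<tau> *\<^sub>R X (x (i + k))) + \<tau> *\<^sub>R (X (x (i + k)) - v))" by (simp add: algebra_simps)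
    ultimately have "norm (x (i + Suc k) - x i - (real (Suc k) * \<tau>) *\<^sub>R v) \<le> real k * \<tau> * (e + \<eta>) + (e * \<tau> + \<tau> * \<eta>)"
      by (metis norm_triangle_mono)
    then show ?case by (simp add: algebra_simps)
  qed simp
  define \<gamma> where "\<gamma> = (\<lambda>t. x (nat \<lfloor>t / \<tau>\<rfloor>))"
  show ?thesis
  proof (rule that[of \<gamma>])
    show "\<gamma> 0 = p" by (simp add: \<gamma>_def x_def)
    show "\<gamma> t \<in> M" for t using xM by (simp add: \<gamma>_def)
    fix t t' \<delta> \<eta> :: real
    assume t: "0 \<le> t" "0 \<le> t'" and uc: "\<And>x y. x \<in> M \<Longrightarrow> y \<in> M \<Longrightarrow> dist x y < \<delta> \<Longrightarrow> norm (X x - X y) \<le> \<eta>"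
      and small: "(\<bar>t' - t\<bar> + \<tau>) * (B + 1) < \<delta>"
    have "\<delta> > 0" using small B0 assms(2) by (smt (verit) mult_nonneg_nonneg)
    then have \<eta>0: "\<eta> \<ge> 0" using uc[OF assms(1) assms(1)] by simp
    define i where "i = nat \<lfloor>t / \<tau>\<rfloor>"
    define j where "j = nat \<lfloor>t' / \<tau>\<rfloor>"
    have fl: "real i * \<tau> \<le> t" "t < real i * \<tau> + \<tau>" "real j * \<tau> \<le> t'" "t' < real j * \<tau> + \<tau>"
    proof -
      have "0 \<le> \<lfloor>t / \<tau>\<rfloor>" "0 \<le> \<lfloor>t' / \<tau>\<rfloor>" using t assms(2) by simp_all
      then have "real i = \<lfloor>t / \<tau>\<rfloor>" "real j = \<lfloor>t' / \<tau>\<rfloor>" unfolding i_def j_def by simp_all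
      then have "real i \<le> t / \<tau>" "t / \<tau> < real i + 1" "real j \<le> t' / \<tau>" "t' / \<tau> < real j + 1" by linarith+
      then show "real i * \<tau> \<le> t" "t < real i * \<tau> + \<tau>" "real j * \<tau> \<le> t'" "t' < real j * \<tau> + \<tau>"
        using assms(2) by (simp_all add: field_simps)
    qed
    have diff: "\<bar>(real j - real i) * \<tau> - (t' - t)\<bar> \<le> \<tau>" using fl by (simp add: algebra_simps abs_le_iff)
    have len: "\<bar>real j - real i\<bar> * \<tau> \<le> \<bar>t' - t\<bar> + \<tau>"
    proof -
      have "\<bar>real j - real i\<bar> * \<tau> = \<bar>(real j - real i) * \<tau>\<bar>" using assms(2) by (simp add: abs_mult)
      then show ?thesis using diff by linarith
    qed
    have main: "norm (x j - x i - ((real j - real i) * \<tau>) *\<^sub>R X (x i)) \<le> \<bar>real j - real i\<bar> * \<tau> * (e + \<eta>)"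
    proof (cases "i \<le> j")
      case True
      define k where "k = j - i"
      have j: "j = i + k" using True by (simp add: k_def)
      have "norm (X (x (i + l)) - X (x i)) \<le> \<eta>" if "l \<le> k" for l
      proof (rule uc[OF xM xM])
        have "norm (x (i + l) - x i) \<le> real l * \<tau> * (B + 1)" by (rule near)
        also have "\<dots> \<le> (\<bar>t' - t\<bar> + \<tau>) * (B + 1)"
        proof (intro mult_right_mono)
          have "real l * \<tau> \<le> real k * \<tau>" using that assms(2) by simp
          then show "real l * \<tau> \<le> \<bar>t' - t\<bar> + \<tau>" using len by (simp add: j)
        qed (use B0 in simp)
        finally show "dist (x (i + l)) (x i) < \<delta>" using small by (simp add: dist_norm)
      qed
      from lin[of k i, OF this] show ?thesis by (simp add: j)
    next
      case False
      define k where "k = i - j"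
      have i: "i = j + k" using False by (simp add: k_def)
      have "norm (X (x (j + l)) - X (x i)) \<le> \<eta>" if "l \<le> k" for l
      proof (rule uc[OF xM xM])
        have il: "i = (j + l) + (k - l)" using that i by simp
        have "norm (x i - x (j + l)) \<le> real (k - l) * \<tau> * (B + 1)" using near[of "j + l" "k - l"] il by simp
        also have "\<dots> \<le> (\<bar>t' - t\<bar> + \<tau>) * (B + 1)"
        proof (intro mult_right_mono)
          have "real (k - l) * \<tau> \<le> real k * \<tau>" using that assms(2) by simp
          then show "real (k - l) * \<tau> \<le> \<bar>t' - t\<bar> + \<tau>" using len by (simp add: i)
        qed (use B0 in simp)
        finally show "dist (x (j + l)) (x i) < \<delta>" using small by (simp add: dist_norm norm_minus_commute)
      qed
      from lin[of k j, OF this] have "norm (x i - x j - (real k * \<tau>) *\<^sub>R X (x i)) \<le> real k * \<tau> * (e + \<eta>)" by (simp add: i)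
      moreover have "x j - x i - ((real j - real i) * \<tau>) *\<^sub>R X (x i) = - (x i - x j - (real k * \<tau>) *\<^sub>R X (x i))"
        by (simp add: i algebra_simps)
      ultimately show ?thesis by (simp only: norm_minus_cancel) (simp add: i)
    qed
    have "\<gamma> t' - \<gamma> t - (t' - t) *\<^sub>R X (\<gamma> t) = (x j - x i - ((real j - real i) * \<tau>) *\<^sub>R X (x i)) + ((real j - real i) * \<tau> - (t' - t)) *\<^sub>R X (x i)"
      by (simp add: \<gamma>_def i_def j_def algebra_simps)
    also have "norm \<dots> \<le> \<bar>real j - real i\<bar> * \<tau> * (e + \<eta>) + \<tau> * B"
      by (intro norm_triangle_mono main) (simp, intro mult_mono diff B xM, use assms(2) in auto)
    also have "\<dots> \<le> (\<bar>t' - t\<bar> + \<tau>) * (e + \<eta>) + \<tau> * B"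
      using len e0 \<eta>0 by (intro add_right_mono mult_right_mono) auto
    finally show "norm (\<gamma> t' - \<gamma> t - (t' - t) *\<^sub>R X (\<gamma> t)) \<le> (e + \<eta>) * (\<bar>t' - t\<bar> + \<tau>) + B * \<tau>"
      by (simp add: mult.commute)
  qed
qed

text \<open>Compactness of the product space of all maps from the line to \<open>M\<close> replaces equicontinuity arguments.
  The differential equation is encoded by closed conditions with parameters \<open>\<eta>\<close> (modulus of
  differentiability) and \<open>\<kappa>\<close> (additive error); a fine polygon meets finitely many of them, and a
  curve meeting all of them is a solution for all positive times.\<close>

lemma forward_integral_curve:
  fixes X :: "'a::euclidean_space \<Rightarrow> 'a"
  assumes M: "compact M" and X: "continuous_on M X" and p: "p \<in> M"
    and tang: "\<And>e. e > 0 \<Longrightarrow> \<exists>d>0. \<forall>y\<in>M. \<forall>s. 0 < s \<and> s < d \<longrightarrow> (\<exists>z\<in>M. norm (z - y - s *\<^sub>R X y) \<le> e * s)"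
  obtains \<alpha> :: "real \<Rightarrow> 'a" where "\<alpha> 0 = p" "\<And>t. \<alpha> t \<in> M"
    "\<And>\<eta>. \<eta> > 0 \<Longrightarrow> \<exists>h>0. \<forall>t t'. 0 \<le> t \<and> 0 \<le> t' \<and> \<bar>t' - t\<bar> < h \<longrightarrow> norm (\<alpha> t' - \<alpha> t - (t' - t) *\<^sub>R X (\<alpha> t)) \<le> \<eta> * \<bar>t' - t\<bar>"
proof -
  obtain B where B0: "B > 0" and B: "\<And>y. y \<in> M \<Longrightarrow> norm (X y) \<le> B"
    using compact_imp_bounded[OF compact_continuous_image[OF X M]] unfolding bounded_pos by auto
  have uc: "\<exists>\<delta>>0. \<forall>x\<in>M. \<forall>y\<in>M. dist x y < \<delta> \<longrightarrow> norm (X x - X y) \<le> \<eta> / 2" if "\<eta> > 0" for \<eta>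
    using compact_uniformly_continuous[OF X M] that unfolding uniformly_continuous_on_def
    by (metis dist_norm half_gt_zero less_imp_le)
  then obtain \<delta> where \<delta>: "\<And>\<eta>. \<eta> > 0 \<Longrightarrow> \<delta> \<eta> > 0"
    "\<And>\<eta> x y. \<eta> > 0 \<Longrightarrow> x \<in> M \<Longrightarrow> y \<in> M \<Longrightarrow> dist x y < \<delta> \<eta> \<Longrightarrow> norm (X x - X y) \<le> \<eta> / 2" by metis
  define h where "h = (\<lambda>\<eta>. \<delta> \<eta> / (2 * (B + 1)))"
  have h: "h \<eta> > 0" if "\<eta> > 0" for \<eta> using \<delta>(1)[OF that] B0 by (simp add: h_def)
  define P where "P = {\<gamma> :: real \<Rightarrow> 'a. \<forall>t. \<gamma> t \<in> M}"
  have "compactin (product_topology (\<lambda>i::real. euclidean) UNIV) (PiE UNIV (\<lambda>_. M))"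
    unfolding compactin_PiE using M by simp
  moreover have "PiE UNIV (\<lambda>_. M) = P" by (auto simp: P_def PiE_def Pi_def)
  ultimately have cP: "compact P" by (simp add: euclidean_product_topology)
  define C where "C = (\<lambda>(\<eta>, \<kappa>). {\<gamma> \<in> P. \<gamma> 0 = p \<and> (\<forall>t t'. 0 \<le> t \<and> 0 \<le> t' \<and> \<bar>t' - t\<bar> < h \<eta> \<longrightarrow>
       norm (\<gamma> t' - \<gamma> t - (t' - t) *\<^sub>R X (\<gamma> t)) \<le> \<eta> * \<bar>t' - t\<bar> + \<kappa>)})"
  have closedP: "closed P"
  proof -
    have "P = (\<Inter>t. (\<lambda>\<gamma>. \<gamma> t) -` M)" by (auto simp: P_def)
    moreover have "closed ((\<lambda>\<gamma>::real \<Rightarrow> 'a. \<gamma> t) -` M)" for t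
      using continuous_closed_preimage[OF continuous_on_product_coordinates, of M] compact_imp_closed[OF M] by simp
    ultimately show ?thesis by auto
  qed
  have coord: "continuous_on P (\<lambda>\<gamma>. \<gamma> t)" for t by (rule continuous_on_subset[OF continuous_on_product_coordinates]) simp
  have Xc: "continuous_on P (\<lambda>\<gamma>. X (\<gamma> t))" for t
    by (rule continuous_on_compose2[OF X coord]) (auto simp: P_def)
  have closedC: "closed (C q)" for q
  proof (cases q)
    case (Pair \<eta> \<kappa>)
    have eq: "C q = (P \<inter> (\<lambda>\<gamma>. \<gamma> 0) -` {p}) \<inter> (\<Inter>t\<in>{0..}. \<Inter>t'\<in>{0..} \<inter> {t'. \<bar>t' - t\<bar> < h \<eta>}.
       P \<inter> (\<lambda>\<gamma>. norm (\<gamma> t' - \<gamma> t - (t' - t) *\<^sub>R X (\<gamma> t))) -` {..\<eta> * \<bar>t' - t\<bar> + \<kappa>})"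
      by (auto simp: C_def Pair)
    have c0: "closed (P \<inter> (\<lambda>\<gamma>. \<gamma> 0) -` {p})" by (rule continuous_closed_preimage[OF coord closedP]) simp
    have c1: "closed (P \<inter> (\<lambda>\<gamma>. norm (\<gamma> t' - \<gamma> t - (t' - t) *\<^sub>R X (\<gamma> t))) -` {..\<eta> * \<bar>t' - t\<bar> + \<kappa>})" for t t'
      by (rule continuous_closed_preimage[OF _ closedP]) (auto intro!: continuous_intros coord Xc)
    show ?thesis unfolding eq by (rule closed_Int[OF c0]) (intro closed_INT ballI c1)
  qed
  have fip: "P \<inter> \<Inter>\<F> \<noteq> {}" if fin: "finite \<F>" "\<F> \<subseteq> C ` ({0<..} \<times> {0<..})" for \<F>
  proof -
    obtain Q where Q: "Q \<subseteq> {0<..} \<times> {0<..}" "finite Q" "\<F> = C ` Q" using finite_subset_image[OF fin] by blast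
    have pos: "0 < fst q" "0 < snd q" if "q \<in> Q" for q using Q that by auto
    have pos2: "\<forall>q\<in>Q. 0 < fst q / 2" using pos(1) by simp
    obtain e1 where e1: "e1 > 0" "\<And>q. q \<in> Q \<Longrightarrow> e1 \<le> fst q / 2"
      using finite_positive_lower_bound[OF Q(2) pos2] by blast
    define e where "e = min e1 1"
    have e: "e > 0" "e \<le> 1" "\<And>q. q \<in> Q \<Longrightarrow> e \<le> fst q / 2" using e1 by (force simp: e_def)+
    obtain d where d: "d > 0" "\<And>y s. y \<in> M \<Longrightarrow> 0 < s \<Longrightarrow> s < d \<Longrightarrow> \<exists>z\<in>M. norm (z - y - s *\<^sub>R X y) \<le> e * s"
      using tang[OF e(1)] by blast
    have pos3: "\<forall>q\<in>Q. 0 < min (h (fst q)) (snd q / (fst q + B))"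
      using pos h[OF pos(1)] B0 by (auto intro!: divide_pos_pos add_pos_pos)
    obtain \<tau>1 where \<tau>1: "\<tau>1 > 0" "\<And>q. q \<in> Q \<Longrightarrow> \<tau>1 \<le> min (h (fst q)) (snd q / (fst q + B))"
      using finite_positive_lower_bound[OF Q(2) pos3] by blast
    define \<tau> where "\<tau> = min \<tau>1 (d / 2)"
    have \<tau>: "\<tau> > 0" "\<tau> < d" using \<tau>1 d by (auto simp: \<tau>_def)
    show ?thesis
    proof (rule euler_polygon[OF p \<tau>(1) e(2)])
      show "norm (X y) \<le> B" if "y \<in> M" for y using B[OF that] .
      show "\<exists>z\<in>M. norm (z - y - \<tau> *\<^sub>R X y) \<le> e * \<tau>" if "y \<in> M" for y using d(2)[OF that \<tau>] .
    next
    fix \<gamma> :: "real \<Rightarrow> 'a"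
    assume \<gamma>: "\<gamma> 0 = p" "\<And>t. \<gamma> t \<in> M"
      "\<And>t t' \<delta> \<eta>. 0 \<le> t \<Longrightarrow> 0 \<le> t' \<Longrightarrow> (\<And>x y. x \<in> M \<Longrightarrow> y \<in> M \<Longrightarrow> dist x y < \<delta> \<Longrightarrow> norm (X x - X y) \<le> \<eta>) \<Longrightarrow>
       (\<bar>t' - t\<bar> + \<tau>) * (B + 1) < \<delta> \<Longrightarrow>
       norm (\<gamma> t' - \<gamma> t - (t' - t) *\<^sub>R X (\<gamma> t)) \<le> (e + \<eta>) * (\<bar>t' - t\<bar> + \<tau>) + B * \<tau>"
    have "\<gamma> \<in> C q" if q: "q \<in> Q" for q
    proof (cases q)
      case (Pair \<eta> \<kappa>)
      have pk: "\<eta> > 0" "\<kappa> > 0" using pos[OF q] Pair by auto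
      have \<tau>h: "\<tau> \<le> h \<eta>" "\<tau> \<le> \<kappa> / (\<eta> + B)" using \<tau>1(2)[OF q] Pair by (auto simp: \<tau>_def)
      have "norm (\<gamma> t' - \<gamma> t - (t' - t) *\<^sub>R X (\<gamma> t)) \<le> \<eta> * \<bar>t' - t\<bar> + \<kappa>"
        if t: "0 \<le> t" "0 \<le> t'" "\<bar>t' - t\<bar> < h \<eta>" for t t'
      proof -
        have "(\<bar>t' - t\<bar> + \<tau>) * (B + 1) < (h \<eta> + h \<eta>) * (B + 1)" using t \<tau>h B0 by (intro mult_strict_right_mono) auto
        also have "\<dots> = \<delta> \<eta>"
        proof -
          have "B + 1 \<noteq> 0" using B0 by simp
          moreover have "x / (2 * c) * c = x / 2" if "c \<noteq> 0" for x c :: real using that by simp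
          ultimately have "h \<eta> * (B + 1) = \<delta> \<eta> / 2" unfolding h_def by blast
          then show ?thesis by (simp add: distrib_right)
        qed
        finally have "norm (\<gamma> t' - \<gamma> t - (t' - t) *\<^sub>R X (\<gamma> t)) \<le> (e + \<eta> / 2) * (\<bar>t' - t\<bar> + \<tau>) + B * \<tau>"
          by (intro \<gamma>(3)[where \<delta> = "\<delta> \<eta>"] t \<delta>(2)[OF pk(1)])
        also have "\<dots> \<le> \<eta> * (\<bar>t' - t\<bar> + \<tau>) + B * \<tau>"
          using e(3)[OF q] \<tau>(1) Pair by (intro add_right_mono mult_right_mono) auto
        also have "\<dots> = \<eta> * \<bar>t' - t\<bar> + \<tau> * (\<eta> + B)" by (simp add: algebra_simps)
        also have "\<dots> \<le> \<eta> * \<bar>t' - t\<bar> + \<kappa>" using \<tau>h(2) pk B0 by (simp add: field_simps)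
        finally show ?thesis .
      qed
      then show ?thesis using \<gamma>(1,2) by (auto simp: C_def Pair P_def)
    qed
    moreover have "\<gamma> \<in> P" using \<gamma>(2) by (simp add: P_def)
    ultimately show ?thesis unfolding Q(3) by blast
    qed
  qed
  have "P \<inter> \<Inter> (C ` ({0<..} \<times> {0<..})) \<noteq> {}"
    by (rule compact_imp_fip[OF cP]) (use closedC fip in auto)
  then obtain \<alpha> where \<alpha>P: "\<alpha> \<in> P" and \<alpha>: "\<And>\<eta> \<kappa>. \<eta> > 0 \<Longrightarrow> \<kappa> > 0 \<Longrightarrow> \<alpha> \<in> C (\<eta>, \<kappa>)" by auto
  show ?thesis
  proof (rule that[of \<alpha>])
    show "\<alpha> 0 = p" using \<alpha>[of 1 1] by (simp add: C_def)
    show "\<alpha> t \<in> M" for t using \<alpha>P by (simp add: P_def)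
    fix \<eta> :: real assume \<eta>: "\<eta> > 0"
    have "norm (\<alpha> t' - \<alpha> t - (t' - t) *\<^sub>R X (\<alpha> t)) \<le> \<eta> * \<bar>t' - t\<bar>" if "0 \<le> t" "0 \<le> t'" "\<bar>t' - t\<bar> < h \<eta>" for t t'
    proof (rule field_le_epsilon)
      fix \<kappa> :: real assume "\<kappa> > 0"
      then show "norm (\<alpha> t' - \<alpha> t - (t' - t) *\<^sub>R X (\<alpha> t)) \<le> \<eta> * \<bar>t' - t\<bar> + \<kappa>"
        using \<alpha>[OF \<eta>] that by (simp add: C_def)
    qed
    then show "\<exists>h>0. \<forall>t t'. 0 \<le> t \<and> 0 \<le> t' \<and> \<bar>t' - t\<bar> < h \<longrightarrow> norm (\<alpha> t' - \<alpha> t - (t' - t) *\<^sub>R X (\<alpha> t)) \<le> \<eta> * \<bar>t' - t\<bar>"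
      using h[OF \<eta>] by blast
  qed
qed

text \<open>A solution for \<open>X\<close> and one for \<open>- X\<close>, run backwards, fit together at time 0.\<close>

lemma complete_integral_curve:
  fixes X :: "'a::euclidean_space \<Rightarrow> 'a"
  assumes M: "compact M" and X: "continuous_on M X" and p: "p \<in> M"
    and tang: "\<And>e. e > 0 \<Longrightarrow> \<exists>d>0. \<forall>y\<in>M. \<forall>s. \<bar>s\<bar> < d \<longrightarrow> (\<exists>z\<in>M. norm (z - y - s *\<^sub>R X y) \<le> e * \<bar>s\<bar>)"
  obtains \<gamma> where "integral_curve M X \<gamma>" "\<gamma> 0 = p"
proof -
  have f: "\<exists>d>0. \<forall>y\<in>M. \<forall>s. 0 < s \<and> s < d \<longrightarrow> (\<exists>z\<in>M. norm (z - y - s *\<^sub>R X y) \<le> e * s)" if e: "e > 0" for e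
    using tang[OF e] by (metis abs_of_pos)
  have b: "\<exists>d>0. \<forall>y\<in>M. \<forall>s. 0 < s \<and> s < d \<longrightarrow> (\<exists>z\<in>M. norm (z - y - s *\<^sub>R (- X y)) \<le> e * s)" if e: "e > 0" for e
  proof -
    obtain d where d: "d > 0" "\<And>y s. y \<in> M \<Longrightarrow> \<bar>s\<bar> < d \<Longrightarrow> \<exists>z\<in>M. norm (z - y - s *\<^sub>R X y) \<le> e * \<bar>s\<bar>" using tang[OF e] by blast
    have "\<exists>z\<in>M. norm (z - y - s *\<^sub>R (- X y)) \<le> e * s" if "y \<in> M" "0 < s" "s < d" for y s
      using d(2)[of y "- s"] that by simp
    then show ?thesis using d(1) by blast
  qed
  have Xm: "continuous_on M (\<lambda>x. - X x)" by (intro continuous_intros X)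
  obtain \<alpha> where \<alpha>: "\<alpha> 0 = p" "\<And>t. \<alpha> t \<in> M"
    "\<And>\<eta>. \<eta> > 0 \<Longrightarrow> \<exists>h>0. \<forall>t t'. 0 \<le> t \<and> 0 \<le> t' \<and> \<bar>t' - t\<bar> < h \<longrightarrow> norm (\<alpha> t' - \<alpha> t - (t' - t) *\<^sub>R X (\<alpha> t)) \<le> \<eta> * \<bar>t' - t\<bar>"
    using forward_integral_curve[OF M X p f] by metis
  obtain \<beta> where \<beta>: "\<beta> 0 = p" "\<And>t. \<beta> t \<in> M"
    "\<And>\<eta>. \<eta> > 0 \<Longrightarrow> \<exists>h>0. \<forall>t t'. 0 \<le> t \<and> 0 \<le> t' \<and> \<bar>t' - t\<bar> < h \<longrightarrow> norm (\<beta> t' - \<beta> t - (t' - t) *\<^sub>R (- X (\<beta> t))) \<le> \<eta> * \<bar>t' - t\<bar>"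
    using forward_integral_curve[OF M Xm p b] by metis
  define \<gamma> where "\<gamma> = (\<lambda>t. if t \<ge> 0 then \<alpha> t else \<beta> (- t))"
  have \<gamma>neg: "\<gamma> t = \<beta> (- t)" if "t \<le> 0" for t using that \<alpha>(1) \<beta>(1) by (cases "t = 0") (auto simp: \<gamma>_def)
  have deriv: "(\<gamma> has_vector_derivative X (\<gamma> t)) (at t)" for t
    unfolding has_vector_derivative_def has_derivative_at_alt
  proof (intro conjI allI impI)
    show "bounded_linear (\<lambda>s. s *\<^sub>R X (\<gamma> t))" by (rule bounded_linear_scaleR_left)
    fix e :: real assume "e > 0"
    obtain h1 where h1: "h1 > 0" "\<And>t t'. 0 \<le> t \<Longrightarrow> 0 \<le> t' \<Longrightarrow> \<bar>t' - t\<bar> < h1 \<Longrightarrow> norm (\<alpha> t' - \<alpha> t - (t' - t) *\<^sub>R X (\<alpha> t)) \<le> e * \<bar>t' - t\<bar>"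
      using \<alpha>(3)[OF \<open>e > 0\<close>] by blast
    obtain h2 where h2: "h2 > 0" "\<And>t t'. 0 \<le> t \<Longrightarrow> 0 \<le> t' \<Longrightarrow> \<bar>t' - t\<bar> < h2 \<Longrightarrow> norm (\<beta> t' - \<beta> t - (t' - t) *\<^sub>R (- X (\<beta> t))) \<le> e * \<bar>t' - t\<bar>"
      using \<beta>(3)[OF \<open>e > 0\<close>] by blast
    define d where "d = (if t = 0 then min h1 h2 else min (min h1 h2) \<bar>t\<bar>)"
    have d: "d > 0" "d \<le> h1" "d \<le> h2" using h1 h2 by (auto simp: d_def)
    have "norm (\<gamma> t' - \<gamma> t - (t' - t) *\<^sub>R X (\<gamma> t)) \<le> e * norm (t' - t)" if "norm (t' - t) < d" for t'
    proof -
      have "(0 \<le> t \<and> 0 \<le> t') \<or> (t \<le> 0 \<and> t' \<le> 0)" using that unfolding d_def by (auto split: if_splits)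
      then show ?thesis
      proof
        assume "0 \<le> t \<and> 0 \<le> t'"
        then show ?thesis using h1(2)[of t t'] that d by (simp add: \<gamma>_def)
      next
        assume "t \<le> 0 \<and> t' \<le> 0"
        moreover have "\<bar>- t' - - t\<bar> = \<bar>t' - t\<bar>" by simp
        ultimately show ?thesis using h2(2)[of "-t" "-t'"] that d by (simp add: \<gamma>neg algebra_simps abs_minus_commute)
      qed
    qed
    then show "\<exists>d>0. \<forall>y. norm (y - t) < d \<longrightarrow> norm (\<gamma> y - \<gamma> t - (y - t) *\<^sub>R X (\<gamma> t)) \<le> e * norm (y - t)"
      using d(1) by blast
  qed
  moreover have "\<gamma> t \<in> M" for t using \<alpha>(2) \<beta>(2) by (simp add: \<gamma>_def)
  moreover have "\<gamma> 0 = p" using \<alpha>(1) by (simp add: \<gamma>_def)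
  ultimately show ?thesis using that unfolding integral_curve_def by blast
qed

section \<open>Fields on a manifold with an atlas\<close>

lemma compact_uniform:
  fixes M :: "'a::metric_space set"
  assumes "compact M" and anti: "\<And>y d d'. P y d \<Longrightarrow> 0 < d' \<Longrightarrow> d' \<le> d \<Longrightarrow> P y d'"
    and loc: "\<And>x. x \<in> M \<Longrightarrow> \<exists>d>0. \<forall>y\<in>M. dist y x < d \<longrightarrow> P y (d::real)"
  shows "\<exists>d>0. \<forall>y\<in>M. P y d"
proof -
  obtain d where d: "\<And>x. x \<in> M \<Longrightarrow> d x > 0" "\<And>x y. x \<in> M \<Longrightarrow> y \<in> M \<Longrightarrow> dist y x < d x \<Longrightarrow> P y (d x)"
    using loc by metis
  obtain C where C: "C \<subseteq> M" "finite C" "M \<subseteq> (\<Union>x\<in>C. ball x (d x))"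
    by (rule compactE_image[OF assms(1), of M "\<lambda>x. ball x (d x)"]) (use d(1) in force)+
  obtain e where e: "e > 0" "\<forall>x\<in>C. e \<le> d x"
    using finite_positive_lower_bound[OF C(2), of d] d(1) C(1) by blast
  have "P y e" if "y \<in> M" for y
  proof -
    have "y \<in> (\<Union>x\<in>C. ball x (d x))" using C(3) that by blast
    then obtain x where "x \<in> C" "dist y x < d x" by (auto simp: dist_commute)
    then show ?thesis using anti[OF d(2)[of x y] e(1)] e(2) C(1) that by blast
  qed
  then show ?thesis using e(1) by blast
qed

text \<open>A strict bound on a compact set leaves a gap, which absorbs small perturbations.\<close>

lemma small_perturbation_gap:
  fixes a b :: "'c::topological_space \<Rightarrow> 'b::real_normed_vector"
  assumes C: "compact C" and a: "continuous_on C a" and b: "continuous_on C b" and lt: "\<And>c. c \<in> C \<Longrightarrow> norm (a c) < \<delta>"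
  shows "\<exists>\<eta>0>0. \<forall>\<eta>. 0 < \<eta> \<and> \<eta> < \<eta>0 \<longrightarrow> (\<forall>c\<in>C. norm (a c + \<eta> *\<^sub>R b c) < \<delta>)"
proof (cases "C = {}")
  case False
  obtain c0 where c0: "c0 \<in> C" "\<And>c. c \<in> C \<Longrightarrow> norm (a c) \<le> norm (a c0)"
    using continuous_attains_sup[OF C False continuous_on_norm[OF a]] by blast
  obtain B where B: "B > 0" "\<And>c. c \<in> C \<Longrightarrow> norm (b c) \<le> B"
    using compact_imp_bounded[OF compact_continuous_image[OF b C]] unfolding bounded_pos by auto
  define \<eta>0 where "\<eta>0 = (\<delta> - norm (a c0)) / B"
  have "\<eta>0 > 0" using lt[OF c0(1)] B by (simp add: \<eta>0_def)
  moreover have "norm (a c + \<eta> *\<^sub>R b c) < \<delta>" if "0 < \<eta>" "\<eta> < \<eta>0" "c \<in> C" for \<eta> c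
  proof -
    have "norm (a c + \<eta> *\<^sub>R b c) \<le> norm (a c) + \<eta> * norm (b c)" using norm_triangle_ineq[of "a c" "\<eta> *\<^sub>R b c"] that by simp
    also have "\<dots> \<le> norm (a c0) + \<eta> * B" using c0(2)[OF that(3)] B(2)[OF that(3)] that by (intro add_mono mult_left_mono) auto
    also have "\<dots> < \<delta>" using that(2) B by (simp add: \<eta>0_def field_simps)
    finally show ?thesis .
  qed
  ultimately show ?thesis by blast
qed (auto intro: exI[of _ 1])

lemma (in chart) chart_rep_image: "x \<in> U \<Longrightarrow> chart_rep U \<phi> X (\<phi> x) = der \<phi> x (X x)"
  by (simp add: chart_rep_def \<psi>\<phi>)

locale atlas_manifold =
  fixes E M :: "'a::euclidean_space set" and \<A> :: "('a set \<times> ('a \<Rightarrow> 'a)) set"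
  assumes compactM: "compact M" and nonempty: "M \<noteq> {}" and atlas: "C2_atlas E M \<A>"
begin

abbreviation "VF \<equiv> C1_vector_fields M \<A>"
abbreviation "T \<equiv> C1_topology E M \<A>"

lemma chartI: "(U, \<phi>) \<in> \<A> \<Longrightarrow> chart E M U \<phi>"
  using atlas unfolding C2_atlas_def by unfold_locales auto

lemma covered: assumes "p \<in> M" obtains U \<phi> where "(U, \<phi>) \<in> \<A>" "p \<in> U"
  using atlas assms unfolding C2_atlas_def by blast

lemma transition: "(U, \<phi>) \<in> \<A> \<Longrightarrow> (V, \<psi>) \<in> \<A> \<Longrightarrow> C2_on (\<phi> ` (U \<inter> V \<inter> M)) (\<psi> \<circ> inv_into U \<phi>)"
  using atlas unfolding C2_atlas_def by blast

lemma VF_tangent: "X \<in> VF \<Longrightarrow> x \<in> M \<Longrightarrow> X x \<in> tangent_space M x"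
  unfolding C1_vector_fields_def by blast

lemma VF_rep: "X \<in> VF \<Longrightarrow> (U, \<phi>) \<in> \<A> \<Longrightarrow> C1_on (\<phi> ` (U \<inter> M)) (chart_rep U \<phi> X)"
  unfolding C1_vector_fields_def by blast

lemma VFI:
  assumes "X \<in> extensional M" "\<And>x. x \<in> M \<Longrightarrow> X x \<in> tangent_space M x"
    "\<And>U \<phi>. (U, \<phi>) \<in> \<A> \<Longrightarrow> C1_on (\<phi> ` (U \<inter> M)) (chart_rep U \<phi> X)"
  shows "X \<in> VF"
  using assms unfolding C1_vector_fields_def by blast

lemma tangent_lincomb:
  assumes "x \<in> M" "u \<in> tangent_space M x" "v \<in> tangent_space M x" shows "u + c *\<^sub>R v \<in> tangent_space M x"
proof -
  obtain U \<phi> where U: "(U, \<phi>) \<in> \<A>" "x \<in> U" using covered assms(1) .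
  interpret chart E M U \<phi> by (rule chartI[OF U(1)])
  have "linear (der \<phi> x)" using C1_open_linear[OF C1\<phi> U(2)] by (rule bounded_linear.linear)
  then show ?thesis using assms(2,3) E unfolding tangent_space_eq[OF U(2) assms(1)]
    by (simp add: linear_add linear_cmul subspace_add subspace_scale)
qed

lemma rep_lincomb:
  assumes "(U, \<phi>) \<in> \<A>" "w \<in> \<phi> ` (U \<inter> M)"
  shows "chart_rep U \<phi> (\<lambda>x\<in>M. X x + c *\<^sub>R V x) w = chart_rep U \<phi> X w + c *\<^sub>R chart_rep U \<phi> V w"
proof -
  interpret chart E M U \<phi> by (rule chartI[OF assms(1)])
  obtain x where x: "x \<in> U" "x \<in> M" "w = \<phi> x" using assms(2) by blast
  have "linear (der \<phi> x)" using C1_open_linear[OF C1\<phi> x(1)] by (rule bounded_linear.linear)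
  then show ?thesis using x by (simp add: chart_rep_image linear_add linear_cmul)
qed

lemma VF_lincomb: assumes X: "X \<in> VF" and V: "V \<in> VF" shows "(\<lambda>x\<in>M. X x + c *\<^sub>R V x) \<in> VF"
proof (rule VFI)
  show "(\<lambda>x\<in>M. X x + c *\<^sub>R V x) x \<in> tangent_space M x" if "x \<in> M" for x
    using tangent_lincomb[OF that VF_tangent[OF X that] VF_tangent[OF V that]] that by simp
  show "C1_on (\<phi> ` (U \<inter> M)) (chart_rep U \<phi> (\<lambda>x\<in>M. X x + c *\<^sub>R V x))" if U: "(U, \<phi>) \<in> \<A>" for U \<phi>
    by (rule C1_on_cong[OF C1_on_add[OF VF_rep[OF X U] C1_on_scale[OF VF_rep[OF V U], of c]]])
      (use rep_lincomb[OF U] in simp)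
qed simp

lemma VF_zero: "(\<lambda>x\<in>M. 0) \<in> VF"
proof (rule VFI)
  show "(\<lambda>x\<in>M. 0) x \<in> tangent_space M x" if x: "x \<in> M" for x
  proof -
    obtain U \<phi> where U: "(U, \<phi>) \<in> \<A>" "x \<in> U" using covered x .
    interpret chart E M U \<phi> by (rule chartI[OF U(1)])
    have "der \<phi> x 0 = 0" using C1_open_linear[OF C1\<phi> U(2)] by (simp add: bounded_linear.linear linear_0)
    then show ?thesis using E x unfolding tangent_space_eq[OF U(2) x] by (simp add: subspace_0)
  qed
  show "C1_on (\<phi> ` (U \<inter> M)) (chart_rep U \<phi> (\<lambda>x\<in>M. 0))" if U: "(U, \<phi>) \<in> \<A>" for U \<phi>
  proof -
    interpret chart E M U \<phi> by (rule chartI[OF U])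
    have z: "chart_rep U \<phi> (\<lambda>x\<in>M. 0) w = 0" if w: "w \<in> \<phi> ` (U \<inter> M)" for w
    proof -
      obtain x where x: "x \<in> U" "x \<in> M" "w = \<phi> x" using w by blast
      show ?thesis using x C1_open_linear[OF C1\<phi> x(1)] by (simp add: chart_rep_image bounded_linear.linear linear_0)
    qed
    have "C1_on (\<phi> ` (U \<inter> M)) (\<lambda>w. 0 :: 'a)"
      unfolding C1_on_def by (intro ballI exI[of _ UNIV] exI[of _ "\<lambda>w. 0"]) (auto intro: C1_open_const)
    then show ?thesis by (rule C1_on_cong) (simp add: z)
  qed
qed simp

lemma VF_continuous: assumes X: "X \<in> VF" shows "continuous_on M X"
  unfolding continuous_on_eq_continuous_within
proof
  fix x assume x: "x \<in> M"
  obtain U \<phi> where U: "(U, \<phi>) \<in> \<A>" "x \<in> U" using covered x .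
  interpret chart E M U \<phi> by (rule chartI[OF U(1)])
  have c\<phi>: "continuous_on (U \<inter> M) \<phi>" using C1_open_continuous[OF C1\<phi>] by (rule continuous_on_subset) simp
  have r: "continuous_on (U \<inter> M) (\<lambda>y. chart_rep U \<phi> X (\<phi> y))"
    by (rule continuous_on_compose2[OF C1_on_continuous[OF VF_rep[OF X U(1)]] c\<phi>]) simp
  have "continuous_on (U \<inter> M) (\<lambda>y. der \<psi> (\<phi> y) (chart_rep U \<phi> X (\<phi> y)))"
    by (rule C1_open_der_continuous2[OF C1\<psi> c\<phi> r]) auto
  then have "continuous_on (U \<inter> M) X"
    by (rule continuous_on_eq) (simp add: chart_rep_image der_inverse)
  then have "continuous (at x within (U \<inter> M)) X" using x U(2) by (simp add: continuous_on_eq_continuous_within)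
  moreover have "at x within (U \<inter> M) = at x within M"
    by (rule at_within_nhd[OF U(2) openU]) blast
  ultimately show "continuous (at x within M) X" by simp
qed

lemma VF_strict_tangency:
  assumes x: "x \<in> M" and u: "u \<in> tangent_space M x" and "e > 0"
  shows "\<exists>d>0. \<forall>y s. y \<in> M \<and> dist y x < d \<and> \<bar>s\<bar> < d \<longrightarrow> (\<exists>z\<in>M. norm (z - y - s *\<^sub>R u) \<le> e * \<bar>s\<bar>)"
proof -
  obtain U \<phi> where U: "(U, \<phi>) \<in> \<A>" "x \<in> U" using covered x .
  interpret chart E M U \<phi> by (rule chartI[OF U(1)])
  have "der \<phi> x u \<in> E" using u tangent_space_eq[OF U(2) x] by blast
  then show ?thesis
    using strict_tangency[OF U(2) x _ assms(3)] by metis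
qed

text \<open>Locally \<open>X y\<close> is close to \<open>X x\<close>, so strict tangency at \<open>x\<close> serves for all nearby \<open>y\<close>; compactness does the rest.\<close>

lemma VF_uniform_tangency:
  assumes X: "X \<in> VF" and "e > 0"
  shows "\<exists>d>0. \<forall>y\<in>M. \<forall>s. \<bar>s\<bar> < d \<longrightarrow> (\<exists>z\<in>M. norm (z - y - s *\<^sub>R X y) \<le> e * \<bar>s\<bar>)"
proof (rule compact_uniform[OF compactM, of "\<lambda>y d. \<forall>s. \<bar>s\<bar> < d \<longrightarrow> (\<exists>z\<in>M. norm (z - y - s *\<^sub>R X y) \<le> e * \<bar>s\<bar>)"])
  fix x assume x: "x \<in> M"
  obtain d1 where d1: "d1 > 0" "\<And>y s. y \<in> M \<Longrightarrow> dist y x < d1 \<Longrightarrow> \<bar>s\<bar> < d1 \<Longrightarrow> \<exists>z\<in>M. norm (z - y - s *\<^sub>R X x) \<le> e/2 * \<bar>s\<bar>"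
    using VF_strict_tangency[OF x VF_tangent[OF X x], of "e/2"] assms(2) by auto
  obtain d2 where d2: "d2 > 0" "\<And>y. y \<in> M \<Longrightarrow> dist y x < d2 \<Longrightarrow> dist (X y) (X x) < e/2"
    using VF_continuous[OF X] x assms(2) unfolding continuous_on_iff by (metis half_gt_zero)
  have "\<exists>z\<in>M. norm (z - y - s *\<^sub>R X y) \<le> e * \<bar>s\<bar>" if y: "y \<in> M" "dist y x < min d1 d2" and s: "\<bar>s\<bar> < min d1 d2" for y s
  proof -
    obtain z where z: "z \<in> M" "norm (z - y - s *\<^sub>R X x) \<le> e/2 * \<bar>s\<bar>" using d1(2)[of y s] y s by auto
    have "norm (X x - X y) \<le> e/2" using d2(2)[of y] y by (simp add: dist_norm norm_minus_commute)
    then have "norm (s *\<^sub>R (X x - X y)) \<le> \<bar>s\<bar> * (e/2)" unfolding norm_scaleR by (rule mult_left_mono) simp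
    moreover have "z - y - s *\<^sub>R X y = (z - y - s *\<^sub>R X x) + s *\<^sub>R (X x - X y)" by (simp add: algebra_simps)
    ultimately have "norm (z - y - s *\<^sub>R X y) \<le> e/2 * \<bar>s\<bar> + \<bar>s\<bar> * (e/2)" using z(2) by (metis norm_triangle_mono)
    then show ?thesis using z(1) by (intro bexI[of _ z]) (auto simp: algebra_simps)
  qed
  then show "\<exists>d>0. \<forall>y\<in>M. dist y x < d \<longrightarrow> (\<forall>s. \<bar>s\<bar> < d \<longrightarrow> (\<exists>z\<in>M. norm (z - y - s *\<^sub>R X y) \<le> e * \<bar>s\<bar>))"
    using d1 d2 by (intro exI[of _ "min d1 d2"]) auto
qed auto

lemma VF_integral_curve:
  assumes X: "X \<in> VF" and "p \<in> M" obtains \<gamma> where "integral_curve M X \<gamma>" "\<gamma> 0 = p"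
  using complete_integral_curve[OF compactM VF_continuous[OF X] assms(2) VF_uniform_tangency[OF X]] by blast

lemma openin_C1_near:
  assumes "X \<in> VF" "(U, \<phi>) \<in> \<A>" "compact K" "K \<subseteq> \<phi> ` (U \<inter> M)" "0 < \<delta>"
  shows "openin T {Y \<in> VF. C1_near E U \<phi> K \<delta> X Y}"
  unfolding C1_topology_def by (rule topology_generated_by_Basis) (use assms in blast)

text \<open>On a compact part of a chart, the field is recovered from its representation by the derivative of
  the inverse chart, whose norm is bounded there.\<close>

lemma C0_neighbourhood:
  assumes Y: "Y \<in> VF" and "\<delta> > 0"
  shows "\<exists>W. openin T W \<and> Y \<in> W \<and> (\<forall>Y'\<in>W. \<forall>x\<in>M. norm (Y' x - Y x) < \<delta>)"
proof -
  have loc: "\<exists>d>0. \<exists>W. openin T W \<and> Y \<in> W \<and> (\<forall>Y'\<in>W. \<forall>x\<in>M. dist x p < d \<longrightarrow> norm (Y' x - Y x) < \<delta>)" if p: "p \<in> M" for p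
  proof -
    obtain U \<phi> where U: "(U, \<phi>) \<in> \<A>" "p \<in> U" using covered p .
    interpret chart E M U \<phi> by (rule chartI[OF U(1)])
    obtain r where r: "r > 0" "cball (\<phi> p) r \<subseteq> \<phi> ` U" using openV U(2) open_contains_cball by blast
    define K where "K = cball (\<phi> p) r \<inter> E"
    have K: "compact K" unfolding K_def by (rule compact_Int_closed[OF compact_cball closed_subspace[OF E]])
    have KU: "K \<subseteq> \<phi> ` (U \<inter> M)" unfolding slice K_def using r by blast
    obtain \<psi>' where \<psi>': "continuous_on (\<phi> ` U) \<psi>'" "\<And>w. w \<in> \<phi> ` U \<Longrightarrow> blinfun_apply (\<psi>' w) = der \<psi> w"
      using C1_openE[OF C1\<psi>] by metis
    have "continuous_on K \<psi>'" by (rule continuous_on_subset[OF \<psi>'(1)]) (use KU in blast)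
    then have "bounded (\<psi>' ` K)" by (rule compact_imp_bounded[OF compact_continuous_image[OF _ K]])
    then obtain B where B: "B > 0" "\<forall>A\<in>\<psi>' ` K. norm A \<le> B" unfolding bounded_pos by blast
    define W where "W = {Y' \<in> VF. C1_near E U \<phi> K (\<delta> / B) Y Y'}"
    have "openin T W" unfolding W_def by (rule openin_C1_near[OF Y U(1) K KU]) (use assms B in simp)
    moreover have "Y \<in> W"
    proof -
      have "\<exists>D. ((\<lambda>u. 0::'a) has_derivative D) (at w within E) \<and> (\<forall>v\<in>E. v \<noteq> 0 \<longrightarrow> norm (D v) < \<delta> / B * norm v)" for w
        using assms(2) B by (intro exI[of _ "\<lambda>v. 0"]) auto
      then show ?thesis unfolding W_def C1_near_def using Y assms(2) B by simp
    qed
    moreover have "isCont \<phi> p" using C1_open_continuous[OF C1\<phi>] openU U(2) by (simp add: continuous_on_eq_continuous_at)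
    then obtain d1 where d1: "d1 > 0" "\<And>x. dist x p < d1 \<Longrightarrow> dist (\<phi> x) (\<phi> p) < r"
      unfolding continuous_at_eps_delta using r(1) by blast
    obtain d2 where d2: "d2 > 0" "ball p d2 \<subseteq> U" using openU U(2) openE by blast
    have "norm (Y' x - Y x) < \<delta>" if Y': "Y' \<in> W" and x: "x \<in> M" "dist x p < min d1 d2" for Y' x
    proof -
      have xU: "x \<in> U" using d2 x by (auto simp: dist_commute)
      have wK: "\<phi> x \<in> K" unfolding K_def using d1(2)[of x] x xU \<phi>_in_E by (simp add: dist_commute less_imp_le)
      have "norm (chart_rep U \<phi> Y' (\<phi> x) - chart_rep U \<phi> Y (\<phi> x)) < \<delta> / B" using Y' wK unfolding W_def C1_near_def by blast
      then have n: "norm (der \<phi> x (Y' x) - der \<phi> x (Y x)) < \<delta> / B" using xU by (simp add: chart_rep_image)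
      have lin: "linear (der \<psi> (\<phi> x))" using C1_open_linear[OF C1\<psi>] xU by (simp add: bounded_linear.linear)
      have "Y' x - Y x = der \<psi> (\<phi> x) (der \<phi> x (Y' x) - der \<phi> x (Y x))" using lin xU by (simp add: linear_diff der_inverse)
      also have "norm \<dots> = norm (blinfun_apply (\<psi>' (\<phi> x)) (der \<phi> x (Y' x) - der \<phi> x (Y x)))" using \<psi>'(2) xU by simp
      also have "\<dots> \<le> norm (\<psi>' (\<phi> x)) * norm (der \<phi> x (Y' x) - der \<phi> x (Y x))" by (rule norm_blinfun)
      also have "\<dots> \<le> B * norm (der \<phi> x (Y' x) - der \<phi> x (Y x))" using B(2) wK by (intro mult_right_mono) auto
      also have "\<dots> < B * (\<delta> / B)" using n B(1) by (intro mult_strict_left_mono) auto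
      finally show ?thesis using B(1) by simp
    qed
    ultimately show ?thesis using d1(1) d2(1) by (intro exI[of _ "min d1 d2"] conjI exI[of _ W]) auto
  qed
  then obtain d W where dW: "\<And>p. p \<in> M \<Longrightarrow> d p > 0" "\<And>p. p \<in> M \<Longrightarrow> openin T (W p) \<and> Y \<in> W p"
    "\<And>p Y' x. p \<in> M \<Longrightarrow> Y' \<in> W p \<Longrightarrow> x \<in> M \<Longrightarrow> dist x p < d p \<Longrightarrow> norm (Y' x - Y x) < \<delta>" by metis
  obtain C where C: "C \<subseteq> M" "finite C" "M \<subseteq> (\<Union>x\<in>C. ball x (d x))"
    by (rule compactE_image[OF compactM, of M "\<lambda>x. ball x (d x)"]) (use dW(1) in force)+
  have "C \<noteq> {}" using C(3) nonempty by auto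
  then have "openin T (\<Inter> (W ` C))" using C dW(2) by (intro openin_Inter) auto
  moreover have "Y \<in> \<Inter> (W ` C)" using C dW(2) by auto
  moreover have "norm (Y' x - Y x) < \<delta>" if "Y' \<in> \<Inter> (W ` C)" "x \<in> M" for Y' x
  proof -
    have "x \<in> (\<Union>x\<in>C. ball x (d x))" using C(3) that(2) by blast
    then obtain p where "p \<in> C" "dist x p < d p" by (auto simp: dist_commute)
    then show ?thesis using dW(3)[of p Y' x] C(1) that by auto
  qed
  ultimately show ?thesis by blast
qed

end

section \<open>Small perturbations in the C1 topology\<close>

lemma subspace_projection:
  fixes E :: "'a::euclidean_space set"
  assumes "subspace E"
  shows "\<exists>\<pi>. linear \<pi> \<and> (\<forall>x. \<pi> x \<in> E) \<and> (\<forall>x\<in>E. \<pi> x = x)"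
proof -
  have "\<exists>g. g ` UNIV \<subseteq> E \<and> linear g \<and> (\<forall>v\<in>E. g (id v) = v)"
    by (rule linear_exists_left_inverse_on[OF linear_id assms]) simp
  then show ?thesis by (auto simp: image_subset_iff)
qed

lemma C1_open_bounded_linear: assumes "bounded_linear f" shows "C1_open UNIV f"
  by (rule C1_openI[where g' = "\<lambda>_. Blinfun f"])
    (use assms in \<open>auto simp: bounded_linear_Blinfun_apply intro: bounded_linear_imp_has_derivative\<close>)

context chart
begin

text \<open>Composition with a projection \<open>\<pi>\<close> onto \<open>E\<close> turns the many local extensions of a C1 map on a slice into one
  C1 map on an open set.  Its derivative is a canonical choice of the derivative along \<open>E\<close>,
  and it depends continuously on the point.\<close>

lemma C1_on_slice_extend:
  assumes f: "C1_on (\<phi> ` (U \<inter> M)) f" and \<pi>: "linear \<pi>" "\<And>x. \<pi> x \<in> E"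
  shows "C1_open (\<pi> -` (\<phi> ` U)) (\<lambda>w. f (\<pi> w))"
proof (rule C1_on_open)
  have bl: "bounded_linear \<pi>" using \<pi>(1) by (rule linear_conv_bounded_linear[THEN iffD1])
  show op: "open (\<pi> -` (\<phi> ` U))"
    by (rule open_vimage[OF openV linear_continuous_on[OF bl]])
  show "C1_on (\<pi> -` (\<phi> ` U)) (\<lambda>w. f (\<pi> w))"
    unfolding C1_on_def
  proof
    fix w assume "w \<in> \<pi> -` (\<phi> ` U)"
    then have "\<pi> w \<in> \<phi> ` (U \<inter> M)" unfolding slice using \<pi>(2) by blast
    then obtain V g where V: "\<pi> w \<in> V" "C1_open V g" "\<forall>y\<in>V \<inter> \<phi> ` (U \<inter> M). g y = f y"
      using f unfolding C1_on_def by blast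
    have "C1_open (UNIV \<inter> \<pi> -` V) (\<lambda>w. g (\<pi> w))"
      by (rule C1_open_compose[OF C1_open_bounded_linear[OF bl] V(2)])
    moreover have "\<forall>y\<in>(UNIV \<inter> \<pi> -` V) \<inter> \<pi> -` (\<phi> ` U). g (\<pi> y) = f (\<pi> y)"
    proof
      fix y assume "y \<in> (UNIV \<inter> \<pi> -` V) \<inter> \<pi> -` (\<phi> ` U)"
      then have "\<pi> y \<in> V" "\<pi> y \<in> \<phi> ` (U \<inter> M)" unfolding slice using \<pi>(2) by auto
      then show "g (\<pi> y) = f (\<pi> y)" using V(3) by blast
    qed
    ultimately show "\<exists>W g. w \<in> W \<and> C1_open W g \<and> (\<forall>y\<in>W \<inter> \<pi> -` (\<phi> ` U). g y = f (\<pi> y))"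
      using V(1) by (intro exI[of _ "UNIV \<inter> \<pi> -` V"] exI[of _ "\<lambda>w. g (\<pi> w)"]) auto
  qed
qed

lemma slice_derivative:
  assumes f: "C1_on (\<phi> ` (U \<inter> M)) f" and \<pi>: "linear \<pi>" "\<And>x. \<pi> x \<in> E" "\<And>x. x \<in> E \<Longrightarrow> \<pi> x = x"
    and w: "w \<in> \<phi> ` (U \<inter> M)"
  shows "(f has_derivative der (\<lambda>w. f (\<pi> w)) w) (at w within E)"
    and "(f has_derivative D) (at w within E) \<Longrightarrow> v \<in> E \<Longrightarrow> D v = der (\<lambda>w. f (\<pi> w)) w v"
proof -
  have wE: "w \<in> E" and wU: "w \<in> \<phi> ` U" using w unfolding slice by auto
  have d: "((\<lambda>w. f (\<pi> w)) has_derivative der (\<lambda>w. f (\<pi> w)) w) (at w)"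
    by (rule C1_open_has_derivative[OF C1_on_slice_extend[OF f \<pi>(1,2)]]) (use wE wU \<pi>(3) in simp)
  show "(f has_derivative der (\<lambda>w. f (\<pi> w)) w) (at w within E)"
    by (rule has_derivative_transform[OF wE _ has_derivative_at_withinI[OF d]]) (use \<pi>(3) in simp)
  assume D: "(f has_derivative D) (at w within E)" and v: "v \<in> E"
  have bl: "bounded_linear \<pi>" using \<pi>(1) by (rule linear_conv_bounded_linear[THEN iffD1])
  have 1: "(\<pi> has_derivative \<pi>) (at w)" by (rule bounded_linear_imp_has_derivative[OF bl])
  have 2: "(f has_derivative D) (at (\<pi> w) within range \<pi>)"
    using has_derivative_subset[OF D, of "range \<pi>"] \<pi>(2,3) wE by auto
  have "((\<lambda>w. f (\<pi> w)) has_derivative (\<lambda>h. D (\<pi> h))) (at w)" by (rule has_derivative_in_compose[OF 1 2])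
  then have "(\<lambda>h. D (\<pi> h)) = der (\<lambda>w. f (\<pi> w)) w" using d by (rule has_derivative_unique)
  then show "D v = der (\<lambda>w. f (\<pi> w)) w v" using \<pi>(3)[OF v] by metis
qed

end

context atlas_manifold
begin

text \<open>The values and the derivatives along unit vectors of \<open>E\<close> are continuous functions on
  compact sets, so the strict inequalities of closeness persist.\<close>

lemma perturbation_near:
  assumes U: "(U, \<phi>) \<in> \<A>" and K: "compact K" "K \<subseteq> \<phi> ` (U \<inter> M)" and X0: "X0 \<in> VF" and X: "X \<in> VF" and V: "V \<in> VF"
    and near: "C1_near E U \<phi> K \<delta> X0 X"
  shows "\<exists>\<eta>0>0. \<forall>\<eta>. 0 < \<eta> \<and> \<eta> < \<eta>0 \<longrightarrow> C1_near E U \<phi> K \<delta> X0 (\<lambda>x\<in>M. X x + \<eta> *\<^sub>R V x)"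
proof -
  interpret chart E M U \<phi> by (rule chartI[OF U])
  obtain \<pi> where \<pi>: "linear \<pi>" "\<And>x. \<pi> x \<in> E" "\<And>x. x \<in> E \<Longrightarrow> \<pi> x = x" using subspace_projection[OF E] by blast
  define a where "a = (\<lambda>w. chart_rep U \<phi> X w - chart_rep U \<phi> X0 w)"
  define b where "b = chart_rep U \<phi> V"
  have ca: "C1_on (\<phi> ` (U \<inter> M)) a" unfolding a_def
    by (rule C1_on_cong[OF C1_on_add[OF VF_rep[OF X U] C1_on_scale[OF VF_rep[OF X0 U], of "-1"]]]) simp
  have cb: "C1_on (\<phi> ` (U \<inter> M)) b" unfolding b_def by (rule VF_rep[OF V U])
  define A where "A = (\<lambda>w. der (\<lambda>w. a (\<pi> w)) w)"
  define B where "B = (\<lambda>w. der (\<lambda>w. b (\<pi> w)) w)"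
  have KE: "w \<in> E" "w \<in> \<phi> ` U" if "w \<in> K" for w using K(2) that unfolding slice by auto
  have sub: "K \<subseteq> \<pi> -` (\<phi> ` U)" using KE \<pi>(3) by auto
  note oa = C1_on_slice_extend[OF ca \<pi>(1,2)] and ob = C1_on_slice_extend[OF cb \<pi>(1,2)]
  have nearD: "norm (a w) < \<delta>" "\<exists>D. (a has_derivative D) (at w within E) \<and> (\<forall>v\<in>E. v \<noteq> 0 \<longrightarrow> norm (D v) < \<delta> * norm v)" if "w \<in> K" for w
    using near that unfolding C1_near_def a_def by auto
  obtain \<eta>1 where \<eta>1: "\<eta>1 > 0" "\<And>\<eta> w. 0 < \<eta> \<Longrightarrow> \<eta> < \<eta>1 \<Longrightarrow> w \<in> K \<Longrightarrow> norm (a w + \<eta> *\<^sub>R b w) < \<delta>"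
    using small_perturbation_gap[OF K(1) continuous_on_subset[OF C1_on_continuous[OF ca] K(2)]
        continuous_on_subset[OF C1_on_continuous[OF cb] K(2)] nearD(1)] by blast
  define S where "S = K \<times> (sphere (0::'a) 1 \<inter> E)"
  have S: "compact S" unfolding S_def by (intro compact_Times K compact_Int_closed compact_sphere closed_subspace E)
  have contA: "continuous_on S (\<lambda>p. A (fst p) (snd p))" unfolding A_def
    by (rule C1_open_der_continuous2[OF oa]) (use sub in \<open>auto simp: S_def intro!: continuous_intros\<close>)
  have contB: "continuous_on S (\<lambda>p. B (fst p) (snd p))" unfolding B_def
    by (rule C1_open_der_continuous2[OF ob]) (use sub in \<open>auto simp: S_def intro!: continuous_intros\<close>)
  have Alt: "norm (A (fst p) (snd p)) < \<delta>" if p: "p \<in> S" for p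
  proof -
    have w: "fst p \<in> K" "snd p \<in> E" "norm (snd p) = 1" using p by (auto simp: S_def)
    obtain D where D: "(a has_derivative D) (at (fst p) within E)" "\<forall>v\<in>E. v \<noteq> 0 \<longrightarrow> norm (D v) < \<delta> * norm v"
      using nearD(2)[OF w(1)] by blast
    have "D (snd p) = A (fst p) (snd p)" unfolding A_def
      by (rule slice_derivative(2)[OF ca \<pi> subsetD[OF K(2) w(1)] D(1) w(2)])
    moreover have "snd p \<noteq> 0" using w(3) by auto
    ultimately show ?thesis using D(2) w by (metis mult.right_neutral)
  qed
  obtain \<eta>2 where \<eta>2: "\<eta>2 > 0" "\<And>\<eta> p. 0 < \<eta> \<Longrightarrow> \<eta> < \<eta>2 \<Longrightarrow> p \<in> S \<Longrightarrow> norm (A (fst p) (snd p) + \<eta> *\<^sub>R B (fst p) (snd p)) < \<delta>"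
    using small_perturbation_gap[OF S contA contB Alt] by blast
  have "C1_near E U \<phi> K \<delta> X0 (\<lambda>x\<in>M. X x + \<eta> *\<^sub>R V x)" if \<eta>: "0 < \<eta>" "\<eta> < min \<eta>1 \<eta>2" for \<eta>
    unfolding C1_near_def
  proof (intro ballI conjI)
    fix w assume w: "w \<in> K"
    let ?f = "\<lambda>u. chart_rep U \<phi> (\<lambda>x\<in>M. X x + \<eta> *\<^sub>R V x) u - chart_rep U \<phi> X0 u"
    have wS: "w \<in> \<phi> ` (U \<inter> M)" using w K(2) by blast
    have feq: "?f u = a u + \<eta> *\<^sub>R b u" if "u \<in> \<phi> ` (U \<inter> M)" for u
      using rep_lincomb[OF U that] by (simp add: a_def b_def)
    show "norm (?f w) < \<delta>" unfolding feq[OF wS] using \<eta>1(2) \<eta> w by simp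
    obtain d where d: "d > 0" "ball w d \<subseteq> \<phi> ` U" using openV KE(2)[OF w] openE by blast
    have "((\<lambda>u. a u + \<eta> *\<^sub>R b u) has_derivative (\<lambda>v. A w v + \<eta> *\<^sub>R B w v)) (at w within E)"
      unfolding A_def B_def by (intro has_derivative_add has_derivative_scaleR_right slice_derivative(1) ca cb \<pi> wS)
    then have D: "(?f has_derivative (\<lambda>v. A w v + \<eta> *\<^sub>R B w v)) (at w within E)"
    proof (rule has_derivative_transform_within[OF _ d(1) KE(1)[OF w]])
      fix u assume "u \<in> E" "dist u w < d"
      then have "u \<in> \<phi> ` (U \<inter> M)" unfolding slice using d(2) by (auto simp: dist_commute)
      then show "a u + \<eta> *\<^sub>R b u = ?f u" using feq by simp
    qed
    have lin: "linear (\<lambda>v. A w v + \<eta> *\<^sub>R B w v)" using D by (rule has_derivative_linear)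
    have "norm (A w v + \<eta> *\<^sub>R B w v) < \<delta> * norm v" if v: "v \<in> E" "v \<noteq> 0" for v
    proof -
      have "(w, (1 / norm v) *\<^sub>R v) \<in> S" unfolding S_def using w v E by (simp add: subspace_scale)
      then have "norm (A w ((1 / norm v) *\<^sub>R v) + \<eta> *\<^sub>R B w ((1 / norm v) *\<^sub>R v)) < \<delta>" using \<eta>2(2)[of \<eta>] \<eta> by force
      also have "A w ((1 / norm v) *\<^sub>R v) + \<eta> *\<^sub>R B w ((1 / norm v) *\<^sub>R v) = (1 / norm v) *\<^sub>R (A w v + \<eta> *\<^sub>R B w v)"
        using linear_cmul[OF lin] by blast
      also have "norm ((1 / norm v) *\<^sub>R (A w v + \<eta> *\<^sub>R B w v)) = norm (A w v + \<eta> *\<^sub>R B w v) / norm v"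
        unfolding norm_scaleR by simp
      finally have "norm (A w v + \<eta> *\<^sub>R B w v) / norm v < \<delta>" .
      moreover have "norm v > 0" using v(2) by simp
      ultimately show ?thesis using pos_divide_less_eq[of "norm v"] by blast
    qed
    then show "\<exists>D. (?f has_derivative D) (at w within E) \<and> (\<forall>v\<in>E. v \<noteq> 0 \<longrightarrow> norm (D v) < \<delta> * norm v)"
      using D by (intro exI[of _ "\<lambda>v. A w v + \<eta> *\<^sub>R B w v"]) simp
  qed
  then show ?thesis using \<eta>1(1) \<eta>2(1) by (intro exI[of _ "min \<eta>1 \<eta>2"]) auto
qed

text \<open>\<open>X + \<eta> V\<close> tends to \<open>X\<close> in the C1 topology as \<open>\<eta>\<close> tends to 0.  It is enough to check this on the generating sets, which
  need not be centred at \<open>X\<close>.\<close>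

lemma perturbation_in_open:
  assumes W: "openin T W" and "X \<in> W" and X: "X \<in> VF" and V: "V \<in> VF"
  shows "\<exists>\<eta>0>0. \<forall>\<eta>. 0 < \<eta> \<and> \<eta> < \<eta>0 \<longrightarrow> (\<lambda>x\<in>M. X x + \<eta> *\<^sub>R V x) \<in> W"
proof -
  have "X \<in> W \<longrightarrow> (\<exists>\<eta>0>0. \<forall>\<eta>. 0 < \<eta> \<and> \<eta> < \<eta>0 \<longrightarrow> (\<lambda>x\<in>M. X x + \<eta> *\<^sub>R V x) \<in> W)"
    using W unfolding C1_topology_def openin_topology_generated_by_iff
  proof (induction rule: generate_topology_on.induct)
    case (Int P Q)
    show ?case
    proof
      assume "X \<in> P \<inter> Q"
      then obtain e1 e2 where "e1 > 0" "\<forall>\<eta>. 0 < \<eta> \<and> \<eta> < e1 \<longrightarrow> (\<lambda>x\<in>M. X x + \<eta> *\<^sub>R V x) \<in> P"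
        "e2 > 0" "\<forall>\<eta>. 0 < \<eta> \<and> \<eta> < e2 \<longrightarrow> (\<lambda>x\<in>M. X x + \<eta> *\<^sub>R V x) \<in> Q" using Int.IH by blast
      then show "\<exists>\<eta>0>0. \<forall>\<eta>. 0 < \<eta> \<and> \<eta> < \<eta>0 \<longrightarrow> (\<lambda>x\<in>M. X x + \<eta> *\<^sub>R V x) \<in> P \<inter> Q"
        by (intro exI[of _ "min e1 e2"]) auto
    qed
  next
    case (UN \<K>)
    show ?case
    proof
      assume "X \<in> \<Union>\<K>"
      then obtain P where P: "P \<in> \<K>" "X \<in> P" by blast
      then obtain \<eta>0 where "\<eta>0 > 0" "\<forall>\<eta>. 0 < \<eta> \<and> \<eta> < \<eta>0 \<longrightarrow> (\<lambda>x\<in>M. X x + \<eta> *\<^sub>R V x) \<in> P" using UN.IH by blast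
      then show "\<exists>\<eta>0>0. \<forall>\<eta>. 0 < \<eta> \<and> \<eta> < \<eta>0 \<longrightarrow> (\<lambda>x\<in>M. X x + \<eta> *\<^sub>R V x) \<in> \<Union>\<K>" using P(1) by blast
    qed
  next
    case (Basis P)
    then obtain X0 U \<phi> K \<delta> where P: "P = {Y \<in> VF. C1_near E U \<phi> K \<delta> X0 Y}"
      "X0 \<in> VF" "(U, \<phi>) \<in> \<A>" "compact K" "K \<subseteq> \<phi> ` (U \<inter> M)" "0 < \<delta>" by auto
    show ?case
    proof
      assume "X \<in> P"
      then have "C1_near E U \<phi> K \<delta> X0 X" unfolding P(1) by simp
      from perturbation_near[OF P(3-5,2) X V this]
      show "\<exists>\<eta>0>0. \<forall>\<eta>. 0 < \<eta> \<and> \<eta> < \<eta>0 \<longrightarrow> (\<lambda>x\<in>M. X x + \<eta> *\<^sub>R V x) \<in> P"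
        unfolding P(1) using VF_lincomb[OF X V] by simp
    qed
  qed simp
  then show ?thesis using assms(2) by blast
qed

end

section \<open>Fields with small support\<close>

text \<open>The square makes the positive part continuously differentiable.\<close>

lemma C1_bump:
  fixes w0 :: "'a::euclidean_space"
  shows "C1_open UNIV (\<lambda>w. (max 0 (r\<^sup>2 - (w - w0) \<bullet> (w - w0)))\<^sup>2)"
proof -
  have m: "((\<lambda>t::real. (max 0 t)\<^sup>2) has_real_derivative 2 * max 0 t) (at t)" for t
  proof (cases "t = 0")
    case False
    show ?thesis
    proof (cases "t > 0")
      case True
      have "((\<lambda>t::real. t\<^sup>2) has_real_derivative 2 * max 0 t) (at t)" using True by (auto intro!: derivative_eq_intros)
      then show ?thesis by (rule DERIV_cong_ev[THEN iffD1, rotated -1]) (use True eventually_gt_at_top in \<open>auto simp: eventually_nhds intro!: exI[of _ "{0<..}"]\<close>)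
    next
      case neg: False
      then have t: "t < 0" using False by simp
      have "((\<lambda>t::real. 0) has_real_derivative 2 * max 0 t) (at t)" using t by (auto intro!: derivative_eq_intros)
      then show ?thesis by (rule DERIV_cong_ev[THEN iffD1, rotated -1]) (use t in \<open>auto simp: eventually_nhds intro!: exI[of _ "{..<0}"]\<close>)
    qed
  next
    case True
    have "((\<lambda>h::real. (max 0 (0 + h))\<^sup>2 / h) \<longlongrightarrow> 0) (at 0)"
    proof (rule Lim_null_comparison[of _ "\<lambda>h. \<bar>h\<bar>"])
      show "\<forall>\<^sub>F h::real in at 0. norm ((max 0 (0 + h))\<^sup>2 / h) \<le> \<bar>h\<bar>"
        by (rule always_eventually) (auto simp: power2_eq_square max_def)
      show "((\<lambda>h::real. \<bar>h\<bar>) \<longlongrightarrow> 0) (at 0)" by (rule tendsto_rabs_zero[OF tendsto_ident_at])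
    qed
    then show ?thesis using True unfolding DERIV_def by simp
  qed
  define q where "q = (\<lambda>w::'a. r\<^sup>2 - (w - w0) \<bullet> (w - w0))"
  have q: "(q has_derivative (\<lambda>h. - 2 * ((w - w0) \<bullet> h))) (at w)" for w
    unfolding q_def by (auto intro!: derivative_eq_intros simp: inner_commute)
  have "C1_open UNIV (\<lambda>w. (max 0 (q w))\<^sup>2)"
  proof (rule C1_openI[where g' = "\<lambda>w. (2 * max 0 (q w) * - 2) *\<^sub>R blinfun_inner_left (w - w0)"])
    fix w :: 'a
    have "((\<lambda>w. (max 0 (q w))\<^sup>2) has_derivative (\<lambda>h. (- 2 * ((w - w0) \<bullet> h)) * (2 * max 0 (q w)))) (at w)"
      using has_derivative_compose[OF q[of w] m[of "q w", unfolded has_field_derivative_def]]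
      by (simp add: mult.commute)
    moreover have "(\<lambda>h. (- 2 * ((w - w0) \<bullet> h)) * (2 * max 0 (q w))) = blinfun_apply ((2 * max 0 (q w) * - 2) *\<^sub>R blinfun_inner_left (w - w0))"
      by (rule ext) (simp add: blinfun.scaleR_left blinfun.minus_left inner_commute)
    ultimately show "((\<lambda>w. (max 0 (q w))\<^sup>2) has_derivative blinfun_apply ((2 * max 0 (q w) * - 2) *\<^sub>R blinfun_inner_left (w - w0))) (at w)" by simp
  next
    have "continuous_on UNIV q" unfolding q_def by (intro continuous_intros)
    then show "continuous_on UNIV (\<lambda>w. (2 * max 0 (q w) * - 2) *\<^sub>R blinfun_inner_left (w - w0))"
      by (intro continuous_intros bounded_linear.continuous_on[OF bounded_linear_blinfun_inner_left])
  qed simp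
  then show ?thesis unfolding q_def .
qed

context atlas_manifold
begin

text \<open>In a chart at \<open>x0\<close>, take a constant vector of \<open>E\<close> times a bump function; \<open>b\<close> is the bump and \<open>u'\<close> the
  pulled back constant field.  In any other chart the representation of this field is the bump times the
  derivative of the transition map along that vector, which is C1 because transition maps are C2.\<close>

lemma bump_field:
  assumes x0: "x0 \<in> M" and u: "u \<in> tangent_space M x0" and "\<epsilon> > 0"
  shows "\<exists>V\<in>VF. \<exists>b u'. \<exists>c>0. \<exists>d>0. (\<forall>x\<in>M. V x = b x *\<^sub>R u' x \<and> 0 \<le> b x \<and>
     (0 < b x \<longrightarrow> dist x x0 < \<epsilon> \<and> norm (u' x - u) < \<epsilon>) \<and> (dist x x0 < d \<longrightarrow> c \<le> b x))"
proof -
  obtain U \<phi> where U: "(U, \<phi>) \<in> \<A>" "x0 \<in> U" using covered x0 .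
  interpret chart E M U \<phi> by (rule chartI[OF U(1)])
  define w0 where "w0 = \<phi> x0"
  define e where "e = der \<phi> x0 u"
  have eE: "e \<in> E" using u tangent_space_eq[OF U(2) x0] by (simp add: e_def)
  have w0: "w0 \<in> \<phi> ` U" using U(2) by (simp add: w0_def)
  have "isCont \<psi> w0" using C1_open_continuous[OF C1\<psi>] w0 unfolding continuous_on_eq_continuous_at[OF openV] by blast
  then obtain r1 where r1: "r1 > 0" "\<And>w. dist w w0 < r1 \<Longrightarrow> dist (\<psi> w) x0 < \<epsilon>"
    unfolding continuous_at_eps_delta using assms(3) \<psi>\<phi>[OF U(2)] unfolding w0_def by metis
  have "isCont (\<lambda>w. der \<psi> w e) w0" using C1_open_der_continuous[OF C1\<psi>] w0 unfolding continuous_on_eq_continuous_at[OF openV] by blast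
  moreover have "der \<psi> w0 e = u" using der_inverse(1)[OF U(2)] by (simp add: w0_def e_def)
  ultimately obtain r2 where r2: "r2 > 0" "\<And>w. dist w w0 < r2 \<Longrightarrow> dist (der \<psi> w e) u < \<epsilon>"
    unfolding continuous_at_eps_delta using assms(3) by metis
  obtain r3 where r3: "r3 > 0" "cball w0 r3 \<subseteq> \<phi> ` U" using openV w0 open_contains_cball by blast
  define r where "r = min (min r1 r2) r3"
  have r: "r > 0" "r \<le> r1" "r \<le> r2" "r \<le> r3" using r1 r2 r3 by (auto simp: r_def)
  have cb: "cball w0 r \<subseteq> \<phi> ` U" using r3(2) r(4) by auto
  define \<beta> where "\<beta> = (\<lambda>w. (max 0 (r\<^sup>2 - (w - w0) \<bullet> (w - w0)))\<^sup>2)"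
  have C1\<beta>: "C1_open UNIV \<beta>" unfolding \<beta>_def by (rule C1_bump)
  have \<beta>0: "\<beta> w \<ge> 0" for w by (simp add: \<beta>_def)
  have \<beta>pos: "\<beta> w > 0 \<longleftrightarrow> dist w w0 < r" for w
  proof -
    have "\<beta> w > 0 \<longleftrightarrow> (norm (w - w0))\<^sup>2 < r\<^sup>2"
      unfolding \<beta>_def by (auto simp: max_def power2_norm_eq_inner)
    also have "\<dots> \<longleftrightarrow> dist w w0 < r"
      unfolding dist_norm using r(1) power2_less_imp_less[of "norm (w - w0)" r] power_strict_mono[of "norm (w - w0)" r 2] by auto
    finally show ?thesis .
  qed
  define V where "V = (\<lambda>x\<in>M. if x \<in> U then \<beta> (\<phi> x) *\<^sub>R der \<psi> (\<phi> x) e else 0)"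
  have zero_tangent: "0 \<in> tangent_space M x" if "x \<in> M" for x
    using VF_tangent[OF VF_zero that] that by simp
  have tan: "der \<psi> (\<phi> x) e \<in> tangent_space M x" if "x \<in> M" "x \<in> U" for x
    unfolding tangent_space_eq[OF that(2,1)] using der_inverse(2)[OF that(2)] eE by simp
  have V_VF: "V \<in> VF"
  proof (rule VFI)
    show "V \<in> extensional M" by (simp add: V_def)
    show "V x \<in> tangent_space M x" if x: "x \<in> M" for x
      using tangent_lincomb[OF x zero_tangent[OF x] tan[OF x]] zero_tangent[OF x] x by (simp add: V_def)
    fix U' \<phi>' assume U': "(U', \<phi>') \<in> \<A>"
    interpret c': chart E M U' \<phi>' by (rule chartI[OF U'])
    define S where "S = \<psi> ` cball w0 r"
    have "compact S" unfolding S_def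
      by (rule compact_continuous_image[OF continuous_on_subset[OF C1_open_continuous[OF C1\<psi>] cb] compact_cball])
    then have closedS: "closed S" by (rule compact_imp_closed)
    show "C1_on (\<phi>' ` (U' \<inter> M)) (chart_rep U' \<phi>' V)"
      unfolding C1_on_def
    proof
      fix w' assume "w' \<in> \<phi>' ` (U' \<inter> M)"
      then obtain x where x: "x \<in> U'" "x \<in> M" "w' = \<phi>' x" by blast
      show "\<exists>W g. w' \<in> W \<and> C1_open W g \<and> (\<forall>y\<in>W \<inter> \<phi>' ` (U' \<inter> M). g y = chart_rep U' \<phi>' V y)"
      proof (cases "x \<in> U")
        case False
        \<comment> \<open>outside the chart domain of the bump the field vanishes near \<open>x\<close>, as its support \<open>S\<close> is closed\<close>
        define W where "W = \<phi>' ` U' \<inter> c'.\<psi> -` (- S)"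
        have oW: "open W" unfolding W_def
          by (rule continuous_open_preimage[OF C1_open_continuous[OF c'.C1\<psi>] c'.openV]) (use closedS in blast)
        have "x \<notin> S" using False cb \<psi>_in unfolding S_def by blast
        then have wW: "w' \<in> W" unfolding W_def using x by (simp add: c'.\<psi>\<phi>)
        have "0 = chart_rep U' \<phi>' V y" if y: "y \<in> W \<inter> \<phi>' ` (U' \<inter> M)" for y
        proof -
          obtain z where z: "z \<in> U'" "z \<in> M" "y = \<phi>' z" using y by blast
          have "z \<notin> S" using y z unfolding W_def by (simp add: c'.\<psi>\<phi>)
          have "V z = 0"
          proof (cases "z \<in> U")
            case zU: True
            have "\<phi> z \<notin> cball w0 r"
            proof
              assume "\<phi> z \<in> cball w0 r"
              then have "\<psi> (\<phi> z) \<in> S" unfolding S_def by blast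
              then show False using \<open>z \<notin> S\<close> \<psi>\<phi>[OF zU] by simp
            qed
            then have "\<not> \<beta> (\<phi> z) > 0" unfolding \<beta>pos by (simp add: dist_commute)
            then have "\<beta> (\<phi> z) = 0" using \<beta>0[of "\<phi> z"] by simp
            then show ?thesis using z by (simp add: V_def)
          qed (use z in \<open>simp add: V_def\<close>)
          then show ?thesis using z C1_open_linear[OF c'.C1\<phi> z(1)] by (simp add: c'.chart_rep_image bounded_linear.linear linear_0)
        qed
        then show ?thesis using wW C1_open_const[OF oW] by (intro exI[of _ W] exI[of _ "\<lambda>y. 0"]) simp
      next
        case xU: True
        have "\<phi> x \<in> \<phi> ` (U \<inter> U' \<inter> M)" using x xU by blast
        then obtain Q g where Q: "\<phi> x \<in> Q" "C2_open Q g" "\<forall>y\<in>Q \<inter> \<phi> ` (U \<inter> U' \<inter> M). g y = (\<phi>' \<circ> \<psi>) y"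
          using transition[OF U(1) U'] unfolding C2_on_def by blast
        obtain g' where oQ: "open Q" and g': "\<And>x. x \<in> Q \<Longrightarrow> (g has_derivative blinfun_apply (g' x)) (at x)" "C1_open Q g'"
          using Q(2) unfolding C2_open_def by blast
        define Z where "Z = \<phi> ` U \<inter> \<psi> -` U'"
        have oZ: "open Z" unfolding Z_def
          by (rule continuous_open_preimage[OF C1_open_continuous[OF C1\<psi>] openV c'.openU])
        \<comment> \<open>the extension \<open>g\<close> agrees with the transition map on \<open>E\<close>, hence has the same derivative in the direction \<open>e\<close> of \<open>E\<close>\<close>
        have key: "der \<phi>' z (der \<psi> (\<phi> z) e) = blinfun_apply (g' (\<phi> z)) e" if z: "z \<in> U" "z \<in> U'" "z \<in> M" "\<phi> z \<in> Q" for z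
        proof -
          have zZ: "\<phi> z \<in> Z \<inter> Q" using z by (simp add: Z_def \<psi>\<phi>)
          obtain d where d: "d > 0" "ball (\<phi> z) d \<subseteq> Z \<inter> Q" using zZ open_Int[OF oZ oQ] openE by blast
          have line: "((\<lambda>s. \<phi> z + s *\<^sub>R e) has_derivative (\<lambda>h. h *\<^sub>R e)) (at 0)"
            by (auto intro!: derivative_eq_intros)
          have 1: "(\<psi> has_derivative der \<psi> (\<phi> z)) (at (\<phi> z + 0 *\<^sub>R e))"
            using C1_open_has_derivative[OF C1\<psi>] z by simp
          have 2: "(\<phi>' has_derivative der \<phi>' z) (at (\<psi> (\<phi> z + 0 *\<^sub>R e)))"
            using C1_open_has_derivative[OF c'.C1\<phi>] z by (simp add: \<psi>\<phi>)
          have 3: "((\<lambda>s. \<phi>' (\<psi> (\<phi> z + s *\<^sub>R e))) has_derivative (\<lambda>h. der \<phi>' z (der \<psi> (\<phi> z) (h *\<^sub>R e)))) (at 0)"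
            by (rule has_derivative_compose[OF has_derivative_compose[OF line 1] 2])
          have 4: "(g has_derivative blinfun_apply (g' (\<phi> z))) (at (\<phi> z + 0 *\<^sub>R e))" using g'(1)[OF z(4)] by simp
          have 5: "((\<lambda>s. g (\<phi> z + s *\<^sub>R e)) has_derivative (\<lambda>h. blinfun_apply (g' (\<phi> z)) (h *\<^sub>R e))) (at 0)"
            by (rule has_derivative_compose[OF line 4])
          have pos: "norm e + 1 > 0" by (intro add_nonneg_pos) auto
          have eq: "g (\<phi> z + s *\<^sub>R e) = \<phi>' (\<psi> (\<phi> z + s *\<^sub>R e))" if "dist s 0 < d / (norm e + 1)" for s
          proof -
            have "\<bar>s\<bar> * (norm e + 1) < d" using that pos by (simp add: pos_less_divide_eq)
            moreover have "norm (s *\<^sub>R e) \<le> \<bar>s\<bar> * (norm e + 1)" by (simp add: mult_left_mono)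
            ultimately have "norm (s *\<^sub>R e) < d" by linarith
            then have "\<phi> z + s *\<^sub>R e \<in> ball (\<phi> z) d" by (simp add: dist_norm)
            then have in_ZQ: "\<phi> z + s *\<^sub>R e \<in> Z" "\<phi> z + s *\<^sub>R e \<in> Q" using d(2) by auto
            have inE: "\<phi> z + s *\<^sub>R e \<in> E" using E eE \<phi>_in_E[OF z(1)] z(3) by (simp add: subspace_add subspace_scale)
            have "\<phi> z + s *\<^sub>R e \<in> \<phi> ` (U \<inter> U' \<inter> M)"
            proof (rule image_eqI)
              show "\<phi> z + s *\<^sub>R e = \<phi> (\<psi> (\<phi> z + s *\<^sub>R e))" using in_ZQ(1) \<phi>\<psi> unfolding Z_def by simp
              show "\<psi> (\<phi> z + s *\<^sub>R e) \<in> U \<inter> U' \<inter> M" using in_ZQ(1) \<psi>_in \<psi>_in_M inE unfolding Z_def by blast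
            qed
            then show ?thesis using Q(3) in_ZQ(2) by simp
          qed
          have "((\<lambda>s. \<phi>' (\<psi> (\<phi> z + s *\<^sub>R e))) has_derivative (\<lambda>h. blinfun_apply (g' (\<phi> z)) (h *\<^sub>R e))) (at 0)"
            by (rule has_derivative_transform_within[OF 5, of "d / (norm e + 1)"]) (use d(1) pos eq in auto)
          from has_derivative_unique[OF 3 this] have "der \<phi>' z (der \<psi> (\<phi> z) (1 *\<^sub>R e)) = blinfun_apply (g' (\<phi> z)) (1 *\<^sub>R e)" by metis
          then show ?thesis by simp
        qed
        define Y where "Y = \<phi>' ` U' \<inter> c'.\<psi> -` U"
        have C\<tau>: "C1_open Y (\<lambda>y. \<phi> (c'.\<psi> y))" unfolding Y_def by (rule C1_open_compose[OF c'.C1\<psi> C1\<phi>])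
        define W where "W = Y \<inter> (\<lambda>y. \<phi> (c'.\<psi> y)) -` Q"
        have oW: "open W" unfolding W_def
          by (rule continuous_open_preimage[OF C1_open_continuous[OF C\<tau>] _ oQ]) (use C\<tau> in \<open>simp add: C1_open_def\<close>)
        have "C1_open W (\<lambda>y. g' (\<phi> (c'.\<psi> y)))" unfolding W_def by (rule C1_open_compose[OF C\<tau> g'(2)])
        then have A: "C1_open W (\<lambda>y. blinfun_apply (g' (\<phi> (c'.\<psi> y))) e)" by (rule C1_open_blinfun_apply)
        have B: "C1_open W (\<lambda>y. \<beta> (\<phi> (c'.\<psi> y)))"
          using C1_open_subset[OF C1_open_compose[OF C\<tau> C1\<beta>] oW] by (auto simp: W_def)
        have C: "C1_open W (\<lambda>y. \<beta> (\<phi> (c'.\<psi> y)) *\<^sub>R blinfun_apply (g' (\<phi> (c'.\<psi> y))) e)"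
          by (rule C1_open_scaleR[OF B A])
        have wW: "w' \<in> W" unfolding W_def Y_def using x xU Q(1) by (simp add: c'.\<psi>\<phi>)
        have "\<beta> (\<phi> (c'.\<psi> y)) *\<^sub>R blinfun_apply (g' (\<phi> (c'.\<psi> y))) e = chart_rep U' \<phi>' V y"
          if y: "y \<in> W \<inter> \<phi>' ` (U' \<inter> M)" for y
        proof -
          obtain z where z: "z \<in> U'" "z \<in> M" "y = \<phi>' z" using y by blast
          have zU: "z \<in> U" "\<phi> z \<in> Q" using y z unfolding W_def Y_def by (auto simp: c'.\<psi>\<phi>)
          have "linear (der \<phi>' z)" using C1_open_linear[OF c'.C1\<phi> z(1)] by (rule bounded_linear.linear)
          then show ?thesis using z zU key[OF zU(1) z(1,2) zU(2)] by (simp add: c'.chart_rep_image c'.\<psi>\<phi> V_def linear_cmul)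
        qed
        then show ?thesis using wW C by blast
      qed
    qed
  qed
  define b where "b = (\<lambda>x. if x \<in> U then \<beta> (\<phi> x) else 0)"
  have "isCont \<phi> x0" using C1_open_continuous[OF C1\<phi>] openU U(2) by (simp add: continuous_on_eq_continuous_at)
  then obtain d1 where d1: "d1 > 0" "\<And>x. dist x x0 < d1 \<Longrightarrow> dist (\<phi> x) w0 < r / 2"
    unfolding continuous_at_eps_delta w0_def using r(1) by (metis half_gt_zero)
  obtain d2 where d2: "d2 > 0" "ball x0 d2 \<subseteq> U" using openU U(2) openE by blast
  define c where "c = (r\<^sup>2 - (r/2)\<^sup>2)\<^sup>2"
  have rr: "r\<^sup>2 - (r/2)\<^sup>2 > 0" using r(1) by (simp add: power2_eq_square)
  have "c > 0" using rr by (simp add: c_def)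
  have low: "c \<le> b x" if "dist x x0 < min d1 d2" for x
  proof -
    have xU: "x \<in> U" using d2(2) that by (auto simp: dist_commute)
    have "norm (\<phi> x - w0) \<le> r / 2" using d1(2)[of x] that by (simp add: dist_norm)
    then have "(norm (\<phi> x - w0))\<^sup>2 \<le> (r/2)\<^sup>2" by (intro power_mono) auto
    then have "r\<^sup>2 - (r/2)\<^sup>2 \<le> max 0 (r\<^sup>2 - (\<phi> x - w0) \<bullet> (\<phi> x - w0))" by (simp add: power2_norm_eq_inner)
    then show ?thesis using rr xU unfolding c_def b_def \<beta>_def by (simp add: power_mono)
  qed
  have bV: "V x = b x *\<^sub>R der \<psi> (\<phi> x) e \<and> 0 \<le> b x \<and> (0 < b x \<longrightarrow> dist x x0 < \<epsilon> \<and> norm (der \<psi> (\<phi> x) e - u) < \<epsilon>)" if x: "x \<in> M" for x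
  proof (intro conjI impI)
    show "V x = b x *\<^sub>R der \<psi> (\<phi> x) e" "0 \<le> b x" using x \<beta>0 by (auto simp: V_def b_def)
    assume "0 < b x"
    then have xU: "x \<in> U" and "dist (\<phi> x) w0 < r" using \<beta>pos by (auto simp: b_def split: if_splits)
    then show "dist x x0 < \<epsilon>" "norm (der \<psi> (\<phi> x) e - u) < \<epsilon>"
      using r1(2)[of "\<phi> x"] r2(2)[of "\<phi> x"] r by (auto simp: \<psi>\<phi> dist_norm)
  qed
  define d where "d = min d1 d2"
  have "d > 0" using d1 d2 by (simp add: d_def)
  have low': "c \<le> b x" if "dist x x0 < d" for x using low that by (simp add: d_def)
  have "\<forall>x\<in>M. V x = b x *\<^sub>R der \<psi> (\<phi> x) e \<and> 0 \<le> b x \<and>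
     (0 < b x \<longrightarrow> dist x x0 < \<epsilon> \<and> norm (der \<psi> (\<phi> x) e - u) < \<epsilon>) \<and> (dist x x0 < d \<longrightarrow> c \<le> b x)"
    using bV low' by blast
  then show ?thesis using \<open>c > 0\<close> \<open>d > 0\<close>
    by (intro bexI[OF _ V_VF] exI[of _ b] exI[of _ "\<lambda>x. der \<psi> (\<phi> x) e"] exI[of _ c] exI[of _ d] conjI)
qed

end

section \<open>Rates of ascent\<close>

definition uphill_cone :: "'a::euclidean_space set \<Rightarrow> ('a \<Rightarrow> real) \<Rightarrow> 'a \<Rightarrow> 'a \<Rightarrow> real \<Rightarrow> real \<Rightarrow> bool" where
  "uphill_cone M f x u r m \<longleftrightarrow> 0 < r \<and> (\<forall>y\<in>M. \<forall>z\<in>M. \<forall>s. dist y x < r \<longrightarrow> 0 < s \<longrightarrow> s < r \<longrightarrow>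
     norm (z - y - s *\<^sub>R u) \<le> r * s \<longrightarrow> m * s \<le> f z - f y)"

lemma uphill_coneI:
  assumes "0 < r" "\<And>y z s. y \<in> M \<Longrightarrow> z \<in> M \<Longrightarrow> dist y x < r \<Longrightarrow> 0 < s \<Longrightarrow> s < r \<Longrightarrow>
     norm (z - y - s *\<^sub>R u) \<le> r * s \<Longrightarrow> m * s \<le> f z - f y"
  shows "uphill_cone M f x u r m"
  unfolding uphill_cone_def using assms by simp

lemma uphill_coneD:
  assumes "uphill_cone M f x u r m"
  shows "0 < r" "y \<in> M \<Longrightarrow> z \<in> M \<Longrightarrow> dist y x < r \<Longrightarrow> 0 < s \<Longrightarrow> s < r \<Longrightarrow>
     norm (z - y - s *\<^sub>R u) \<le> r * s \<Longrightarrow> m * s \<le> f z - f y"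
  using assms unfolding uphill_cone_def by blast+

text \<open>The lower derivative of \<open>f\<close> at \<open>x\<close> in direction \<open>u\<close> is at least \<open>m\<close>, uniformly in base points near \<open>x\<close>.
  For a Lipschitz function, this is a lower bound in the sense of Clarke's generalized derivatives.
  Varying the base point is what makes the notion superadditive in \<open>u\<close>.\<close>

definition ascends :: "'a::euclidean_space set \<Rightarrow> ('a \<Rightarrow> real) \<Rightarrow> 'a \<Rightarrow> 'a \<Rightarrow> real \<Rightarrow> bool" where
  "ascends M f x u m \<longleftrightarrow> (\<forall>\<epsilon>>0. \<exists>\<delta>. uphill_cone M f x u \<delta> (m - \<epsilon>))"

lemma ascendsI: "(\<And>\<epsilon>. \<epsilon> > 0 \<Longrightarrow> \<exists>\<delta>. uphill_cone M f x u \<delta> (m - \<epsilon>)) \<Longrightarrow> ascends M f x u m"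
  unfolding ascends_def by blast

lemma ascendsD:
  assumes "ascends M f x u m" "\<epsilon> > 0"
  obtains \<delta> where "uphill_cone M f x u \<delta> (m - \<epsilon>)"
  using assms unfolding ascends_def by blast

lemma ascends_mono:
  assumes "ascends M f x u m" "m' \<le> m" shows "ascends M f x u m'"
proof (rule ascendsI)
  fix \<epsilon> :: real assume "\<epsilon> > 0"
  then have "\<epsilon> + (m - m') > 0" using assms(2) by simp
  then obtain \<delta> where "uphill_cone M f x u \<delta> (m - (\<epsilon> + (m - m')))" using ascendsD[OF assms(1)] by blast
  then show "\<exists>\<delta>. uphill_cone M f x u \<delta> (m' - \<epsilon>)" by (intro exI[of _ \<delta>]) simp
qed

lemma ascends_zero:
  assumes "L-lipschitz_on M f" shows "ascends M f x 0 0"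

proof (rule ascendsI)
  fix \<epsilon> :: real assume "\<epsilon> > 0"
  have L: "L \<ge> 0" using assms by (rule lipschitz_on_nonneg)
  define \<delta> where "\<delta> = \<epsilon> / (L + 1)"
  have d: "\<delta> > 0" using L \<open>\<epsilon> > 0\<close> by (simp add: \<delta>_def)
  have Ld: "L * \<delta> \<le> \<epsilon>"
  proof -
    have "L * \<delta> \<le> (L + 1) * \<delta>" using d by (intro mult_right_mono) auto
    also have "\<dots> = \<epsilon>" using L by (simp add: \<delta>_def)
    finally show ?thesis .
  qed
  have "(0 - \<epsilon>) * s \<le> f z - f y" if h: "y \<in> M" "z \<in> M" "0 < s" "norm (z - y - s *\<^sub>R 0) \<le> \<delta> * s" for y z s
  proof -
    have "\<bar>f z - f y\<bar> \<le> L * norm (z - y)" using lipschitz_onD[OF assms h(2,1)] by (simp add: dist_real_def dist_norm)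
    also have "\<dots> \<le> L * (\<delta> * s)" using h L by (intro mult_left_mono) auto
    also have "\<dots> \<le> \<epsilon> * s" using Ld h(3) by (simp add: mult.assoc[symmetric])
    finally show ?thesis by simp
  qed
  then show "\<exists>\<delta>. uphill_cone M f x 0 \<delta> (0 - \<epsilon>)"
    unfolding uphill_cone_def using d by (intro exI[of _ \<delta>]) blast
qed

lemma ascends_scale:
  assumes "L-lipschitz_on M f" and asc: "ascends M f x u m" and "c \<ge> 0" shows "ascends M f x (c *\<^sub>R u) (c * m)"
proof (cases "c = 0")
  case True
  then show ?thesis using ascends_zero[OF assms(1)] by simp
next
  case False
  then have c: "c > 0" using assms(3) by simp
  show ?thesis
proof (rule ascendsI)
    fix \<epsilon> :: real assume "\<epsilon> > 0"
    then have "\<epsilon> / c > 0" using c by simp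
    then obtain d where d: "uphill_cone M f x u d (m - \<epsilon> / c)" using ascendsD[OF asc] by blast
    define \<delta> where "\<delta> = min d (min (d / c) (d * c))"
    have \<delta>: "\<delta> > 0" "\<delta> \<le> d" "\<delta> \<le> d / c" "\<delta> \<le> d * c" using uphill_coneD(1)[OF d] c by (auto simp: \<delta>_def)
    have "(c * m - \<epsilon>) * s \<le> f z - f y"
      if h: "y \<in> M" "z \<in> M" "dist y x < \<delta>" "0 < s" "s < \<delta>" "norm (z - y - s *\<^sub>R c *\<^sub>R u) \<le> \<delta> * s" for y z s
    proof -
      have "s < d / c" using h(5) \<delta>(3) by simp
      then have 1: "c * s < d" using c by (simp add: field_simps)
      have "\<delta> * s \<le> (d * c) * s" using \<delta>(4) h(4) by (intro mult_right_mono) auto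
      then have 2: "norm (z - y - (c * s) *\<^sub>R u) \<le> d * (c * s)" using h(6) by (simp add: mult.commute mult.left_commute)
      have "(m - \<epsilon> / c) * (c * s) \<le> f z - f y"
        by (rule uphill_coneD(2)[OF d h(1,2) _ _ 1 2]) (use h \<delta>(2) c in auto)
      moreover have "(m - \<epsilon> / c) * (c * s) = (c * m - \<epsilon>) * s" using c by (simp add: field_simps)
      ultimately show ?thesis by simp
    qed
    then show "\<exists>\<delta>. uphill_cone M f x (c *\<^sub>R u) \<delta> (c * m - \<epsilon>)"
    unfolding uphill_cone_def using \<delta>(1) by (intro exI[of _ \<delta>]) blast
  qed
qed

text \<open>A cone of ascent is stable under small changes of the base point and of the direction.\<close>

lemma ascends_from_cone:
  assumes cone: "uphill_cone M f x0 u r m" and x: "dist x x0 < r / 2" and u': "norm (u' - u) < r / 2"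
  shows "ascends M f x u' m"
proof (rule ascendsI)
  fix \<epsilon> :: real assume "\<epsilon> > 0"
  have r: "r > 0" using cone by (rule uphill_coneD)
  have "(m - \<epsilon>) * s \<le> f z - f y"
    if h: "y \<in> M" "z \<in> M" "dist y x < r / 2" "0 < s" "s < r / 2" "norm (z - y - s *\<^sub>R u') \<le> r / 2 * s" for y z s
  proof -
    have 1: "dist y x0 < r" using dist_triangle[of y x0 x] h(3) x by simp
    have "norm (s *\<^sub>R (u' - u)) \<le> s * (r / 2)" using u' h(4) by simp
    moreover have "z - y - s *\<^sub>R u = (z - y - s *\<^sub>R u') + s *\<^sub>R (u' - u)" by (simp add: algebra_simps)
    ultimately have "norm (z - y - s *\<^sub>R u) \<le> r / 2 * s + s * (r / 2)" using h(6) by (metis norm_triangle_mono)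
    then have "norm (z - y - s *\<^sub>R u) \<le> r * s" by (simp add: algebra_simps)
    then have "m * s \<le> f z - f y" using uphill_coneD(2)[OF cone h(1,2) 1 h(4)] h(5) r by linarith
    moreover have "0 \<le> \<epsilon> * s" using \<open>\<epsilon> > 0\<close> h(4) by simp
    ultimately show ?thesis by (simp add: algebra_simps)
  qed
  then show "\<exists>\<delta>. uphill_cone M f x u' \<delta> (m - \<epsilon>)"
    unfolding uphill_cone_def using r by (intro exI[of _ "r / 2"]) simp
qed

context atlas_manifold
begin

text \<open>A step along \<open>u + v\<close> is a step along \<open>u\<close> to a point of \<open>M\<close>, which exists by strict tangency,
  followed by a step along \<open>v\<close>.\<close>

lemma ascends_add:
  assumes x: "x \<in> M" and u: "u \<in> tangent_space M x" and asc: "ascends M f x u m" "ascends M f x v n"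
  shows "ascends M f x (u + v) (m + n)"
proof (rule ascendsI)
  fix \<epsilon> :: real assume "\<epsilon> > 0"
  then have e2: "\<epsilon> / 2 > 0" by simp
  obtain d1 where d1: "uphill_cone M f x u d1 (m - \<epsilon> / 2)" using ascendsD[OF asc(1) e2] by blast
  obtain d2 where d2: "uphill_cone M f x v d2 (n - \<epsilon> / 2)" using ascendsD[OF asc(2) e2] by blast
  have d10: "d1 > 0" and d20: "d2 > 0" using d1 d2 by (auto dest: uphill_coneD(1))
  define e where "e = min d1 (d2 / 2)"
  have e: "e > 0" "e \<le> d1" "e \<le> d2 / 2" using d10 d20 by (auto simp: e_def)
  obtain d3 where d3: "d3 > 0" "\<forall>y s. y \<in> M \<and> dist y x < d3 \<and> \<bar>s\<bar> < d3 \<longrightarrow> (\<exists>z\<in>M. norm (z - y - s *\<^sub>R u) \<le> e * \<bar>s\<bar>)"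
    using VF_strict_tangency[OF x u e(1)] by blast
  define k where "k = norm u + e + 1"
  have k: "k \<ge> 1" using e by (simp add: k_def)
  define \<delta> where "\<delta> = min (min d1 d3) (d2 / (2 * k))"
  have "d2 / (2 * k) \<le> d2 / 2" using k d20 by (simp add: field_simps)
  then have \<delta>: "\<delta> > 0" "\<delta> \<le> d1" "\<delta> \<le> d3" "\<delta> \<le> d2 / 2" using d10 d20 d3 k by (auto simp: \<delta>_def)
  have "\<delta> \<le> d2 / (2 * k)" by (simp add: \<delta>_def)
  then have \<delta>k: "k * \<delta> \<le> d2 / 2" using k by (simp add: field_simps)
  have "(m + n - \<epsilon>) * s \<le> f z - f y"
    if h: "y \<in> M" "z \<in> M" "dist y x < \<delta>" "0 < s" "s < \<delta>" "norm (z - y - s *\<^sub>R (u + v)) \<le> \<delta> * s" for y z s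
  proof -
    obtain y' where y': "y' \<in> M" "norm (y' - y - s *\<^sub>R u) \<le> e * s" using d3(2) h \<delta>(3) by (metis abs_of_pos order_less_le_trans)
    have "e * s \<le> d1 * s" using e h by (intro mult_right_mono) auto
    then have "norm (y' - y - s *\<^sub>R u) \<le> d1 * s" using y'(2) by linarith
    then have 1: "(m - \<epsilon> / 2) * s \<le> f y' - f y" using uphill_coneD(2)[OF d1 h(1) y'(1), of s] h(3-5) \<delta>(2) by linarith
    have "norm (y' - y) \<le> norm (y' - y - s *\<^sub>R u) + norm (s *\<^sub>R u)" by (metis diff_add_cancel norm_triangle_ineq)
    also have "\<dots> \<le> e * s + s * norm u" using y'(2) h(4) by simp
    also have "\<dots> \<le> k * s" using h(4) by (simp add: k_def algebra_simps)
    also have "\<dots> \<le> k * \<delta>" using h(5) k by (intro mult_left_mono) auto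
    finally have "dist y' y \<le> d2 / 2" using \<delta>k by (simp add: dist_norm)
    then have dy': "dist y' x < d2" using dist_triangle[of y' x y] h(3) \<delta>(4) by simp
    have "z - y' - s *\<^sub>R v = (z - y - s *\<^sub>R (u + v)) - (y' - y - s *\<^sub>R u)" by (simp add: algebra_simps)
    then have "norm (z - y' - s *\<^sub>R v) \<le> norm (z - y - s *\<^sub>R (u + v)) + norm (y' - y - s *\<^sub>R u)"
      by (simp only: norm_triangle_ineq4)
    also have "\<dots> \<le> \<delta> * s + e * s" using h(6) y'(2) by (rule add_mono)
    also have "\<dots> \<le> d2 / 2 * s + d2 / 2 * s" using \<delta>(4) e(3) h(4) by (intro add_mono mult_right_mono) auto
    finally have "norm (z - y' - s *\<^sub>R v) \<le> d2 * s" by (simp add: algebra_simps)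
    then have "(n - \<epsilon> / 2) * s \<le> f z - f y'" using uphill_coneD(2)[OF d2 y'(1) h(2) dy' h(4)] h(5) \<delta>(4) d20 by linarith
    then show ?thesis using 1 by (simp add: algebra_simps)
  qed
  then show "\<exists>\<delta>. uphill_cone M f x (u + v) \<delta> (m + n - \<epsilon>)"
    unfolding uphill_cone_def using \<delta>(1) by (intro exI[of _ \<delta>]) blast
qed

text \<open>The integral curve through \<open>y\<close> reaches a point near \<open>y + s (X x)\<close> without changing \<open>f\<close>; the Lipschitz condition
  controls the rest of the step.\<close>

lemma first_integral_ascends:
  assumes X: "X \<in> VF" and f: "first_integral M X f" and lip: "L-lipschitz_on M f" and x: "x \<in> M"
  shows "ascends M f x (X x) 0"
proof (rule ascendsI)
  fix \<epsilon> :: real assume "\<epsilon> > 0"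
  have L: "L \<ge> 0" using lip by (rule lipschitz_on_nonneg)
  define \<kappa> where "\<kappa> = \<epsilon> / (2 * (L + 1))"
  have \<kappa>: "\<kappa> > 0" using L \<open>\<epsilon> > 0\<close> by (simp add: \<kappa>_def)
  have L\<kappa>: "L * (2 * \<kappa>) \<le> \<epsilon>"
  proof -
    have "L * (2 * \<kappa>) \<le> (L + 1) * (2 * \<kappa>)" using \<kappa> by (intro mult_right_mono) auto
    also have "\<dots> = \<epsilon> * ((L + 1) / (L + 1))" by (simp add: \<kappa>_def field_simps)
    also have "\<dots> = \<epsilon>" using L by simp
    finally show ?thesis .
  qed
  obtain d1 where d1: "d1 > 0" "\<And>y. y \<in> M \<Longrightarrow> dist y x < d1 \<Longrightarrow> dist (X y) (X x) < \<kappa>"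
    using VF_continuous[OF X] x \<kappa> unfolding continuous_on_iff by metis
  obtain B where B: "B > 0" "\<forall>v\<in>X ` M. norm v \<le> B"
    using compact_imp_bounded[OF compact_continuous_image[OF VF_continuous[OF X] compactM]] unfolding bounded_pos by blast
  define \<delta> where "\<delta> = min (min (d1 / 2) (d1 / (2 * B))) \<kappa>"
  have \<delta>: "\<delta> > 0" "\<delta> \<le> d1 / 2" "\<delta> \<le> \<kappa>" using d1 B \<kappa> by (auto simp: \<delta>_def)
  have "\<delta> \<le> d1 / (2 * B)" by (simp add: \<delta>_def)
  then have \<delta>B: "B * \<delta> \<le> d1 / 2" using B by (simp add: field_simps)
  have "(0 - \<epsilon>) * s \<le> f z - f y"
    if h: "y \<in> M" "z \<in> M" "dist y x < \<delta>" "0 < s" "s < \<delta>" "norm (z - y - s *\<^sub>R X x) \<le> \<delta> * s" for y z s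
  proof -
    obtain \<gamma> where \<gamma>: "integral_curve M X \<gamma>" "\<gamma> 0 = y" using VF_integral_curve[OF X h(1)] .
    have \<gamma>M: "\<gamma> t \<in> M" and \<gamma>d: "(\<gamma> has_vector_derivative X (\<gamma> t)) (at t within S)" for t S
      using \<gamma>(1) unfolding integral_curve_def by (auto intro: has_vector_derivative_at_within)
    have near: "dist (\<gamma> t) x < d1" if t: "t \<in> {0..s}" for t
    proof -
      have "norm (\<gamma> t - \<gamma> 0) \<le> B * norm (t - 0)"
      proof (rule differentiable_bound[where S = "{0..s}" and f' = "\<lambda>t h. h *\<^sub>R X (\<gamma> t)"])
        show "onorm (\<lambda>h. h *\<^sub>R X (\<gamma> t)) \<le> B" for t
        proof (rule onorm_le)
          fix h :: real
          have "norm (X (\<gamma> t)) \<le> B" using B(2) \<gamma>M by blast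
          then have "\<bar>h\<bar> * norm (X (\<gamma> t)) \<le> \<bar>h\<bar> * B" by (rule mult_left_mono) simp
          then show "norm (h *\<^sub>R X (\<gamma> t)) \<le> B * norm h" by (simp add: mult.commute[of B])
        qed
      qed (use \<gamma>d h(4) t in \<open>auto simp: has_vector_derivative_def\<close>)
      also have "\<dots> \<le> B * \<delta>" using t h(5) B by (intro mult_left_mono) auto
      finally have "dist (\<gamma> t) y \<le> d1 / 2" using \<delta>B \<gamma>(2) by (simp add: dist_norm)
      then show ?thesis using dist_triangle[of "\<gamma> t" x y] h(3) \<delta>(2) by simp
    qed
    have "norm ((\<gamma> s - s *\<^sub>R X x) - (\<gamma> 0 - 0 *\<^sub>R X x)) \<le> \<kappa> * norm (s - 0)"
    proof (rule differentiable_bound[where S = "{0..s}" and f = "\<lambda>t. \<gamma> t - t *\<^sub>R X x" and f' = "\<lambda>t h. h *\<^sub>R X (\<gamma> t) - h *\<^sub>R X x"])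
      show "((\<lambda>t. \<gamma> t - t *\<^sub>R X x) has_derivative (\<lambda>h. h *\<^sub>R X (\<gamma> t) - h *\<^sub>R X x)) (at t within {0..s})" for t
        using \<gamma>d[of t "{0..s}"] unfolding has_vector_derivative_def by (auto intro!: derivative_eq_intros)
      show "onorm (\<lambda>h. h *\<^sub>R X (\<gamma> t) - h *\<^sub>R X x) \<le> \<kappa>" if t: "t \<in> {0..s}" for t
      proof (rule onorm_le)
        fix h :: real
        have "norm (X (\<gamma> t) - X x) \<le> \<kappa>" using d1(2)[OF \<gamma>M near[OF t]] by (simp add: dist_norm)
        then have "norm (h *\<^sub>R (X (\<gamma> t) - X x)) \<le> \<bar>h\<bar> * \<kappa>" unfolding norm_scaleR by (rule mult_left_mono) simp
        then show "norm (h *\<^sub>R X (\<gamma> t) - h *\<^sub>R X x) \<le> \<kappa> * norm h" by (simp add: scaleR_diff_right mult.commute)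
      qed
    qed (use h(4) in auto)
    then have 1: "norm (\<gamma> s - y - s *\<^sub>R X x) \<le> \<kappa> * s" using \<gamma>(2) h(4) by (simp add: algebra_simps)
    have "z - \<gamma> s = (z - y - s *\<^sub>R X x) - (\<gamma> s - y - s *\<^sub>R X x)" by simp
    then have "norm (z - \<gamma> s) \<le> norm (z - y - s *\<^sub>R X x) + norm (\<gamma> s - y - s *\<^sub>R X x)"
      by (simp only: norm_triangle_ineq4)
    also have "\<dots> \<le> \<delta> * s + \<kappa> * s" using h(6) 1 by (rule add_mono)
    also have "\<dots> \<le> (2 * \<kappa>) * s" using \<delta>(3) h(4) by (simp add: algebra_simps)
    finally have n: "norm (z - \<gamma> s) \<le> (2 * \<kappa>) * s" .
    have "range \<gamma> \<in> orbits M X" using \<gamma>(1) unfolding orbits_def by blast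
    then have "f constant_on range \<gamma>" using f unfolding first_integral_def by blast
    then have fy: "f (\<gamma> s) = f y" using \<gamma>(2) unfolding constant_on_def by (metis rangeI)
    have "\<bar>f z - f (\<gamma> s)\<bar> \<le> L * norm (z - \<gamma> s)" using lipschitz_onD[OF lip h(2) \<gamma>M] by (simp add: dist_real_def dist_norm)
    also have "\<dots> \<le> L * ((2 * \<kappa>) * s)" using n L by (rule mult_left_mono)
    also have "\<dots> = (L * (2 * \<kappa>)) * s" by simp
    also have "\<dots> \<le> \<epsilon> * s" using L\<kappa> h(4) by (intro mult_right_mono) auto
    finally show ?thesis using fy by simp
  qed
  then show "\<exists>\<delta>. uphill_cone M f x (X x) \<delta> (0 - \<epsilon>)"
    unfolding uphill_cone_def using \<delta>(1) by (intro exI[of _ \<delta>]) blast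
qed

text \<open>Near each point of \<open>K\<close> a bump field in the direction of the cone ascends, and everywhere else
  it does not descend.  By superadditivity, finite sums of such fields inherit both properties.\<close>

lemma ascending_field:
  assumes lip: "L-lipschitz_on M f" and K: "compact K" "K \<subseteq> M" and "m > 0"
    and cone: "\<And>x. x \<in> K \<Longrightarrow> \<exists>u\<in>tangent_space M x. \<exists>r. uphill_cone M f x u r m"
  shows "\<exists>V\<in>VF. \<exists>W. open W \<and> K \<subseteq> W \<and> (\<exists>c>0. \<forall>x\<in>M \<inter> W. ascends M f x (V x) c)"
proof -
  define Q where "Q = (\<lambda>A. \<exists>V\<in>VF. \<exists>c>0. (\<forall>x\<in>M. ascends M f x (V x) 0) \<and> (\<forall>x\<in>M \<inter> A. ascends M f x (V x) c))"
  have Q0: "Q {}" unfolding Q_def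
    by (intro bexI[OF _ VF_zero] exI[of _ 1]) (use ascends_zero[OF lip] in simp)
  have QUn: "Q (A \<union> B)" if "Q A" "Q B" for A B
  proof -
    obtain V c where V: "V \<in> VF" "c > 0" "\<forall>x\<in>M. ascends M f x (V x) 0" "\<forall>x\<in>M \<inter> A. ascends M f x (V x) c"
      using \<open>Q A\<close> unfolding Q_def by blast
    obtain V' c' where V': "V' \<in> VF" "c' > 0" "\<forall>x\<in>M. ascends M f x (V' x) 0" "\<forall>x\<in>M \<inter> B. ascends M f x (V' x) c'"
      using \<open>Q B\<close> unfolding Q_def by blast
    define V'' where "V'' = (\<lambda>x\<in>M. V x + 1 *\<^sub>R V' x)"
    have add: "ascends M f x (V'' x) (p + q)" if "x \<in> M" "ascends M f x (V x) p" "ascends M f x (V' x) q" for x p q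
      using ascends_add[OF that(1) VF_tangent[OF V(1) that(1)] that(2,3)] that(1) by (simp add: V''_def)
    have "V'' \<in> VF" unfolding V''_def by (rule VF_lincomb[OF V(1) V'(1)])
    moreover have "\<forall>x\<in>M. ascends M f x (V'' x) 0" using add[of _ 0 0] V(3) V'(3) by simp
    moreover have "\<forall>x\<in>M \<inter> (A \<union> B). ascends M f x (V'' x) (min c c')"
    proof
      fix x assume x: "x \<in> M \<inter> (A \<union> B)"
      then have "ascends M f x (V'' x) c \<or> ascends M f x (V'' x) c'"
        using add[of x c 0] add[of x 0 c'] V V' by auto
      then show "ascends M f x (V'' x) (min c c')" by (metis ascends_mono min.cobounded1 min.cobounded2)
    qed
    moreover have "min c c' > 0" using V(2) V'(2) by simp
    ultimately show ?thesis unfolding Q_def by blast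
  qed
  have loc: "\<exists>d>0. Q (ball x d)" if x: "x \<in> K" for x
  proof -
    have xM: "x \<in> M" using K x by blast
    obtain u r where u: "u \<in> tangent_space M x" and c: "uphill_cone M f x u r m" using cone[OF x] by blast
    have "r / 2 > 0" using uphill_coneD(1)[OF c] by simp
    from bump_field[OF xM u this] obtain V b u' k d where V: "V \<in> VF" "k > 0" "d > 0" and
      b: "\<forall>y\<in>M. V y = b y *\<^sub>R u' y \<and> 0 \<le> b y \<and> (0 < b y \<longrightarrow> dist y x < r / 2 \<and> norm (u' y - u) < r / 2) \<and> (dist y x < d \<longrightarrow> k \<le> b y)"
      by blast
    have asc: "ascends M f y (V y) (b y * m)" if y: "y \<in> M" for y
    proof (cases "b y = 0")
      case True
      then show ?thesis using b y ascends_zero[OF lip] by simp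
    next
      case False
      then have by': "b y > 0" using b y by (metis less_eq_real_def)
      then have "ascends M f y (u' y) m" using ascends_from_cone[OF c] b y by blast
      then have "ascends M f y (b y *\<^sub>R u' y) (b y * m)" using ascends_scale[OF lip] by' by simp
      then show ?thesis using b y by simp
    qed
    have "ascends M f y (V y) 0" if "y \<in> M" for y
      using ascends_mono[OF asc[OF that]] b that \<open>m > 0\<close> by simp
    moreover have "ascends M f y (V y) (k * m)" if "y \<in> M \<inter> ball x d" for y
    proof (rule ascends_mono[OF asc])
      show "y \<in> M" using that by blast
      have "k \<le> b y" using b that by (simp add: dist_commute)
      then show "k * m \<le> b y * m" using \<open>m > 0\<close> by (intro mult_right_mono) auto
    qed
    moreover have "k * m > 0" using V(2) \<open>m > 0\<close> by simp
    ultimately have "Q (ball x d)" unfolding Q_def using V(1) by blast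
    then show ?thesis using V(3) by blast
  qed
  then obtain d where d: "\<And>x. x \<in> K \<Longrightarrow> d x > 0 \<and> Q (ball x (d x))" by metis
  obtain C where C: "C \<subseteq> K" "finite C" "K \<subseteq> (\<Union>x\<in>C. ball x (d x))"
    by (rule compactE_image[OF K(1), of K "\<lambda>x. ball x (d x)"]) (use d in force)+
  have "Q (\<Union>x\<in>C. ball x (d x))" using C(2,1)
    by (induction C rule: finite_induct) (use Q0 QUn d in auto)
  then obtain V c where "V \<in> VF" "c > 0" "\<forall>x\<in>M \<inter> (\<Union>x\<in>C. ball x (d x)). ascends M f x (V x) c" unfolding Q_def by blast
  moreover have "open (\<Union>x\<in>C. ball x (d x))" by blast
  ultimately show ?thesis using C(3) by blast
qed

section \<open>The generic argument\<close>

text \<open>The growing function \<open>h\<close> may depend on the field.  Perturbations of a field with first integral \<open>f\<close> are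
  rising because \<open>f\<close> itself grows along them, whereas along the unperturbed field \<open>f\<close> is constant
  and only some other function could grow.\<close>

definition rising :: "'a set \<Rightarrow> ('a \<Rightarrow> 'a) set" where
  "rising R = {Y \<in> VF. \<exists>h L c. L-lipschitz_on M h \<and> 0 < c \<and>
     (\<forall>x\<in>M \<inter> R. \<exists>\<delta>>0. \<forall>z\<in>M. \<forall>s. 0 < s \<longrightarrow> s < \<delta> \<longrightarrow> norm (z - x - s *\<^sub>R Y x) \<le> \<delta> * s \<longrightarrow> c * s \<le> h z - h x)}"

text \<open>The same Lipschitz function serves for nearby fields: changing the direction of a step by \<open>e\<close> changes its
  increment by at most \<open>L e s\<close>.\<close>

lemma openin_rising: "openin T (rising R)"
proof (subst openin_subopen, rule ballI)
  fix Y assume "Y \<in> rising R"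
  then obtain h L c where Y: "Y \<in> VF" and h: "L-lipschitz_on M h" "0 < c" and
    r: "\<forall>x\<in>M \<inter> R. \<exists>\<delta>>0. \<forall>z\<in>M. \<forall>s. 0 < s \<longrightarrow> s < \<delta> \<longrightarrow> norm (z - x - s *\<^sub>R Y x) \<le> \<delta> * s \<longrightarrow> c * s \<le> h z - h x"
    unfolding rising_def by blast
  have L: "L \<ge> 0" using h(1) by (rule lipschitz_on_nonneg)
  define e where "e = c / (4 * (L + 1))"
  have e: "e > 0" using L h(2) by (simp add: e_def)
  have "k * (c / (4 * k)) = c / 4" if "k \<noteq> 0" for k :: real using that by simp
  from this[of "L + 1"] have ce: "(L + 1) * e = c / 4" using L unfolding e_def by linarith
  have Le: "L * (3 * e) \<le> 3 * c / 4"
  proof -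
    have "L * (3 * e) \<le> (L + 1) * (3 * e)" using e by (intro mult_right_mono) auto
    also have "\<dots> = 3 * ((L + 1) * e)" by simp
    also have "\<dots> = 3 * (c / 4)" unfolding ce ..
    finally show ?thesis by simp
  qed
  obtain W where W: "openin T W" "Y \<in> W" "\<forall>Y'\<in>W. \<forall>x\<in>M. norm (Y' x - Y x) < e"
    using C0_neighbourhood[OF Y e] by blast
  define W' where "W' = W \<inter> VF"
  have "openin T VF"
    using topspace_C1_topology[OF atlas nonempty] openin_topspace by metis
  then have "openin T W'" unfolding W'_def by (rule openin_Int[OF W(1)])
  moreover have "Y \<in> W'" using W(2) Y by (simp add: W'_def)
  moreover have "W' \<subseteq> rising R"
  proof
    fix Y' assume Y': "Y' \<in> W'"
    have "\<exists>\<delta>>0. \<forall>z\<in>M. \<forall>s. 0 < s \<longrightarrow> s < \<delta> \<longrightarrow> norm (z - x - s *\<^sub>R Y' x) \<le> \<delta> * s \<longrightarrow> c / 4 * s \<le> h z - h x"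
      if x: "x \<in> M \<inter> R" for x
    proof -
      obtain d where d: "d > 0" "\<forall>z\<in>M. \<forall>s. 0 < s \<longrightarrow> s < d \<longrightarrow> norm (z - x - s *\<^sub>R Y x) \<le> d * s \<longrightarrow> c * s \<le> h z - h x"
        using r x by blast
      define k where "k = min d e"
      have k: "k > 0" "k \<le> d" "k \<le> e" using d e by (auto simp: k_def)
      obtain d' where d': "d' > 0" "\<forall>y\<in>M. \<forall>s. \<bar>s\<bar> < d' \<longrightarrow> (\<exists>z\<in>M. norm (z - y - s *\<^sub>R Y y) \<le> k * \<bar>s\<bar>)"
        using VF_uniform_tangency[OF Y k(1)] by blast
      define \<delta> where "\<delta> = min (min d d') e"
      have \<delta>: "\<delta> > 0" "\<delta> \<le> d" "\<delta> \<le> d'" "\<delta> \<le> e" using d d' e by (auto simp: \<delta>_def)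
      have "c / 4 * s \<le> h z - h x" if z: "z \<in> M" and s: "0 < s" "s < \<delta>" and n: "norm (z - x - s *\<^sub>R Y' x) \<le> \<delta> * s" for z s
      proof -
        have "\<bar>s\<bar> < d'" using s \<delta> by simp
        then obtain z' where z': "z' \<in> M" "norm (z' - x - s *\<^sub>R Y x) \<le> k * s" using d'(2) x s by (metis IntD1 abs_of_pos)
        have "k * s \<le> d * s" using k s by (intro mult_right_mono) auto
        then have "norm (z' - x - s *\<^sub>R Y x) \<le> d * s" using z'(2) by linarith
        moreover have "s < d" using s(2) \<delta>(2) by linarith
        ultimately have 1: "c * s \<le> h z' - h x" using d(2) z'(1) s(1) by blast
        have "norm (Y' x - Y x) \<le> e" using W(3) Y' x unfolding W'_def by (simp add: less_imp_le)
        then have 2: "norm (s *\<^sub>R (Y' x - Y x)) \<le> s * e" using s(1) by simp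
        have "z - z' = (z - x - s *\<^sub>R Y' x) + s *\<^sub>R (Y' x - Y x) - (z' - x - s *\<^sub>R Y x)" by (simp add: algebra_simps)
        then have "norm (z - z') \<le> norm ((z - x - s *\<^sub>R Y' x) + s *\<^sub>R (Y' x - Y x)) + norm (z' - x - s *\<^sub>R Y x)"
          by (simp only: norm_triangle_ineq4)
        also have "\<dots> \<le> (\<delta> * s + s * e) + k * s" by (intro add_mono norm_triangle_mono n 2 z'(2))
        also have "\<dots> \<le> (e * s + s * e) + e * s" using \<delta>(4) k(3) s(1) e by (intro add_mono mult_right_mono) auto
        finally have "norm (z - z') \<le> 3 * e * s" by (simp add: algebra_simps)
        then have "L * norm (z - z') \<le> L * (3 * e * s)" using L by (rule mult_left_mono)
        also have "\<dots> = L * (3 * e) * s" by simp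
        also have "\<dots> \<le> 3 * c / 4 * s" using Le s(1) by (intro mult_right_mono) auto
        finally have "\<bar>h z - h z'\<bar> \<le> 3 * c / 4 * s" using lipschitz_onD[OF h(1) z z'(1)] by (simp add: dist_real_def dist_norm)
        moreover have "3 * c / 4 * s = c * s - c / 4 * s" by (simp add: field_simps)
        ultimately show ?thesis using 1 by linarith
      qed
      then show ?thesis using \<delta>(1) by blast
    qed
    moreover have "c / 4 > 0" using h(2) by simp
    ultimately show "Y' \<in> rising R" unfolding rising_def using h(1) Y' unfolding W'_def by blast
  qed
  ultimately show "\<exists>W. openin T W \<and> Y \<in> W \<and> W \<subseteq> rising R" by blast
qed

text \<open>Along such a curve the bounded function \<open>h\<close> would grow at least linearly.\<close>

lemma integral_curve_leaves:
  assumes X: "X \<in> rising R" and \<gamma>: "integral_curve M X \<gamma>" and R: "range \<gamma> \<subseteq> R"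
  shows False
proof -
  obtain h L c where h: "L-lipschitz_on M h" "0 < c" and
    r: "\<forall>x\<in>M \<inter> R. \<exists>\<delta>>0. \<forall>z\<in>M. \<forall>s. 0 < s \<longrightarrow> s < \<delta> \<longrightarrow> norm (z - x - s *\<^sub>R X x) \<le> \<delta> * s \<longrightarrow> c * s \<le> h z - h x"
    using X unfolding rising_def by blast
  have hc: "continuous_on M h" using h(1) by (rule lipschitz_on_continuous_on)
  obtain B where B: "\<forall>v\<in>h ` M. norm v \<le> B"
    using compact_imp_bounded[OF compact_continuous_image[OF hc compactM]] unfolding bounded_iff by blast
  have \<gamma>M: "\<gamma> t \<in> M" and d: "(\<gamma> has_vector_derivative X (\<gamma> t)) (at t)" for t using \<gamma> unfolding integral_curve_def by auto
  have "continuous_on UNIV \<gamma>" using d has_vector_derivative_continuous continuous_at_imp_continuous_on by blast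
  then have "continuous_on UNIV (\<lambda>t. h (\<gamma> t))" by (rule continuous_on_compose2[OF hc]) (use \<gamma>M in blast)
  then have "continuous_on UNIV (\<lambda>t. h (\<gamma> t) - h (\<gamma> 0) - c * t)" by (intro continuous_intros)
  then have cont: "isCont (\<lambda>t. h (\<gamma> t) - h (\<gamma> 0) - c * t) t" for t by (simp add: continuous_on_eq_continuous_at)
  define \<Phi> where "\<Phi> = (\<lambda>t. h (\<gamma> t) - h (\<gamma> 0) - c * t)"
  have cont\<Phi>: "isCont \<Phi> t" for t unfolding \<Phi>_def by (rule cont)
  have grow: "0 \<le> \<Phi> S" if S: "0 \<le> S" for S
  proof (rule real_induction[of 0 S "\<lambda>t. 0 \<le> \<Phi> t"])
    show "0 \<le> \<Phi> 0" by (simp add: \<Phi>_def)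
    fix t assume t: "0 \<le> t" "t < S" "0 \<le> \<Phi> t"
    have "\<gamma> t \<in> M \<inter> R" using \<gamma>M R by auto
    then obtain \<delta> where \<delta>: "\<delta> > 0" "\<forall>z\<in>M. \<forall>s. 0 < s \<longrightarrow> s < \<delta> \<longrightarrow> norm (z - \<gamma> t - s *\<^sub>R X (\<gamma> t)) \<le> \<delta> * s \<longrightarrow> c * s \<le> h z - h (\<gamma> t)"
      using r by blast
    obtain \<rho> where \<rho>: "\<rho> > 0" "\<forall>y. norm (y - t) < \<rho> \<longrightarrow> norm (\<gamma> y - \<gamma> t - (y - t) *\<^sub>R X (\<gamma> t)) \<le> \<delta> * norm (y - t)"
      using d[of t] \<delta>(1) unfolding has_vector_derivative_def has_derivative_at_alt by blast
    have "0 \<le> \<Phi> y" if y: "t < y" "y < t + min \<delta> \<rho>" for y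
    proof -
      have "norm (\<gamma> y - \<gamma> t - (y - t) *\<^sub>R X (\<gamma> t)) \<le> \<delta> * (y - t)" using \<rho>(2)[rule_format, of y] y by simp
      moreover have "0 < y - t" "y - t < \<delta>" using y by auto
      ultimately have "c * (y - t) \<le> h (\<gamma> y) - h (\<gamma> t)" using \<delta>(2) \<gamma>M by blast
      then show ?thesis using t(3) by (simp add: \<Phi>_def algebra_simps)
    qed
    moreover have "min \<delta> \<rho> > 0" using \<delta> \<rho> by simp
    ultimately show "\<exists>\<rho>>0. \<forall>y. t < y \<and> y < t + \<rho> \<longrightarrow> 0 \<le> \<Phi> y" by blast
  next
    fix s assume s: "0 < s" "s \<le> S" "\<And>t. 0 \<le> t \<Longrightarrow> t < s \<Longrightarrow> 0 \<le> \<Phi> t"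
    show "0 \<le> \<Phi> s"
    proof (rule ccontr)
      assume "\<not> 0 \<le> \<Phi> s"
      then have "- \<Phi> s > 0" by simp
      then obtain e where e: "e > 0" "\<And>t. dist t s < e \<Longrightarrow> dist (\<Phi> t) (\<Phi> s) < - \<Phi> s"
        using cont\<Phi>[of s] unfolding continuous_at_eps_delta by blast
      define t where "t = max 0 (s - e / 2)"
      have t: "0 \<le> t" "t < s" "dist t s < e" using s e by (auto simp: t_def dist_real_def)
      show False using e(2)[OF t(3)] s(3)[OF t(1,2)] by (simp add: dist_real_def)
    qed
  qed (use S in auto)
  define S where "S = (2 * B + 1) / c"
  have nb: "\<bar>h (\<gamma> t)\<bar> \<le> B" for t using B \<gamma>M by auto
  have "B \<ge> 0" using nb[of 0] by linarith
  then have "0 \<le> S" using h(2) by (simp add: S_def)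
  then have "0 \<le> h (\<gamma> S) - h (\<gamma> 0) - c * S" using grow unfolding \<Phi>_def by blast
  moreover have "c * S = 2 * B + 1" using h(2) by (simp add: S_def)
  ultimately show False using nb[of S] nb[of 0] by (simp add: abs_le_iff)
qed

text \<open>Transfer from \<open>N = G(M)\<close> to \<open>M\<close>.  The near tangency of \<open>v\<close> provides pairs of points of \<open>N\<close> whose secants are
  within \<open>\<rho>\<close> of \<open>v\<close>.  Pulled back to \<open>M\<close>, their secants accumulate at a tangent vector \<open>u\<close>, and the derivative of
  \<open>G\<close> maps \<open>u\<close> to a vector within \<open>\<rho>\<close> of \<open>v\<close>.  So short steps along \<open>u\<close> become steps within the
  cone of width \<open>2 \<rho>\<close> around \<open>v\<close>.\<close>

lemma cone_from_regular_point:
  assumes x: "x \<in> M" and G: "C1_open UNIV G" and H: "C1_open UNIV H" and HG: "\<And>x. H (G x) = x"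
    and \<rho>: "\<rho> > 0" and reg: "regular_point \<rho> (G ` M) g (G x)" and g: "\<And>x. x \<in> M \<Longrightarrow> g (G x) = f x"
  shows "\<exists>u\<in>tangent_space M x. \<exists>r. uphill_cone M f x u r (1/2)"
proof -
  obtain v r0 where par: "\<forall>r. 0 < r \<longrightarrow> (\<exists>y z s. y \<in> G ` M \<and> z \<in> G ` M \<and> norm (y - G x) < r \<and> norm (z - G x) < r \<and> 0 < s \<and> s < r \<and>
        norm (z - y - s *\<^sub>R v) \<le> \<rho> * s)" and
    r0: "0 < r0" and cone: "\<forall>y z s. y \<in> G ` M \<and> z \<in> G ` M \<and> norm (y - G x) < r0 \<and> norm (z - G x) < r0 \<and> 0 < s \<and> s < r0 \<and>
        norm (z - y - s *\<^sub>R v) \<le> (2 * \<rho>) * s \<longrightarrow> (1/2) * s \<le> g z - g y"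
    using reg unfolding regular_point_def by blast
  obtain KH where KH: "KH > 0" "\<And>h. norm (der H (G x) h) \<le> norm h * KH"
    using bounded_linear.pos_bounded[OF C1_open_linear[OF H UNIV_I]] by blast
  obtain KG where KG: "KG > 0" "\<And>h. norm (der G x h) \<le> norm h * KG"
    using bounded_linear.pos_bounded[OF C1_open_linear[OF G UNIV_I]] by blast
  obtain dH where dH: "dH > 0" "\<And>y z. y \<in> ball (G x) dH \<Longrightarrow> z \<in> ball (G x) dH \<Longrightarrow> norm (H z - H y - der H (G x) (z - y)) \<le> 1 * norm (z - y)"
    using C1_open_strict[OF H UNIV_I zero_less_one, of "G x"] by metis
  \<comment> \<open>bounds the secant slopes on \<open>M\<close>, so that they accumulate\<close>
  define C where "C = (KH + 1) * (norm v + \<rho>)"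
  have contH: "isCont H (G x)" using C1_open_continuous[OF H] by (simp add: continuous_on_eq_continuous_at)
  have "\<exists>a b s. a \<in> M \<and> b \<in> M \<and> dist a x < e \<and> dist b x < e \<and> 0 < s \<and> norm (G b - G a - s *\<^sub>R v) \<le> \<rho> * s \<and> norm (b - a) \<le> C * s"
    if e: "e > 0" for e
  proof -
    obtain d where d: "d > 0" "\<And>y. dist y (G x) < d \<Longrightarrow> dist (H y) x < e"
      using contH e unfolding continuous_at_eps_delta HG by blast
    have "0 < min d dH" using d dH by simp
    then obtain y z s where yz: "y \<in> G ` M" "z \<in> G ` M" "norm (y - G x) < min d dH" "norm (z - G x) < min d dH" "0 < s"
        "norm (z - y - s *\<^sub>R v) \<le> \<rho> * s" using par by blast
    obtain a b where ab: "a \<in> M" "b \<in> M" "y = G a" "z = G b" using yz(1,2) by blast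
    have n: "norm (H z - H y - der H (G x) (z - y)) \<le> 1 * norm (z - y)"
      by (rule dH(2)) (use yz in \<open>auto simp: dist_norm norm_minus_commute\<close>)
    have "norm (z - y) \<le> norm (z - y - s *\<^sub>R v) + norm (s *\<^sub>R v)" by (metis diff_add_cancel norm_triangle_ineq)
    also have "\<dots> \<le> \<rho> * s + s * norm v" using yz by simp
    finally have zy: "norm (z - y) \<le> (norm v + \<rho>) * s" by (simp add: algebra_simps)
    have "norm (b - a) \<le> norm (H z - H y - der H (G x) (z - y)) + norm (der H (G x) (z - y))"
      unfolding ab(3,4) HG by (metis diff_add_cancel norm_triangle_ineq)
    also have "\<dots> \<le> 1 * norm (z - y) + norm (z - y) * KH" by (rule add_mono[OF n KH(2)])
    also have "\<dots> = (KH + 1) * norm (z - y)" by (simp add: algebra_simps)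
    also have "\<dots> \<le> (KH + 1) * ((norm v + \<rho>) * s)" using zy KH(1) by (intro mult_left_mono) auto
    finally have "norm (b - a) \<le> C * s" by (simp add: C_def mult.assoc)
    moreover have "dist a x < e" "dist b x < e" using d(2)[of y] d(2)[of z] yz ab HG by (auto simp: dist_norm)
    ultimately show ?thesis using ab yz(5,6) by blast
  qed
  then have "\<forall>n. \<exists>a b s. a \<in> M \<and> b \<in> M \<and> dist a x < inverse (real (Suc n)) \<and> dist b x < inverse (real (Suc n)) \<and> 0 < s \<and>
     norm (G b - G a - s *\<^sub>R v) \<le> \<rho> * s \<and> norm (b - a) \<le> C * s" by simp
  then obtain a b s where abs: "\<forall>n::nat. a n \<in> M \<and> b n \<in> M \<and> dist (a n) x < inverse (real (Suc n)) \<and> dist (b n) x < inverse (real (Suc n)) \<and> 0 < s n \<and>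
     norm (G (b n) - G (a n) - s n *\<^sub>R v) \<le> \<rho> * s n \<and> norm (b n - a n) \<le> C * s n" by metis
  define q where "q = (\<lambda>n. (1 / s n) *\<^sub>R (b n - a n))"
  have "q n \<in> cball 0 C" for n
  proof -
    have "norm (b n - a n) \<le> C * s n" "s n > 0" using abs by auto
    moreover from this have "norm (q n) = norm (b n - a n) / s n" unfolding q_def norm_scaleR by simp
    ultimately show ?thesis by (simp add: pos_divide_le_eq)
  qed
  then obtain u \<sigma> where u: "strict_mono (\<sigma> :: nat \<Rightarrow> nat)" "(q \<circ> \<sigma>) \<longlonglongrightarrow> u"
    using compact_cball[of "0::'a" C] unfolding compact_def by blast
  have key: "\<exists>a b s. a \<in> M \<and> b \<in> M \<and> dist a x < e \<and> dist b x < e \<and> 0 < s \<and> norm (b - a - s *\<^sub>R u) \<le> e * s \<and> norm (G b - G a - s *\<^sub>R v) \<le> \<rho> * s"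
    if e: "e > 0" for e
  proof -
    obtain n1 where n1: "\<forall>n\<ge>n1. dist (q (\<sigma> n)) u < e" using u(2) e unfolding lim_sequentially o_def by blast
    obtain n2 where n2: "inverse (real (Suc n2)) < e" using reals_Archimedean[OF e] by blast
    define n where "n = \<sigma> (max n1 n2)"
    have "n \<ge> n2" using seq_suble[OF u(1), of "max n1 n2"] by (simp add: n_def)
    then have "inverse (real (Suc n)) \<le> inverse (real (Suc n2))" by simp
    then have ine: "inverse (real (Suc n)) < e" using n2 by linarith
    have s: "s n > 0" using abs by blast
    have "norm (q n - u) < e" using n1 by (simp add: n_def dist_norm)
    then have "s n * norm (q n - u) \<le> s n * e" using s by (intro mult_left_mono) auto
    moreover have "b n - a n - s n *\<^sub>R u = s n *\<^sub>R (q n - u)" using s by (simp add: q_def scaleR_diff_right)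
    then have "norm (b n - a n - s n *\<^sub>R u) = s n * norm (q n - u)" using s by simp
    ultimately have "norm (b n - a n - s n *\<^sub>R u) \<le> e * s n" by (simp add: mult.commute)
    moreover have "dist (a n) x < e" "dist (b n) x < e" using abs ine by (meson order_less_trans)+
    ultimately show ?thesis using abs by blast
  qed
  have tan: "u \<in> tangent_space M x"
  proof -
    obtain U \<phi> where U: "(U, \<phi>) \<in> \<A>" "x \<in> U" using covered x .
    interpret chart E M U \<phi> by (rule chartI[OF U(1)])
    have "der \<phi> x u \<in> E" by (rule paratangent_limit[OF U(2) x]) (use key in blast)
    then show ?thesis using tangent_space_eq[OF U(2) x] by blast
  qed
  have lin: "linear (der G x)" using C1_open_linear[OF G UNIV_I] by (rule bounded_linear.linear)
  have Du: "norm (der G x u - v) \<le> \<rho>"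
  proof (rule field_le_epsilon)
    fix \<epsilon> :: real assume \<epsilon>: "\<epsilon> > 0"
    define e1 where "e1 = \<epsilon> / (2 * (norm u + 1))"
    have nu: "norm u + 1 > 0" by (intro add_nonneg_pos) auto
    have e1: "e1 > 0" using \<epsilon> nu by (simp add: e1_def)
    have e1': "e1 * (norm u + 1) = \<epsilon> / 2" using nu unfolding e1_def by (simp add: divide_simps)
    obtain d where d: "d > 0" "\<And>y z. y \<in> ball x d \<Longrightarrow> z \<in> ball x d \<Longrightarrow> norm (G z - G y - der G x (z - y)) \<le> e1 * norm (z - y)"
      using C1_open_strict[OF G UNIV_I e1, of x] by metis
    define e where "e = min (min d 1) (\<epsilon> / (2 * KG))"
    have e: "e > 0" "e \<le> d" "e \<le> 1" using d \<epsilon> KG by (auto simp: e_def)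
    have "e \<le> \<epsilon> / (2 * KG)" by (simp add: e_def)
    then have eK: "e * KG \<le> \<epsilon> / 2" using KG by (simp add: field_simps)
    obtain a b s where ab: "a \<in> M" "b \<in> M" "dist a x < e" "dist b x < e" "0 < s" "norm (b - a - s *\<^sub>R u) \<le> e * s" "norm (G b - G a - s *\<^sub>R v) \<le> \<rho> * s"
      using key[OF e(1)] by blast
    have n1: "norm (G b - G a - der G x (b - a)) \<le> e1 * norm (b - a)"
      by (rule d(2)) (use ab e in \<open>auto simp: dist_commute\<close>)
    have "norm (b - a) \<le> norm (b - a - s *\<^sub>R u) + norm (s *\<^sub>R u)" by (metis diff_add_cancel norm_triangle_ineq)
    also have "\<dots> \<le> e * s + s * norm u" using ab by simp
    also have "\<dots> \<le> (norm u + 1) * s" using e(3) ab(5) by (simp add: algebra_simps)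
    finally have ba: "norm (b - a) \<le> (norm u + 1) * s" .
    have "s *\<^sub>R (der G x u - v) = (G b - G a - s *\<^sub>R v) - (G b - G a - der G x (b - a)) - der G x (b - a - s *\<^sub>R u)"
      unfolding linear_diff[OF lin, of "b - a" "s *\<^sub>R u"] linear_cmul[OF lin] by (simp add: algebra_simps)
    then have "norm (s *\<^sub>R (der G x u - v)) \<le> norm ((G b - G a - s *\<^sub>R v) - (G b - G a - der G x (b - a))) + norm (der G x (b - a - s *\<^sub>R u))"
      by (simp only: norm_triangle_ineq4)
    also have "\<dots> \<le> (norm (G b - G a - s *\<^sub>R v) + norm (G b - G a - der G x (b - a))) + norm (b - a - s *\<^sub>R u) * KG"
      by (intro add_mono norm_triangle_ineq4 KG(2))
    also have "\<dots> \<le> (\<rho> * s + e1 * ((norm u + 1) * s)) + (e * s) * KG"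
    proof (intro add_mono ab(7))
      have "e1 * norm (b - a) \<le> e1 * ((norm u + 1) * s)" using ba e1 by (intro mult_left_mono) auto
      then show "norm (G b - G a - der G x (b - a)) \<le> e1 * ((norm u + 1) * s)" using n1 by linarith
      show "norm (b - a - s *\<^sub>R u) * KG \<le> (e * s) * KG" using ab(6) KG by (intro mult_right_mono) auto
    qed
    also have "\<dots> = (\<rho> + e1 * (norm u + 1) + e * KG) * s" by (simp add: algebra_simps)
    also have "\<dots> \<le> (\<rho> + \<epsilon>) * s" using eK e1' ab(5) by (intro mult_right_mono) auto
    finally have "s * norm (der G x u - v) \<le> s * (\<rho> + \<epsilon>)" using ab(5) by (simp add: mult.commute)
    then show "norm (der G x u - v) \<le> \<rho> + \<epsilon>" using ab(5) by simp
  qed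
  have nu: "norm u + 1 > 0" by (intro add_nonneg_pos) auto
  define \<epsilon> where "\<epsilon> = \<rho> / (2 * (norm u + 1))"
  have \<epsilon>: "\<epsilon> > 0" using nu \<rho> by (simp add: \<epsilon>_def)
  have \<epsilon>': "\<epsilon> * (norm u + 1) = \<rho> / 2" using nu unfolding \<epsilon>_def by (simp add: divide_simps)
  obtain d where d: "d > 0" "\<And>y z. y \<in> ball x d \<Longrightarrow> z \<in> ball x d \<Longrightarrow> norm (G z - G y - der G x (z - y)) \<le> \<epsilon> * norm (z - y)"
    using C1_open_strict[OF G UNIV_I \<epsilon>, of x] by metis
  have contG: "isCont G x" using C1_open_continuous[OF G] by (simp add: continuous_on_eq_continuous_at)
  obtain d' where d': "d' > 0" "\<And>y. dist y x < d' \<Longrightarrow> dist (G y) (G x) < r0"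
    using contG r0 unfolding continuous_at_eps_delta by blast
  define k where "k = norm u + 2"
  have k: "k \<ge> 1" by (simp add: k_def)
  define r where "r = min (min 1 r0) (min (\<rho> / (2 * KG)) (min d d' / k))"
  have r: "r > 0" "r \<le> 1" "r \<le> r0" "r \<le> \<rho> / (2 * KG)" "r \<le> min d d' / k" using r0 \<rho> KG d d' k by (auto simp: r_def)
  have rk: "r * k \<le> d" "r * k \<le> d'" using r(5) k by (auto simp: pos_le_divide_eq)
  have rK: "r * KG \<le> \<rho> / 2" using r(4) KG by (simp add: field_simps)
  have "(1/2) * s \<le> f z - f y"
    if h: "y \<in> M" "z \<in> M" "dist y x < r" "0 < s" "s < r" "norm (z - y - s *\<^sub>R u) \<le> r * s" for y z s
  proof -
    have "norm (z - y) \<le> norm (z - y - s *\<^sub>R u) + norm (s *\<^sub>R u)" by (metis diff_add_cancel norm_triangle_ineq)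
    also have "\<dots> \<le> r * s + s * norm u" using h by simp
    also have "\<dots> \<le> (norm u + 1) * s" using r(2) h(4) by (simp add: algebra_simps)
    finally have zy: "norm (z - y) \<le> (norm u + 1) * s" .
    also have "\<dots> \<le> (norm u + 1) * r" using h(5) nu by (intro mult_left_mono) auto
    finally have "dist z x < (norm u + 1) * r + r" using dist_triangle[of z x y] h(3) by (simp add: dist_norm)
    then have zx: "dist z x < r * k" by (simp add: k_def algebra_simps)
    have "r * 1 \<le> r * k" using r(1) k by (intro mult_left_mono) auto
    then have yx: "dist y x < r * k" using h(3) by simp
    have n1: "norm (G z - G y - der G x (z - y)) \<le> \<epsilon> * norm (z - y)"
      by (rule d(2)) (use zx yx rk in \<open>auto simp: dist_commute\<close>)
    have "G z - G y - s *\<^sub>R v = (G z - G y - der G x (z - y)) + (der G x (z - y - s *\<^sub>R u) + s *\<^sub>R (der G x u - v))"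
      unfolding linear_diff[OF lin, of "z - y" "s *\<^sub>R u"] linear_cmul[OF lin] by (simp add: algebra_simps)
    also have "norm \<dots> \<le> \<epsilon> * ((norm u + 1) * s) + ((r * s) * KG + s * \<rho>)"
    proof (intro norm_triangle_mono)
      have "\<epsilon> * norm (z - y) \<le> \<epsilon> * ((norm u + 1) * s)" using zy \<epsilon> by (intro mult_left_mono) auto
      then show "norm (G z - G y - der G x (z - y)) \<le> \<epsilon> * ((norm u + 1) * s)" using n1 by linarith
      have "norm (z - y - s *\<^sub>R u) * KG \<le> (r * s) * KG" using h(6) KG by (intro mult_right_mono) auto
      then show "norm (der G x (z - y - s *\<^sub>R u)) \<le> (r * s) * KG" using KG(2)[of "z - y - s *\<^sub>R u"] by linarith
      show "norm (s *\<^sub>R (der G x u - v)) \<le> s * \<rho>" using Du h(4) by simp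
    qed
    also have "\<dots> = (\<epsilon> * (norm u + 1) + r * KG + \<rho>) * s" by (simp add: algebra_simps)
    also have "\<dots> \<le> (2 * \<rho>) * s" using rK \<epsilon>' h(4) by (intro mult_right_mono) auto
    finally have n: "norm (G z - G y - s *\<^sub>R v) \<le> (2 * \<rho>) * s" .
    have "norm (G y - G x) < r0" "norm (G z - G x) < r0" using d'(2)[of y] d'(2)[of z] yx zx rk(2) by (auto simp: dist_norm)
    moreover have "s < r0" using h(5) r(3) by simp
    ultimately have "(1/2) * s \<le> g (G z) - g (G y)" using cone h(1,2,4) n by blast
    then show ?thesis using g h(1,2) by simp
  qed
  then have "uphill_cone M f x u r (1/2)" using r(1) by (intro uphill_coneI) blast+
  then show ?thesis using tan by blast
qed

lemma open_dense_alternative: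
  assumes "openin S A"
  shows "openin S (A \<union> (topspace S - S closure_of A))" "S closure_of (A \<union> (topspace S - S closure_of A)) = topspace S"
proof -
  show "openin S (A \<union> (topspace S - S closure_of A))"
    by (rule openin_Un[OF assms openin_diff[OF openin_topspace closedin_closure_of]])
  define B where "B = topspace S - S closure_of A"
  have "B \<subseteq> S closure_of B" by (rule closure_of_subset) (simp add: B_def)
  then have "topspace S \<subseteq> S closure_of A \<union> S closure_of B" unfolding B_def by blast
  moreover have "S closure_of (A \<union> B) = S closure_of A \<union> S closure_of B" by (rule closure_of_Un)
  ultimately have "topspace S \<subseteq> S closure_of (A \<union> B)" by (simp only:)
  then show "S closure_of (A \<union> (topspace S - S closure_of A)) = topspace S"
    unfolding B_def using closure_of_subset_topspace[of S] by (rule subset_antisym[rotated])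
qed

lemma topspaceT: "topspace T = VF"
  by (rule topspace_C1_topology[OF atlas nonempty])

text \<open>The condition says that every field outside \<open>S\<close> has a Lipschitz first integral with a level all of whose points
  carry a tangent cone of ascent.\<close>

lemma residual_without_regular_level:
  assumes "\<And>X. X \<in> VF \<Longrightarrow> X \<notin> S \<Longrightarrow> \<exists>f L t m. first_integral M X f \<and> L-lipschitz_on M f \<and> t \<in> f ` M \<and> 0 < (m::real) \<and>
      (\<forall>x\<in>M. f x = t \<longrightarrow> (\<exists>u\<in>tangent_space M x. \<exists>r. uphill_cone M f x u r m))"
    and "S \<subseteq> VF"
  shows "residual_in T S"
proof -
  obtain \<B> :: "'a set set" where B: "countable \<B>" "topological_basis \<B>" using ex_countable_basis by blast
  define \<R> where "\<R> = Union ` {\<F>. finite \<F> \<and> \<F> \<subseteq> \<B>}"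
  have countR: "countable \<R>" unfolding \<R>_def
    using countable_Collect_finite_subset[OF B(1)] by (intro countable_image) (simp add: conj_commute)
  define D where "D = (\<lambda>R. rising R \<union> (topspace T - T closure_of rising R))"
  have "X \<in> S" if X: "X \<in> topspace T \<inter> \<Inter>(D ` \<R>)" for X
  proof (rule ccontr)
    assume "X \<notin> S"
    have XVF: "X \<in> VF" using X topspaceT by blast
    obtain f L t m where f: "first_integral M X f" "L-lipschitz_on M f" "t \<in> f ` M" "0 < (m::real)" and
      cone: "\<forall>x\<in>M. f x = t \<longrightarrow> (\<exists>u\<in>tangent_space M x. \<exists>r. uphill_cone M f x u r m)"
      using assms(1)[OF XVF \<open>X \<notin> S\<close>] by blast
    define K where "K = {x \<in> M. f x = t}"
    have fc: "continuous_on M f" using f(2) by (rule lipschitz_on_continuous_on)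
    have "K = M \<inter> f -` {t}" by (auto simp: K_def)
    then have "closed K" using continuous_closed_preimage[OF fc compact_imp_closed[OF compactM] closed_singleton] by simp
    then have K: "compact K" using compact_Int_closed[OF compactM, of K] by (simp add: K_def Int_absorb1 Collect_subset)
    have KM: "K \<subseteq> M" by (auto simp: K_def)
    have "\<exists>u\<in>tangent_space M x. \<exists>r. uphill_cone M f x u r m" if "x \<in> K" for x
      using cone that unfolding K_def by blast
    from ascending_field[OF f(2) K KM f(4) this] obtain V W c where V: "V \<in> VF" and W: "open W" "K \<subseteq> W" and
      c: "c > 0" "\<forall>x\<in>M \<inter> W. ascends M f x (V x) c" by blast
    obtain \<B>' where B': "\<B>' \<subseteq> \<B>" "\<Union>\<B>' = W" using B(2) W(1) unfolding topological_basis_def by blast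
    have "\<And>Q. Q \<in> \<B>' \<Longrightarrow> open Q" using B' topological_basis_open[OF B(2)] by blast
    then obtain \<F> where F: "\<F> \<subseteq> \<B>'" "finite \<F>" "K \<subseteq> \<Union>\<F>" using compactE[OF K, of \<B>'] W(2) B'(2) by metis
    define R where "R = \<Union>\<F>"
    have RR: "R \<in> \<R>" unfolding \<R>_def R_def using F B' by blast
    have RW: "R \<subseteq> W" unfolding R_def using F B' by blast
    have "X \<in> T closure_of rising R"
      unfolding in_closure_of
    proof (intro conjI allI impI)
      show "X \<in> topspace T" using X by blast
      fix P assume "X \<in> P \<and> openin T P"
      then obtain \<eta>0 where \<eta>0: "\<eta>0 > 0" "\<forall>\<eta>. 0 < \<eta> \<and> \<eta> < \<eta>0 \<longrightarrow> (\<lambda>x\<in>M. X x + \<eta> *\<^sub>R V x) \<in> P"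
        using perturbation_in_open[OF _ _ XVF V] by blast
      define \<eta> where "\<eta> = \<eta>0 / 2"
      have \<eta>: "0 < \<eta>" "\<eta> < \<eta>0" using \<eta>0(1) by (auto simp: \<eta>_def)
      define Y where "Y = (\<lambda>x\<in>M. X x + \<eta> *\<^sub>R V x)"
      have YP: "Y \<in> P" unfolding Y_def using \<eta>0(2) \<eta> by blast
      have YVF: "Y \<in> VF" unfolding Y_def by (rule VF_lincomb[OF XVF V])
      have "\<exists>\<delta>>0. \<forall>z\<in>M. \<forall>s. 0 < s \<longrightarrow> s < \<delta> \<longrightarrow> norm (z - x - s *\<^sub>R Y x) \<le> \<delta> * s \<longrightarrow> (\<eta> * c / 2) * s \<le> f z - f x"
        if x: "x \<in> M \<inter> R" for x
      proof -
        have xM: "x \<in> M" and xW: "x \<in> M \<inter> W" using x RW by auto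
        have "ascends M f x (\<eta> *\<^sub>R V x) (\<eta> * c)" using ascends_scale[OF f(2)] c(2) xW \<eta>(1) by simp
        then have asc: "ascends M f x (Y x) (0 + \<eta> * c)"
          using ascends_add[OF xM VF_tangent[OF XVF xM] first_integral_ascends[OF XVF f(1,2) xM]] xM by (simp add: Y_def)
        have "\<eta> * c / 2 > 0" using \<eta> c by simp
        then obtain \<delta> where "uphill_cone M f x (Y x) \<delta> (0 + \<eta> * c - \<eta> * c / 2)" using ascendsD[OF asc] by blast
        moreover have "0 + \<eta> * c - \<eta> * c / 2 = \<eta> * c / 2" by simp
        ultimately have \<delta>: "uphill_cone M f x (Y x) \<delta> (\<eta> * c / 2)" by simp
        then have "dist x x < \<delta>" using uphill_coneD(1) by simp
        then show ?thesis using uphill_coneD[OF \<delta>] xM by (intro exI[of _ \<delta>]) blast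
      qed
      moreover have "0 < \<eta> * c / 2" using \<eta> c by simp
      ultimately have "Y \<in> rising R" unfolding rising_def using YVF f(2) by blast
      then show "\<exists>y. y \<in> rising R \<and> y \<in> P" using YP by blast
    qed
    then have XR: "X \<in> rising R" using X RR unfolding D_def by blast
    obtain x0 where x0: "x0 \<in> M" "f x0 = t" using f(3) by blast
    obtain \<gamma> where \<gamma>: "integral_curve M X \<gamma>" "\<gamma> 0 = x0" using VF_integral_curve[OF XVF x0(1)] .
    have "range \<gamma> \<in> orbits M X" using \<gamma>(1) unfolding orbits_def by blast
    then have "f constant_on range \<gamma>" using f(1) unfolding first_integral_def by blast
    then have "f (\<gamma> s) = t" for s using \<gamma>(2) x0(2) unfolding constant_on_def by (metis rangeI)
    moreover have "\<gamma> s \<in> M" for s using \<gamma>(1) unfolding integral_curve_def by blast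
    ultimately have "range \<gamma> \<subseteq> K" by (auto simp: K_def)
    then have "range \<gamma> \<subseteq> R" using F(3) unfolding R_def by blast
    then show False by (rule integral_curve_leaves[OF XR \<gamma>(1)])
  qed
  moreover have "openin T Q \<and> T closure_of Q = topspace T" if "Q \<in> D ` \<R>" for Q
    using that open_dense_alternative[OF openin_rising] unfolding D_def by auto
  moreover have "countable (D ` \<R>)" using countR by (rule countable_image)
  ultimately show ?thesis unfolding residual_in_def topspaceT using assms(2) by (intro conjI exI[of _ "D ` \<R>"]) (auto simp: topspaceT)
qed

end

lemma C1_lipschitz_on_bounded:
  fixes H :: "'a::euclidean_space \<Rightarrow> 'b::real_normed_vector"
  assumes H: "C1_open UNIV H" and "bounded N"
  shows "\<exists>L\<ge>0. \<forall>y\<in>N. \<forall>z\<in>N. norm (H z - H y) \<le> L * norm (z - y)"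
proof -
  obtain r where "\<forall>y\<in>N. norm y \<le> r" using assms(2) unfolding bounded_iff by blast
  then have r: "y \<in> cball 0 r" if "y \<in> N" for y using that by simp
  obtain H' where H': "\<And>x. (H has_derivative blinfun_apply (H' x)) (at x)" "continuous_on UNIV H'"
    using H unfolding C1_open_def by blast
  have "bounded (H' ` cball 0 r)"
    by (rule compact_imp_bounded[OF compact_continuous_image[OF continuous_on_subset[OF H'(2)] compact_cball]]) simp
  then obtain L where L: "L > 0" "\<forall>A\<in>H' ` cball 0 r. norm A \<le> L" unfolding bounded_pos by blast
  have "norm (H z - H y) \<le> L * norm (z - y)" if "y \<in> N" "z \<in> N" for y z
  proof (rule differentiable_bound[OF convex_cball, where f' = "\<lambda>x. blinfun_apply (H' x)"])
    show "(H has_derivative blinfun_apply (H' x)) (at x within cball 0 r)" for x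
      by (rule has_derivative_at_withinI[OF H'(1)])
    show "onorm (blinfun_apply (H' x)) \<le> L" if "x \<in> cball 0 r" for x
      using L(2) that unfolding norm_blinfun.rep_eq by blast
  qed (rule r[OF that(2)], rule r[OF that(1)])
  then show ?thesis using L(1) by (intro exI[of _ L]) auto
qed

theorem theorem2p7:
  fixes M N E :: "(real ^ 'n::{finite,linorder}) set"
    and \<A> :: "((real ^ 'n::{finite,linorder}) set \<times> (real ^ 'n::{finite,linorder} \<Rightarrow> real ^ 'n::{finite,linorder})) set"
    and F :: "real ^ 'n::{finite,linorder} \<Rightarrow> real ^ 'n::{finite,linorder}"
    and \<epsilon> :: real
  assumes "compact M" and "connected M" and "M \<noteq> {}" and "C1_submanifold M"
    and "C2_atlas E M \<A>"
    and "0 < \<epsilon>"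
    and "definable_eps_approximation \<epsilon> M N F"
  shows "residual_in (C1_topology E M \<A>)
    {X \<in> C1_vector_fields M \<A>.
       \<not> (\<exists>f :: real ^ 'n::{finite,linorder} \<Rightarrow> real.
            first_integral M X f \<and> (\<exists>L. L-lipschitz_on M f) \<and> essentially_o_minimal M N F f)}"
proof -
  interpret atlas_manifold E M \<A> using assms by unfold_locales
  obtain G where G: "C1_diffeo UNIV UNIV G" "\<forall>x\<in>M. G x = F x" and F: "C1_diffeo M N F"
    using assms(7) unfolding definable_eps_approximation_def eps_approximation_def by blast
  define H where "H = inv_into UNIV G"
  have bijG: "bij G" and C1G: "C1_open UNIV G" and C1H: "C1_open UNIV H"
    using G(1) C1_on_open[OF _ open_UNIV] unfolding C1_diffeo_def H_def by auto
  have HG: "H (G x) = x" for x unfolding H_def using bijG by (simp add: bij_is_inj)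
  have bijF: "bij_betw F M N" using F by (simp add: C1_diffeo_def)
  have NG: "N = G ` M" using bijF G(2) unfolding bij_betw_def by auto
  have invF: "inv_into M F (G x) = x" if "x \<in> M" for x
    using bijF G(2) that by (simp add: bij_betw_def)
  have "compact N" unfolding NG
    by (rule compact_continuous_image[OF continuous_on_subset[OF C1_open_continuous[OF C1G]] compactM]) simp
  then have bN: "bounded N" by (rule compact_imp_bounded)
  show ?thesis
  proof (rule residual_without_regular_level)
    fix X assume "X \<in> VF" and X: "X \<notin> {X \<in> C1_vector_fields M \<A>.
       \<not> (\<exists>f :: (real, 'n) vec \<Rightarrow> real. first_integral M X f \<and> (\<exists>L. L-lipschitz_on M f) \<and> essentially_o_minimal M N F f)}"
    then obtain f L where f: "first_integral M X f" "L-lipschitz_on M f" "essentially_o_minimal M N F f" by blast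
    obtain \<O> where O: "o_minimal_structure \<O>" "definable_fun \<O> N (f \<circ> inv_into M F)"
      using f(3) unfolding essentially_o_minimal_def o_minimal_fun_def by blast
    interpret omin \<O> by unfold_locales (rule O(1))
    \<comment> \<open>extended by 0, so that it is a definable map on the whole space\<close>
    define g where "g = (\<lambda>y. if y \<in> N then f (inv_into M F y) else 0)"
    have gG: "g (G x) = f x" if "x \<in> M" for x using that invF by (simp add: g_def NG)
    note graph = definable_graph[OF O(2)]
    have dN: "definable_pred (\<lambda>x. x \<in> N)"
    proof -
      have "definable_pred (\<lambda>x. \<exists>t. x \<in> N \<and> t = (f \<circ> inv_into M F) x)"
        by (rule definable_ex) (rule graph)
      then show ?thesis by simp
    qed
    have dg: "definable_map g"
    proof -
      have "definable_pred (\<lambda>p. (fst p \<in> N \<and> snd p = (f \<circ> inv_into M F) (fst p)) \<or> (\<not> fst p \<in> N \<and> snd p = 0))"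
        by (intro definable_disj graph definable_conj definable_not definable_subst[OF dN] definable_eq definable_map_intros)
      moreover have "(fst p \<in> N \<and> snd p = (f \<circ> inv_into M F) (fst p)) \<or> (\<not> fst p \<in> N \<and> snd p = 0) \<longleftrightarrow> snd p = g (fst p)" for p
        by (simp add: g_def)
      ultimately show ?thesis unfolding definable_map_def by simp
    qed
    obtain LH where LH: "LH \<ge> 0" "\<forall>y\<in>N. \<forall>z\<in>N. norm (H z - H y) \<le> LH * norm (z - y)"
      using C1_lipschitz_on_bounded[OF C1H bN] by blast
    have L0: "L \<ge> 0" using f(2) by (rule lipschitz_on_nonneg)
    have lipg: "\<bar>g z - g y\<bar> \<le> (L * LH) * norm (z - y)" if yz: "y \<in> N" "z \<in> N" for y z
    proof -
      obtain a b where ab: "a \<in> M" "b \<in> M" "y = G a" "z = G b" using yz unfolding NG by blast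
      have "\<bar>f b - f a\<bar> \<le> L * norm (b - a)" using lipschitz_onD[OF f(2) ab(2,1)] by (simp add: dist_real_def dist_norm)
      also have "norm (b - a) \<le> LH * norm (z - y)" using LH(2)[rule_format, OF yz] unfolding ab(3,4) HG .
      then have "L * norm (b - a) \<le> L * (LH * norm (z - y))" using L0 by (rule mult_left_mono)
      finally show ?thesis using ab gG by (simp add: mult.assoc)
    qed
    have LL: "L * LH \<ge> 0" using L0 LH(1) by simp
    \<comment> \<open>the added 1 covers the case of a vanishing Lipschitz constant\<close>
    define \<rho> where "\<rho> = 1 / (16 * (L * LH + 1))"
    have \<rho>: "\<rho> > 0" using LL by (simp add: \<rho>_def)
    have "16 * \<rho> * (L * LH) \<le> 16 * \<rho> * (L * LH + 1)" using \<rho> by simp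
    also have "\<dots> = 1" using LL by (simp add: \<rho>_def)
    finally have fin: "finite (g ` {y \<in> N. \<not> regular_point \<rho> N g y})"
      by (intro finite_critical_values[OF dN dg bN lipg LL \<rho>])
    \<comment> \<open>\<open>M\<close> is connected and \<open>f\<close> is not constant on the open set \<open>M\<close>, so there are infinitely many levels\<close>
    have "infinite (f ` M)"
    proof -
      have "\<not> f constant_on M" using f(1) nonempty unfolding first_integral_def by (metis openin_subtopology_self)
      then obtain x1 x2 where x12: "x1 \<in> M" "x2 \<in> M" "f x1 < f x2" unfolding constant_on_def by (metis linorder_neqE_linordered_idom)
      have "connected (f ` M)"
        using connected_continuous_image[OF lipschitz_on_continuous_on[OF f(2)] assms(2)] .
      then have "{f x1..f x2} \<subseteq> f ` M" using x12 by (intro connected_contains_Icc) auto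
      then show ?thesis using x12(3) infinite_Icc finite_subset by blast
    qed
    then have "\<not> f ` M \<subseteq> g ` {y \<in> N. \<not> regular_point \<rho> N g y}" using fin finite_subset by blast
    then obtain t where t: "t \<in> f ` M" "t \<notin> g ` {y \<in> N. \<not> regular_point \<rho> N g y}" by blast
    have "\<exists>u\<in>tangent_space M x. \<exists>r. uphill_cone M f x u r (1/2)" if x: "x \<in> M" "f x = t" for x
    proof (rule cone_from_regular_point[where G = G and H = H and g = g and \<rho> = \<rho>])
      show "x \<in> M" "C1_open UNIV G" "C1_open UNIV H" "0 < \<rho>" by fact+
      show "H (G y) = y" for y by (rule HG)
      show "g (G y) = f y" if "y \<in> M" for y using gG[OF that] .
      show "regular_point \<rho> (G ` M) g (G x)"
      proof (rule ccontr)
        assume "\<not> regular_point \<rho> (G ` M) g (G x)"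
        then have "G x \<in> {y \<in> N. \<not> regular_point \<rho> N g y}" using x unfolding NG by blast
        then have "g (G x) \<in> g ` {y \<in> N. \<not> regular_point \<rho> N g y}" by (rule imageI)
        then show False using t(2) gG[OF x(1)] x(2) by simp
      qed
    qed
    moreover have "0 < (1/2::real)" by simp
    ultimately show "\<exists>f L t m. first_integral M X f \<and> L-lipschitz_on M f \<and> t \<in> f ` M \<and> 0 < (m::real) \<and>
      (\<forall>x\<in>M. f x = t \<longrightarrow> (\<exists>u\<in>tangent_space M x. \<exists>r. uphill_cone M f x u r m))"
      using f(1,2) t(1) by blast
  qed blast
qed

end
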